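(* Let $-A$ be the generator of a $C_0$-semigroup $(T(t))_{t\ge 0}$ on a Banach space $X$ such that $\mathbb{C}_-\subseteq\rho(A)$. Assume that one of the following conditions holds: (1) $X$ is a Hilbert space; (2) $(T(t))_{t\ge0}$ is an asymptotically analytic semigroup; (3) $X=L^p(\Omega)$ for some $p\in[1,\infty)$ and some measure space $\Omega$, and $T(t)$ is a positive operator for all $t\ge0$; (4) $X$ is a Banach lattice which is a closed subspace of $C_b(\Omega)$ for some topological space $\Omega$, such that either $\mathbf{1}_\Omega\in X$ or $X$ is a sublattice of $C_b(\Omega)$, and $T(t)$ is a positive operator for all $t\ge0$. If there exist $\alpha\in[0,\infty)$ and $K\ge1$ such that $$\|(\lambda+A)^{-1}\|_{\mathcal{L}(X)}\le K\big(\mathrm{Re}(\lambda)^{-\alpha}+1\big)\qquad(\lambda\in\mathbb{C}_+),$$ then there exists a $C\ge0$ such that $$\|T(t)\|_{\mathcal{L}(X)}\le CK(t^\alpha+1)\qquad(t\ge0).$$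
   Context: Banach spaces are nonzero and over $\mathbb{C}$; $\mathcal{L}(X)$ is the space of bounded operators on $X$. $\mathbb{C}_+=\{\lambda\in\mathbb{C}:\mathrm{Re}(\lambda)>0\}$, $\mathbb{C}_-=-\mathbb{C}_+$; $\rho(A)$ is the resolvent set of $A$. Asymptotically analytic semigroups: the non-analytic growth bound of a $C_0$-semigroup $T$ on $X$ is $$\zeta(T)=\inf\Big\{\omega\in\mathbb{R}:\ \sup_{t>0}e^{-\omega t}\|T(t)-S(t)\|_{\mathcal L(X)}<\infty\ \text{for some } S\in\mathcal{H}(\mathcal{L}(X))\Big\},$$ where $\mathcal{H}(\mathcal{L}(X))$ is the set of all $S:(0,\infty)\to\mathcal{L}(X)$ having an exponentially bounded analytic extension to some sector containing $(0,\infty)$. The semigroup is asymptotically analytic if $\zeta(T)<0$. Lattices: $C_b(\Omega)$ is the space of bounded continuous complex-valued functions on $\Omega$ with the supremum norm and pointwise order. Complex Banach lattices are complexifications of real ones; in (4) the order and norm of $X$ are those inherited from $C_b(\Omega)$, and $X=X_{\mathbb{R}}+iX_{\mathbb{R}}$ with $X_{\mathbb{R}}$ the set of real-valued functions in $X$. $X$ is a sublattice of $C_b(\Omega)$ if $x\vee y,x\wedge y\in X$ (pointwise maximum and minimum) for all real-valued $x,y\in X$. An operator is positive if it maps nonnegative elements to nonnegative elements. *)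

theory Defs
  imports "HOL-Analysis.Analysis"
begin

section \<open>Complex normed spaces\<close>

class scaleC =
  fixes scaleC :: "complex \<Rightarrow> 'a \<Rightarrow> 'a"  (infixr \<open>*\<^sub>C\<close> 75)

class complex_normed_vector = real_normed_vector + scaleC +
  assumes scaleC_add_right: "c *\<^sub>C (x + y) = c *\<^sub>C x + c *\<^sub>C y"
    and scaleC_add_left: "(c + d) *\<^sub>C x = c *\<^sub>C x + d *\<^sub>C x"
    and scaleC_scaleC: "c *\<^sub>C (d *\<^sub>C x) = (c * d) *\<^sub>C x"
    and scaleR_scaleC: "r *\<^sub>R x = complex_of_real r *\<^sub>C x"
    and norm_scaleC: "norm (c *\<^sub>C x) = cmod c * norm x"

text \<open>A complex Banach space is a type of sort
  \<open>{complex_normed_vector, banach}\<close>.\<close>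

instantiation complex :: complex_normed_vector
begin
definition scaleC_complex :: "complex \<Rightarrow> complex \<Rightarrow> complex" where
  "scaleC_complex c x = c * x"
instance
  by standard
    (auto simp: scaleC_complex_def algebra_simps scaleR_conv_of_real norm_mult)
end

lemma scaleC_one [simp]: "1 *\<^sub>C x = x" for x :: "'a :: complex_normed_vector"
  using scaleR_scaleC[of 1 x] by simp

lemma bounded_linear_scaleC: "bounded_linear (\<lambda>x :: 'a :: complex_normed_vector. c *\<^sub>C x)"
proof (rule bounded_linear_intro[where K = "cmod c"])
  fix x y :: 'a and r :: real
  show "c *\<^sub>C (x + y) = c *\<^sub>C x + c *\<^sub>C y" by (rule scaleC_add_right)
  show "c *\<^sub>C (r *\<^sub>R x) = r *\<^sub>R (c *\<^sub>C x)"
    by (simp add: scaleR_scaleC scaleC_scaleC mult.commute)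
  show "norm (c *\<^sub>C x) \<le> norm x * cmod c"
    by (simp add: norm_scaleC mult.commute)
qed

instantiation blinfun :: (real_normed_vector, complex_normed_vector) complex_normed_vector
begin
lift_definition scaleC_blinfun :: "complex \<Rightarrow> ('a \<Rightarrow>\<^sub>L 'b) \<Rightarrow> ('a \<Rightarrow>\<^sub>L 'b)" is
  "\<lambda>c f x. c *\<^sub>C f x"
  by (rule bounded_linear_compose[OF bounded_linear_scaleC])
instance
proof
  fix c d :: complex and r :: real and f g :: "'a \<Rightarrow>\<^sub>L 'b"
  show "c *\<^sub>C (f + g) = c *\<^sub>C f + c *\<^sub>C g"
    by transfer (simp add: scaleC_add_right)
  show "(c + d) *\<^sub>C f = c *\<^sub>C f + d *\<^sub>C f"
    by transfer (simp add: scaleC_add_left)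
  show "c *\<^sub>C (d *\<^sub>C f) = (c * d) *\<^sub>C f"
    by transfer (simp add: scaleC_scaleC)
  show "r *\<^sub>R f = complex_of_real r *\<^sub>C f"
    by transfer (simp add: scaleR_scaleC)
  have le: "norm (c *\<^sub>C f) \<le> cmod c * norm f" for c and f :: "'a \<Rightarrow>\<^sub>L 'b"
  proof (rule norm_blinfun_bound)
    fix x
    have "norm (blinfun_apply (c *\<^sub>C f) x) = cmod c * norm (blinfun_apply f x)"
      by (simp add: scaleC_blinfun.rep_eq norm_scaleC)
    also have "\<dots> \<le> cmod c * (norm f * norm x)"
      by (intro mult_left_mono norm_blinfun) auto
    finally show "norm (blinfun_apply (c *\<^sub>C f) x) \<le> cmod c * norm f * norm x"
      by (simp add: mult.assoc)
  qed simp
  show "norm (c *\<^sub>C f) = cmod c * norm f"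
  proof (cases "c = 0")
    case True
    then show ?thesis using le[of 0 f] by simp
  next
    case False
    have "inverse c *\<^sub>C (c *\<^sub>C f) = 1 *\<^sub>R f"
      using False by transfer (simp add: scaleC_scaleC scaleR_scaleC)
    then have "norm f \<le> cmod (inverse c) * norm (c *\<^sub>C f)"
      using le[of "inverse c" "c *\<^sub>C f"] by simp
    then have "cmod c * norm f \<le> norm (c *\<^sub>C f)"
      using False by (simp add: norm_divide field_simps)
    then show ?thesis using le[of c f] by simp
  qed
qed
end

instantiation bcontfun :: (topological_space, complex_normed_vector) complex_normed_vector
begin
definition scaleC_bcontfun :: "complex \<Rightarrow> ('a \<Rightarrow>\<^sub>C 'b) \<Rightarrow> ('a \<Rightarrow>\<^sub>C 'b)" where
  "scaleC_bcontfun c f = Bcontfun (\<lambda>x. c *\<^sub>C f x)"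
lemma scaleC_bcontfun_apply: "(c *\<^sub>C f) x = c *\<^sub>C f x"
  for f :: "'a \<Rightarrow>\<^sub>C 'b"
proof -
  have "range (\<lambda>x. c *\<^sub>C f x) = (\<lambda>y. c *\<^sub>C y) ` range f" by auto
  then have "(\<lambda>x. c *\<^sub>C f x) \<in> bcontfun"
    using apply_bcontfun[of f] bounded_linear_image[OF _ bounded_linear_scaleC, of "range f" c]
      bounded_linear.continuous_on[OF bounded_linear_scaleC, of UNIV f c]
    by (auto simp: bcontfun_def)
  then show ?thesis by (simp add: scaleC_bcontfun_def Bcontfun_inverse)
qed
instance
proof
  fix c d :: complex and r :: real and f g :: "'a \<Rightarrow>\<^sub>C 'b"
  show "c *\<^sub>C (f + g) = c *\<^sub>C f + c *\<^sub>C g"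
    by (rule bcontfun_eqI) (simp add: scaleC_bcontfun_apply plus_bcontfun.rep_eq scaleR_bcontfun.rep_eq scaleC_add_right)
  show "(c + d) *\<^sub>C f = c *\<^sub>C f + d *\<^sub>C f"
    by (rule bcontfun_eqI) (simp add: scaleC_bcontfun_apply plus_bcontfun.rep_eq scaleR_bcontfun.rep_eq scaleC_add_left)
  show "c *\<^sub>C (d *\<^sub>C f) = (c * d) *\<^sub>C f"
    by (rule bcontfun_eqI) (simp add: scaleC_bcontfun_apply plus_bcontfun.rep_eq scaleR_bcontfun.rep_eq scaleC_scaleC)
  show "r *\<^sub>R f = complex_of_real r *\<^sub>C f"
    by (rule bcontfun_eqI) (simp add: scaleC_bcontfun_apply plus_bcontfun.rep_eq scaleR_bcontfun.rep_eq scaleR_scaleC)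
  have le: "norm (c *\<^sub>C f) \<le> cmod c * norm f" for c and f :: "'a \<Rightarrow>\<^sub>C 'b"
    by (rule norm_bound)
      (auto simp: scaleC_bcontfun_apply norm_scaleC intro!: mult_left_mono norm_bounded)
  show "norm (c *\<^sub>C f) = cmod c * norm f"
  proof (cases "c = 0")
    case True
    then show ?thesis using le[of 0 f] by simp
  next
    case False
    have "inverse c *\<^sub>C (c *\<^sub>C f) = 1 *\<^sub>R f"
      by (rule bcontfun_eqI) (simp add: scaleC_bcontfun_apply plus_bcontfun.rep_eq scaleR_bcontfun.rep_eq scaleC_scaleC scaleR_scaleC False)
    then have "norm f \<le> cmod (inverse c) * norm (c *\<^sub>C f)"
      using le[of "inverse c" "c *\<^sub>C f"] by simp
    then have "cmod c * norm f \<le> norm (c *\<^sub>C f)"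
      using False by (simp add: norm_divide field_simps)
    then show ?thesis using le[of c f] by simp
  qed
qed
end

text \<open>The library's \<open>'a \<Rightarrow>\<^sub>L 'b\<close> consists of the real-linear bounded operators.  The complex-linear
  ones are singled out by the following predicate; their operator norm is the one of the library.\<close>

definition bounded_clinear ::
    "('a :: complex_normed_vector \<Rightarrow> 'b :: complex_normed_vector) \<Rightarrow> bool" where
  "bounded_clinear f \<longleftrightarrow> bounded_linear f \<and> (\<forall>c x. f (c *\<^sub>C x) = c *\<^sub>C f x)"


section \<open>Semigroups, generators, resolvents\<close>

text \<open>Only the values \<open>T t\<close> with \<open>t \<ge> 0\<close> matter.\<close>

definition C0_semigroup ::
    "(real \<Rightarrow> 'a :: {complex_normed_vector, banach} \<Rightarrow>\<^sub>L 'a) \<Rightarrow> bool" where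
  "C0_semigroup T \<longleftrightarrow>
     (\<forall>t\<ge>0. bounded_clinear (blinfun_apply (T t))) \<and>
     T 0 = id_blinfun \<and>
     (\<forall>s\<ge>0. \<forall>t\<ge>0. T (s + t) = T s o\<^sub>L T t) \<and>
     (\<forall>x. continuous_on {0..} (\<lambda>t. T t x))"

text \<open>An unbounded operator is given by its domain \<open>D\<close> and a function of which only the
  values on \<open>D\<close> matter.\<close>

definition is_generator ::
    "(real \<Rightarrow> 'a :: {complex_normed_vector, banach} \<Rightarrow>\<^sub>L 'a) \<Rightarrow> 'a set \<Rightarrow> ('a \<Rightarrow> 'a) \<Rightarrow> bool" where
  "is_generator T D B \<longleftrightarrow>
     D = {x. \<exists>y. ((\<lambda>h. (T h x - x) /\<^sub>R h) \<longlongrightarrow> y) (at_right 0)} \<and>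
     (\<forall>x\<in>D. ((\<lambda>h. (T h x - x) /\<^sub>R h) \<longlongrightarrow> B x) (at_right 0))"

definition resolvent_set ::
    "'a :: {complex_normed_vector, banach} set \<Rightarrow> ('a \<Rightarrow> 'a) \<Rightarrow> complex set" where
  "resolvent_set D A =
     {l. bij_betw (\<lambda>x. l *\<^sub>C x - A x) D UNIV \<and>
         bounded_clinear (inv_into D (\<lambda>x. l *\<^sub>C x - A x))}"


section \<open>Hilbert spaces\<close>

text \<open>The norm of the (complete) space is induced by a complex inner product.\<close>

definition hilbert_inner ::
    "('a :: {complex_normed_vector, banach} \<Rightarrow> 'a \<Rightarrow> complex) \<Rightarrow> bool" where
  "hilbert_inner ip \<longleftrightarrow>
     (\<forall>x y z. ip (x + y) z = ip x z + ip y z) \<and>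
     (\<forall>c x y. ip (c *\<^sub>C x) y = c * ip x y) \<and>
     (\<forall>x y. ip y x = cnj (ip x y)) \<and>
     (\<forall>x. ip x x = complex_of_real ((norm x)\<^sup>2))"


section \<open>Asymptotically analytic semigroups\<close>

definition sector :: "real \<Rightarrow> complex set" where
  "sector \<theta> = {z. z \<noteq> 0 \<and> \<bar>Arg z\<bar> < \<theta>}"

definition vector_holomorphic_on ::
    "(complex \<Rightarrow> 'b :: complex_normed_vector) \<Rightarrow> complex set \<Rightarrow> bool" where
  "vector_holomorphic_on F U \<longleftrightarrow>
     (\<forall>z\<in>U. \<exists>d. (F has_derivative (\<lambda>h. h *\<^sub>C d)) (at z within U))"

text \<open>The class \<open>\<H>(\<L>(X))\<close>; only the values \<open>S t\<close> with \<open>t > 0\<close> matter.\<close>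

definition exp_bounded_analytic ::
    "(real \<Rightarrow> 'a :: {complex_normed_vector, banach} \<Rightarrow>\<^sub>L 'a) \<Rightarrow> bool" where
  "exp_bounded_analytic S \<longleftrightarrow>
     (\<exists>\<theta> F. 0 < \<theta> \<and> \<theta> \<le> pi \<and>
        (\<forall>z\<in>sector \<theta>. bounded_clinear (blinfun_apply (F z))) \<and>
        vector_holomorphic_on F (sector \<theta>) \<and>
        (\<exists>c \<omega>. \<forall>z\<in>sector \<theta>. norm (F z) \<le> c * exp (\<omega> * cmod z)) \<and>
        (\<forall>t>0. F (complex_of_real t) = S t))"

text \<open>The infimum is taken in the extended reals, as it may be \<open>-\<infinity>\<close>.\<close>

definition nonanalytic_growth_bound ::
    "(real \<Rightarrow> 'a :: {complex_normed_vector, banach} \<Rightarrow>\<^sub>L 'a) \<Rightarrow> ereal" where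
  "nonanalytic_growth_bound T =
     Inf (ereal ` {\<omega>. \<exists>S. exp_bounded_analytic S \<and>
                     bdd_above ((\<lambda>t. exp (- \<omega> * t) * norm (T t - S t)) ` {0<..})})"

definition asymptotically_analytic ::
    "(real \<Rightarrow> 'a :: {complex_normed_vector, banach} \<Rightarrow>\<^sub>L 'a) \<Rightarrow> bool" where
  "asymptotically_analytic T \<longleftrightarrow> nonanalytic_growth_bound T < 0"


section \<open>Positivity\<close>

text \<open>Here \<open>P\<close> is the set of nonnegative elements of the space.\<close>

definition positive_operator ::
    "'a set \<Rightarrow> ('a :: real_normed_vector \<Rightarrow>\<^sub>L 'a) \<Rightarrow> bool" where
  "positive_operator P B \<longleftrightarrow> (\<forall>x\<in>P. B x \<in> P)"


section \<open>\<open>L\<^sup>p\<close> spaces\<close>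

definition Lp_functions :: "real \<Rightarrow> 'm measure \<Rightarrow> ('m \<Rightarrow> complex) set" where
  "Lp_functions p M =
     {f. f \<in> borel_measurable M \<and> integrable M (\<lambda>w. cmod (f w) powr p)}"

definition Lp_norm :: "real \<Rightarrow> 'm measure \<Rightarrow> ('m \<Rightarrow> complex) \<Rightarrow> real" where
  "Lp_norm p M f = (\<integral>w. cmod (f w) powr p \<partial>M) powr (1 / p)"

text \<open>An identification of a Banach space with \<open>L\<^sup>p(M)\<close>: a map \<open>\<Phi>\<close> on \<open>p\<close>-integrable functions
  that induces an isometric isomorphism from their space of classes modulo equality almost
  everywhere onto the whole type \<open>'a\<close>.  By the norm condition, \<open>\<Phi> f = \<Phi> g\<close> iff \<open>f = g\<close> almost
  everywhere.\<close>

definition identifies_Lp ::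
    "(('m \<Rightarrow> complex) \<Rightarrow> 'a :: {complex_normed_vector, banach}) \<Rightarrow> real \<Rightarrow> 'm measure \<Rightarrow> bool" where
  "identifies_Lp \<Phi> p M \<longleftrightarrow>
     (\<forall>f\<in>Lp_functions p M. \<forall>g\<in>Lp_functions p M. \<Phi> (\<lambda>w. f w + g w) = \<Phi> f + \<Phi> g) \<and>
     (\<forall>c. \<forall>f\<in>Lp_functions p M. \<Phi> (\<lambda>w. c * f w) = c *\<^sub>C \<Phi> f) \<and>
     (\<forall>f\<in>Lp_functions p M. norm (\<Phi> f) = Lp_norm p M f) \<and>
     \<Phi> ` Lp_functions p M = UNIV"

definition Lp_nonneg :: "(('m \<Rightarrow> complex) \<Rightarrow> 'a) \<Rightarrow> real \<Rightarrow> 'm measure \<Rightarrow> 'a set" where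
  "Lp_nonneg \<Phi> p M = \<Phi> ` {f \<in> Lp_functions p M. AE w in M. f w \<in> \<real>\<^sub>\<ge>\<^sub>0}"


section \<open>Banach lattices of bounded continuous functions\<close>

definition is_sup_in :: "'b set \<Rightarrow> ('b \<Rightarrow> 'b \<Rightarrow> bool) \<Rightarrow> 'b \<Rightarrow> 'b \<Rightarrow> 'b \<Rightarrow> bool" where
  "is_sup_in V le x y s \<longleftrightarrow>
     s \<in> V \<and> le x s \<and> le y s \<and> (\<forall>u\<in>V. le x u \<and> le y u \<longrightarrow> le s u)"

definition is_inf_in :: "'b set \<Rightarrow> ('b \<Rightarrow> 'b \<Rightarrow> bool) \<Rightarrow> 'b \<Rightarrow> 'b \<Rightarrow> 'b \<Rightarrow> bool" where
  "is_inf_in V le x y s \<longleftrightarrow>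
     s \<in> V \<and> le s x \<and> le s y \<and> (\<forall>u\<in>V. le u x \<and> le u y \<longrightarrow> le u s)"

text \<open>Suprema and infima are formed within \<open>V\<close>.  In the last clause \<open>a = |x|\<close> and \<open>b = |y|\<close>.\<close>

definition real_banach_lattice :: "'b :: real_normed_vector set \<Rightarrow> ('b \<Rightarrow> 'b \<Rightarrow> bool) \<Rightarrow> bool" where
  "real_banach_lattice V le \<longleftrightarrow>
     subspace V \<and> complete V \<and>
     (\<forall>x\<in>V. le x x) \<and>
     (\<forall>x\<in>V. \<forall>y\<in>V. le x y \<and> le y x \<longrightarrow> x = y) \<and>
     (\<forall>x\<in>V. \<forall>y\<in>V. \<forall>z\<in>V. le x y \<and> le y z \<longrightarrow> le x z) \<and>
     (\<forall>x\<in>V. \<forall>y\<in>V. \<forall>z\<in>V. le x y \<longrightarrow> le (x + z) (y + z)) \<and>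
     (\<forall>x\<in>V. \<forall>y\<in>V. \<forall>r\<ge>0. le x y \<longrightarrow> le (r *\<^sub>R x) (r *\<^sub>R y)) \<and>
     (\<forall>x\<in>V. \<forall>y\<in>V. \<exists>s. is_sup_in V le x y s) \<and>
     (\<forall>x\<in>V. \<forall>y\<in>V. \<exists>s. is_inf_in V le x y s) \<and>
     (\<forall>x\<in>V. \<forall>y\<in>V. \<forall>a b. is_sup_in V le x (- x) a \<and> is_sup_in V le y (- y) b \<and> le a b \<longrightarrow>
        norm x \<le> norm y)"

definition Cb_le :: "('w :: topological_space \<Rightarrow>\<^sub>C complex) \<Rightarrow> ('w \<Rightarrow>\<^sub>C complex) \<Rightarrow> bool" where
  "Cb_le f g \<longleftrightarrow> (\<forall>w. g w - f w \<in> \<real>\<^sub>\<ge>\<^sub>0)"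

definition real_valued_in ::
    "('w :: topological_space \<Rightarrow>\<^sub>C complex) set \<Rightarrow> ('w \<Rightarrow>\<^sub>C complex) set" where
  "real_valued_in V = {f \<in> V. \<forall>w. f w \<in> \<real>}"

definition Cb_banach_lattice :: "('w :: topological_space \<Rightarrow>\<^sub>C complex) set \<Rightarrow> bool" where
  "Cb_banach_lattice V \<longleftrightarrow>
     real_banach_lattice (real_valued_in V) Cb_le \<and>
     V = {g + \<i> *\<^sub>C h | g h. g \<in> real_valued_in V \<and> h \<in> real_valued_in V}"

text \<open>In contrast to the suprema in \<open>real_banach_lattice\<close>, these are pointwise.\<close>

definition Cb_sublattice :: "('w :: topological_space \<Rightarrow>\<^sub>C complex) set \<Rightarrow> bool" where
  "Cb_sublattice V \<longleftrightarrow>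
     (\<forall>f\<in>real_valued_in V. \<forall>g\<in>real_valued_in V.
        (\<exists>h\<in>V. \<forall>w. h w = complex_of_real (max (Re (f w)) (Re (g w)))) \<and>
        (\<exists>h\<in>V. \<forall>w. h w = complex_of_real (min (Re (f w)) (Re (g w)))))"

text \<open>The identification of a Banach space with a closed subspace of \<open>C\<^sub>b\<close>, namely \<open>range J\<close>.\<close>

definition embeds_Cb ::
    "('a :: {complex_normed_vector, banach} \<Rightarrow> ('w :: topological_space \<Rightarrow>\<^sub>C complex)) \<Rightarrow> bool" where
  "embeds_Cb J \<longleftrightarrow>
     bounded_clinear J \<and> (\<forall>x. norm (J x) = norm x) \<and> closed (range J)"

definition Cb_nonneg ::
    "('a \<Rightarrow> ('w :: topological_space \<Rightarrow>\<^sub>C complex)) \<Rightarrow> 'a set" where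
  "Cb_nonneg J = {x. \<forall>w. J x w \<in> \<real>\<^sub>\<ge>\<^sub>0}"

end

theory Submission
  imports Defs "HOL-Complex_Analysis.Complex_Analysis" "HOL-Probability.Distributions" "HOL-Real_Asymp.Real_Asymp"
begin

text \<open>
  Write \<open>R z = (z + A)\<^sup>-\<^sup>1\<close> for \<open>Re z > 0\<close>, so that \<open>norm (R z) \<le> \<kappa> (Re z)\<close> with
  \<open>\<kappa> a = K (a\<^sup>-\<^sup>\<alpha> + 1)\<close>.  The claim for \<open>t \<ge> 1\<close> says that the norm of \<open>T t\<close> is at most a constant times
  \<open>\<kappa> (1 / t)\<close>; for \<open>t \<le> 1\<close> it is the exponential growth bound of every \<open>C\<^sub>0\<close>-semigroup.

  The proof works with the implicit Euler scheme \<open>E = (I + h A)\<^sup>-\<^sup>1 = R (1 / h) / h\<close> instead of the semigroup.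
  With \<open>h = t / n\<close>, the powers \<open>E\<^sup>n x\<close> tend to \<open>T t x\<close> (\<open>euler_tendsto\<close>), so it suffices to bound
  \<open>E\<^sup>n\<close> for large \<open>n\<close> (\<open>growth_from_euler\<close>).  Integrals over the half-line thereby become finite sums.  The
  resolvent enters through
  \<open>(I - \<zeta> E)\<^sup>-\<^sup>1 = I + (\<zeta> / h) R ((1 - \<zeta>) / h)\<close>, whose norm is at most
  \<open>1 + \<kappa> ((1 - r) / h) / h\<close> for \<open>|\<zeta>| \<le> r < 1\<close>.
  For \<open>r = 1 - 1 / n\<close> this norm is \<open>1 + \<kappa> (1 / t) / h\<close>, whereas \<open>r\<^sup>n\<close> stays above \<open>e\<^sup>-\<^sup>2\<close>.

  For a Hilbert space and for \<open>L\<^sup>p\<close>, let \<open>N\<close> be about \<open>n / (2 t)\<close>, so that the first \<open>N\<close> steps cover a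
  time between \<open>1 / 4\<close> and \<open>1\<close>, where \<open>E\<^sup>j\<close> is bounded by the constant \<open>M1\<close>.  Put \<open>f\<^sub>j = r\<^sup>j E\<^sup>j x\<close> for
  \<open>j < N\<close> and \<open>f\<^sub>j = 0\<close> otherwise.  The \<open>i\<close>-th term of the convolution of \<open>f\<close> with the sequence
  \<open>r\<^sup>k E\<^sup>k\<close> is \<open>N r\<^sup>i E\<^sup>i x\<close> as soon as \<open>i \<ge> N - 1\<close>.  The generating function of \<open>r\<^sup>k E\<^sup>k\<close> is
  \<open>(I - \<zeta> E)\<^sup>-\<^sup>1\<close>; hence the \<open>\<ell>\<^sup>p\<close> norm of the convolution is at most \<open>1 + \<kappa> (1 / t) / h\<close> times
  that of \<open>f\<close>, with \<open>p = 2\<close> by Plancherel's theorem in a Hilbert space (\<open>hilbert_window\<close>), and by positivity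
  for \<open>x \<ge> 0\<close> in \<open>L\<^sup>p\<close> (\<open>Lp_window\<close>).  Summing over
  the last \<open>N\<close> steps, from each of which \<open>E\<^sup>n x\<close> is reached by a bounded operator, gives
  \<open>N \<cdot> norm (E\<^sup>n x) \<le> c (1 + \<kappa> (1 / t) / h) norm x\<close>, and \<open>N h \<ge> 1 / 4\<close> turns this into the claim.

  In \<open>L\<^sup>p\<close> the bound rests on one dominating element: with the pointwise \<open>\<ell>\<^sup>p\<close> norm \<open>F\<close> of the \<open>f\<^sub>j\<close>,
  the element \<open>G = (I - r E)\<^sup>-\<^sup>1 F\<close> dominates the pointwise \<open>\<ell>\<^sup>p\<close> norm of the convolution, since every linear
  combination \<open>\<Sum> c\<^sub>i f\<^sub>i\<^sub>-\<^sub>k\<close> with \<open>c\<close> in the dual unit ball lies below \<open>F\<close>.  In a space of continuous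
  functions the argument is the same with a common upper bound of the \<open>f\<^sub>j\<close> in place of \<open>F\<close>
  (\<open>growth_from_upper_bounds\<close>).

  In the asymptotically analytic case, \<open>\<phi> (T t x)\<close> is for every functional \<open>\<phi>\<close> the sum of an exponentially
  decaying function \<open>d\<close> and a function \<open>s\<close> that extends to a wedge.  The Laplace transform of \<open>d\<close> has Taylor
  coefficients that are bounded as required.  That of \<open>s\<close> can be continued by rotating the ray of integration
  (\<open>laplace_rotate\<close>), and its derivative therefore decays like \<open>1 / |z|\<^sup>2\<close>, while for bounded \<open>|z|\<close> the
  resolvent bound controls it.  The integral of \<open>1 / (1 + |z|\<^sup>2)\<close> over the circle around \<open>n / t\<close> that touches the line
  \<open>Re z = 1 / t\<close> is bounded independently of \<open>n\<close>, and so Cauchy's formula bounds the Taylor coefficients of the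
  resolvent at \<open>n / t\<close>, of which \<open>\<phi> (E\<^sup>n x)\<close> is one up to a factor
  (\<open>scalar_euler_bound\<close>).
\<close>

section \<open>Uniform boundedness and norming functionals\<close>

text \<open>By Baire's theorem one of the closed sets on which all \<open>T i\<close> are bounded by \<open>n\<close> contains a ball;
  differences of points of that ball fill a neighbourhood of zero.\<close>

lemma uniform_boundedness:
  fixes T :: "'i \<Rightarrow> 'a::banach \<Rightarrow>\<^sub>L 'b::real_normed_vector"
  assumes pointwise: "\<And>x. \<exists>B. \<forall>i\<in>I. norm (T i x) \<le> B"
  shows "\<exists>B. \<forall>i\<in>I. norm (T i) \<le> B"
proof -
  define V where "V n = {x. \<forall>i\<in>I. norm (T i x) \<le> real n}" for n
  have V_eq: "V n = (\<Inter>i\<in>I. {x. norm (T i x) \<le> real n})" for n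
    by (auto simp: V_def)
  have closed_V: "closed (V n)" for n
    unfolding V_eq by (intro closed_INT ballI closed_Collect_le continuous_intros)
  have cover: "\<Union> (range V) = UNIV"
  proof (intro equalityI subsetI)
    fix x :: 'a
    obtain B where B: "\<forall>i\<in>I. norm (T i x) \<le> B"
      using pointwise by blast
    obtain n :: nat where "B \<le> real n"
      using real_arch_simple by blast
    then have "x \<in> V n" using B by (force simp: V_def)
    then show "x \<in> \<Union> (range V)" by blast
  qed simp
  have "\<exists>n. interior (V n) \<noteq> {}"
  proof (rule ccontr)
    assume "\<nexists>n. interior (V n) \<noteq> {}"
    then have "Met_TC.mtopology interior_of \<Union> (range V) = ({} :: 'a set)"
      by (intro Met_TC.metric_Baire_category_alt) (auto simp: closed_V complete_UNIV)
    then show False by (simp add: cover)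
  qed
  then obtain n x where "x \<in> interior (V n)" by blast
  then obtain e where e: "e > 0" "ball x e \<subseteq> V n"
    by (meson mem_interior)
  have small: "norm (T i y) \<le> 2 * real n" if "i \<in> I" "norm y < e" for i y
  proof -
    have "x + y \<in> V n" "x \<in> V n" using e that by (auto simp: subset_iff dist_norm)
    then have "norm (T i (x + y)) \<le> n" "norm (T i x) \<le> n" using that by (auto simp: V_def)
    moreover have "T i y = T i (x + y) - T i x" by (simp add: blinfun.add_right)
    ultimately show ?thesis using norm_triangle_ineq4[of "T i (x + y)" "T i x"] by simp
  qed
  have "norm (T i) \<le> 4 * real n / e" if i: "i \<in> I" for i
  proof (rule norm_blinfun_bound)
    show "0 \<le> 4 * real n / e" using e by simp
    fix y
    show "norm (T i y) \<le> 4 * real n / e * norm y"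
    proof (cases "y = 0")
      case False
      define c where "c = e / (2 * norm y)"
      have c: "c > 0" using False e by (simp add: c_def)
      have "norm (c *\<^sub>R y) < e" using False e by (simp add: c_def)
      from small[OF i this] have "c * norm (T i y) \<le> 2 * real n"
        using c by (simp add: blinfun.scaleR_right)
      then show ?thesis using False e by (simp add: c_def field_simps)
    qed (simp add: blinfun.zero_right)
  qed
  then show ?thesis by blast
qed

text \<open>The Hahn--Banach theorem in the form needed here.  A maximal functional dominated by the norm is total
  because its value at a further point \<open>x\<close> can be chosen between the lower bounds \<open>r - norm (u - x)\<close> and
  the upper bounds \<open>norm (u + x) - r\<close>.\<close>

lemma norming_real_functional:
  fixes y :: "'a::real_normed_vector"
  shows "\<exists>f. linear f \<and> (\<forall>x. f x \<le> norm x) \<and> f y = norm y"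
proof -
  \<comment> \<open>A partial functional is handled through its graph, a subspace of \<open>'a \<times> real\<close>.\<close>
  define G where "G = {S :: ('a \<times> real) set. subspace S \<and> (\<forall>(x, r)\<in>S. r \<le> norm x) \<and> (y, norm y) \<in> S}"
  have single: "span {(y, norm y)} \<in> G"
  proof -
    have "r \<le> norm u" if ur: "(u, r) \<in> span {(y, norm y)}" for u r
    proof -
      obtain k where "(u, r) = k *\<^sub>R (y, norm y)" using ur unfolding span_singleton by blast
      then have "u = k *\<^sub>R y" "r = k * norm y" by auto
      then show ?thesis by (simp add: mult_right_mono)
    qed
    moreover have "(y, norm y) \<in> span {(y, norm y)}" by (rule span_base) simp
    ultimately show ?thesis unfolding G_def using subspace_span[of "{(y, norm y)}"] by blast
  qed
  have "\<exists>M\<in>G. \<forall>S\<in>G. M \<subseteq> S \<longrightarrow> S = M"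
  proof (intro subset_Zorn_nonempty)
    show "G \<noteq> {}" using single by (metis empty_iff)
  next
    fix C assume C: "C \<noteq> {}" "subset.chain G C"
    have CG: "C \<subseteq> G" using C by (simp add: subset.chain_def)
    have lin: "S \<subseteq> S' \<or> S' \<subseteq> S" if "S \<in> C" "S' \<in> C" for S S'
      using C(2) that unfolding subset.chain_def by (auto)
    have sub: "subspace S" if "S \<in> C" for S using CG that by (auto simp: G_def)
    have "subspace (\<Union>C)"
    proof (rule subspaceI)
      show "0 \<in> \<Union>C" using C(1) sub subspace_0 by blast
      show "c *\<^sub>R x \<in> \<Union>C" if "x \<in> \<Union>C" for c x
        using that sub subspace_scale by blast
      fix u v assume "u \<in> \<Union>C" "v \<in> \<Union>C"
      then obtain S where "S \<in> C" "u \<in> S" "v \<in> S"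
        using lin by (elim UnionE) (meson subsetD)
      then show "u + v \<in> \<Union>C" using sub subspace_add by blast
    qed
    moreover have "(y, norm y) \<in> \<Union>C" using C(1) CG by (auto simp: G_def)
    moreover have "\<forall>(x, r)\<in>\<Union>C. r \<le> norm x"
    proof clarify
      fix x r S assume "S \<in> C" "(x, r) \<in> S"
      moreover from this CG have "\<forall>(x, r)\<in>S. r \<le> norm x" by (auto simp: G_def)
      ultimately show "r \<le> norm x" by blast
    qed
    ultimately show "\<Union>C \<in> G" by (simp add: G_def)
  qed
  then obtain M where M: "M \<in> G" and max: "\<And>S. S \<in> G \<Longrightarrow> M \<subseteq> S \<Longrightarrow> S = M" by blast
  have sub: "subspace M" and dom: "\<And>x r. (x, r) \<in> M \<Longrightarrow> r \<le> norm x" and yM: "(y, norm y) \<in> M"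
    using M by (auto simp: G_def)
  have total: "\<exists>r. (x, r) \<in> M" for x
  proof -
    define L where "L = (\<lambda>(u, r). r - norm (u - x)) ` M"
    have upper: "l \<le> norm (u + x) - r" if l: "l \<in> L" and ur: "(u, r) \<in> M" for l u r
    proof -
      obtain u' r' where *: "(u', r') \<in> M" "l = r' - norm (u' - x)"
        using l unfolding L_def by force
      have "(u' + u, r' + r) \<in> M" using subspace_add[OF sub *(1) ur] by simp
      then have "r' + r \<le> norm ((u' - x) + (u + x))" using dom by fastforce
      also have "\<dots> \<le> norm (u' - x) + norm (u + x)" by (rule norm_triangle_ineq)
      finally show ?thesis using * by simp
    qed
    have zero: "(0, 0) \<in> M" using subspace_0[OF sub] by (simp add: zero_prod_def)
    have L_ne: "L \<noteq> {}" using zero by (auto simp: L_def)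
    have bdd: "bdd_above L" using upper zero by (meson bdd_aboveI)
    define c where "c = Sup L"
    have c_lower: "r - norm (u - x) \<le> c" if "(u, r) \<in> M" for u r
      unfolding c_def by (rule cSup_upper[OF _ bdd]) (use that in \<open>force simp: L_def\<close>)
    have c_upper: "c \<le> norm (u + x) - r" if "(u, r) \<in> M" for u r
      unfolding c_def by (rule cSup_least[OF L_ne]) (use upper that in blast)
    have bound: "r + k * c \<le> norm (u + k *\<^sub>R x)" if "(u, r) \<in> M" for u r k
    proof -
      consider "k = 0" | "k > 0" | "k < 0" by linarith
      then show ?thesis
      proof cases
        case 1 then show ?thesis using dom that by simp
      next
        case 2
        have "(u /\<^sub>R k, r / k) \<in> M" using subspace_scale[OF sub that, of "inverse k"] by (simp add: divide_inverse mult.commute)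
        from c_upper[OF this] have "k * c \<le> k * (norm (u /\<^sub>R k + x) - r / k)"
          using 2 by (intro mult_left_mono) auto
        also have "\<dots> = norm (k *\<^sub>R (u /\<^sub>R k + x)) - r" using 2 by (simp add: right_diff_distrib)
        also have "k *\<^sub>R (u /\<^sub>R k + x) = u + k *\<^sub>R x" using 2 by (simp add: scaleR_add_right)
        finally show ?thesis by simp
      next
        case 3
        define j where "j = - k"
        have j: "j > 0" using 3 by (simp add: j_def)
        have "(u /\<^sub>R j, r / j) \<in> M" using subspace_scale[OF sub that, of "inverse j"] by (simp add: divide_inverse mult.commute)
        from c_lower[OF this] have 1: "j * (r / j - norm (u /\<^sub>R j - x)) \<le> j * c"
          using j by (intro mult_left_mono) auto
        have 2: "j * (r / j - norm (u /\<^sub>R j - x)) = r - norm (j *\<^sub>R (u /\<^sub>R j - x))" using j by (simp add: right_diff_distrib)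
        have 3: "j *\<^sub>R (u /\<^sub>R j - x) = u + k *\<^sub>R x" using j by (simp add: scaleR_diff_right j_def)
        have "j * c = - (k * c)" by (simp add: j_def)
        then show ?thesis using 1 unfolding 2 3 by linarith
      qed
    qed
    have "span (insert (x, c) M) \<in> G"
    proof -
      have "r \<le> norm u" if ur: "(u, r) \<in> span (insert (x, c) M)" for u r
      proof -
        obtain k where "(u, r) - k *\<^sub>R (x, c) \<in> span M"
          using ur by (auto simp: span_insert)
        then have "(u - k *\<^sub>R x, r - k * c) \<in> M" using sub by (simp add: span_eq_iff[THEN iffD2])
        from bound[OF this, of k] show ?thesis by simp
      qed
      moreover have "(y, norm y) \<in> span (insert (x, c) M)" using yM by (simp add: span_base)
      ultimately show ?thesis by (auto simp: G_def)
    qed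
    then have "span (insert (x, c) M) = M" by (rule max) (meson span_superset subset_insertI subset_trans)
    then show ?thesis by (metis insertI1 span_base)
  qed
  have unique: "r = r'" if "(x, r) \<in> M" "(x, r') \<in> M" for x r r'
  proof -
    have "(0, r - r') \<in> M" "(0, r' - r) \<in> M"
      using subspace_diff[OF sub that] subspace_diff[OF sub that(2,1)] by auto
    then show ?thesis using dom[of 0 "r - r'"] dom[of 0 "r' - r"] by simp
  qed
  define f where "f x = (THE r. (x, r) \<in> M)" for x
  have f: "(x, f x) \<in> M" for x
    unfolding f_def using total[of x] unique by (metis theI)
  have f_eq: "(x, r) \<in> M \<Longrightarrow> f x = r" for x r using f unique by blast
  have "linear f"
  proof (rule linearI)
    show "f (u + v) = f u + f v" for u v using subspace_add[OF sub f f, of u v] by (intro f_eq) simp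
    show "f (c *\<^sub>R u) = c *\<^sub>R f u" for c u using subspace_scale[OF sub f, of c u] by (intro f_eq) simp
  qed
  then show ?thesis using dom f f_eq yM by blast
qed

text \<open>The complex functional with real part \<open>f\<close> is \<open>x \<mapsto> f x - \<i> f (\<i> x)\<close>.\<close>

lemma norming_functional:
  fixes y :: "'a::complex_normed_vector"
  shows "\<exists>\<phi>. bounded_clinear \<phi> \<and> (\<forall>x. cmod (\<phi> x) \<le> norm x) \<and> \<phi> y = norm y"
proof -
  obtain f where lin: "linear f" and le: "\<And>x. f x \<le> norm x" and fy: "f y = norm (y :: 'a)"
    using norming_real_functional by blast
  define \<phi> where "\<phi> x = Complex (f x) (- f (\<i> *\<^sub>C x))" for x
  have minus: "(-1) *\<^sub>C x = - x" for x :: 'a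
    using scaleR_scaleC[of "-1" x] by simp
  have add: "\<phi> (u + v) = \<phi> u + \<phi> v" for u v
    by (simp add: \<phi>_def complex_eq_iff linear_add[OF lin] scaleC_add_right)
  have re: "Re (\<phi> x) = f x" for x by (simp add: \<phi>_def)
  have sc: "\<phi> (c *\<^sub>C x) = c *\<^sub>C \<phi> x" for c x
  proof -
    have eq: "c *\<^sub>C x = Re c *\<^sub>R x + Im c *\<^sub>R (\<i> *\<^sub>C x)" for c and x :: 'a
      unfolding scaleR_scaleC scaleC_scaleC scaleC_add_left[symmetric]
      by (metis complex_eq mult.commute)
    have ii: "\<i> *\<^sub>C (c *\<^sub>C x) = Re c *\<^sub>R (\<i> *\<^sub>C x) - Im c *\<^sub>R x"
    proof -
      have "\<i> * c = complex_of_real (Re c) * \<i> + complex_of_real (- Im c)"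
        by (simp add: complex_eq_iff)
      then have "\<i> *\<^sub>C (c *\<^sub>C x) = Re c *\<^sub>R (\<i> *\<^sub>C x) + (- Im c) *\<^sub>R x"
        unfolding scaleR_scaleC scaleC_scaleC scaleC_add_left[symmetric] by simp
      then show ?thesis by simp
    qed
    show ?thesis
      unfolding \<phi>_def ii unfolding eq[of c x]
      by (simp add: complex_eq_iff scaleC_complex_def linear_add[OF lin] linear_diff[OF lin] linear_scale[OF lin])
  qed
  have bd: "cmod (\<phi> x) \<le> norm x" for x
  proof (cases "\<phi> x = 0")
    case False
    define c where "c = cnj (sgn (\<phi> x))"
    have c: "cmod c = 1" using False by (simp add: c_def norm_sgn)
    have "c * \<phi> x = cmod (\<phi> x)"
      using False unfolding c_def sgn_eq by (simp add: complex_norm_square[symmetric] power2_eq_square mult.commute)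
    then have "\<phi> (c *\<^sub>C x) = cmod (\<phi> x)" by (simp add: sc scaleC_complex_def)
    then have "cmod (\<phi> x) = f (c *\<^sub>C x)" by (metis re Re_complex_of_real)
    also have "\<dots> \<le> norm (c *\<^sub>C x)" by (rule le)
    finally show ?thesis by (simp add: norm_scaleC c)
  qed simp
  have "bounded_linear \<phi>"
  proof (rule bounded_linear_intro[where K = 1])
    show "\<phi> (r *\<^sub>R x) = r *\<^sub>R \<phi> x" for r x
      unfolding scaleR_scaleC[of r x] sc by (simp add: scaleC_complex_def scaleR_conv_of_real)
  qed (use add bd in auto)
  moreover have "\<phi> y = norm y"
  proof -
    have "Re (\<phi> y) = norm y" using fy re by simp
    moreover have "(Re (\<phi> y))\<^sup>2 + (Im (\<phi> y))\<^sup>2 \<le> (norm y)\<^sup>2"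
      using power_mono[OF bd[of y], of 2] by (simp add: cmod_power2)
    ultimately show ?thesis by (simp add: complex_eq_iff)
  qed
  ultimately show ?thesis using sc bd by (auto simp: bounded_clinear_def)
qed

section \<open>Semigroups whose generator has a half-plane resolvent\<close>

lemma scaleC_zero_left [simp]: "0 *\<^sub>C x = 0" for x :: "'a :: complex_normed_vector"
  using scaleR_scaleC[of 0 x] by simp

lemma scaleC_minus_left: "(- c) *\<^sub>C x = - (c *\<^sub>C x)" for x :: "'a :: complex_normed_vector"
  using scaleC_add_left[of c "- c" x] by (simp add: eq_neg_iff_add_eq_0 add.commute)

lemma scaleC_zero_right [simp]: "c *\<^sub>C 0 = (0 :: 'a :: complex_normed_vector)"
  by (rule linear_0[OF bounded_linear.linear[OF bounded_linear_scaleC]])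

lemma scaleC_diff_right: "c *\<^sub>C (x - y) = c *\<^sub>C x - c *\<^sub>C y" for x y :: "'a :: complex_normed_vector"
  by (rule linear_diff[OF bounded_linear.linear[OF bounded_linear_scaleC]])

text \<open>Orbits are bounded on \<open>[0, 1]\<close>, hence by uniform boundedness so are the operators; the semigroup law
  propagates this bound.\<close>

lemma C0_semigroup_exponentially_bounded:
  assumes "C0_semigroup T"
  shows "\<exists>M\<ge>1. \<exists>w\<ge>1. \<forall>t\<ge>0. norm (T t) \<le> M * exp (w * t)"
proof -
  have add: "T (s + t) = T s o\<^sub>L T t" if "s \<ge> 0" "t \<ge> 0" for s t
    using assms that by (auto simp: C0_semigroup_def)
  have "\<exists>B. \<forall>t\<in>{0..1}. norm (T t x) \<le> B" for x
  proof -
    have "continuous_on {0..1} (\<lambda>t. T t x)"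
      using assms by (auto simp: C0_semigroup_def intro: continuous_on_subset)
    then have "compact ((\<lambda>t. T t x) ` {0..1})" by (rule compact_continuous_image) simp
    then show ?thesis using compact_imp_bounded by (force simp: bounded_iff)
  qed
  from uniform_boundedness[OF this] obtain B where B: "\<forall>t\<in>{0..1}. norm (T t) \<le> B" by blast
  define M where "M = max 1 B"
  have M: "M \<ge> 1" "\<And>t. 0 \<le> t \<Longrightarrow> t \<le> 1 \<Longrightarrow> norm (T t) \<le> M" using B by (auto simp: M_def intro: max.coboundedI2)
  have pow: "norm (T (real n + s)) \<le> M * M ^ n" if "0 \<le> s" "s \<le> 1" for n s
  proof (induction n)
    case (Suc n)
    have "norm (T (real (Suc n) + s)) = norm (T 1 o\<^sub>L T (real n + s))"
      using add[of 1 "real n + s"] that by (simp add: algebra_simps)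
    also have "\<dots> \<le> norm (T 1) * norm (T (real n + s))" by (rule norm_blinfun_compose)
    also have "\<dots> \<le> M * (M * M ^ n)" using Suc M by (intro mult_mono) auto
    finally show ?case by simp
  qed (use M that in auto)
  define w where "w = max 1 (ln M)"
  have "norm (T t) \<le> M * exp (w * t)" if "t \<ge> 0" for t
  proof -
    define n where "n = nat \<lfloor>t\<rfloor>"
    have n: "real n \<le> t" "t - real n \<le> 1" using that unfolding n_def by linarith+
    have "norm (T t) \<le> M * M ^ n" using pow[of "t - real n" n] n by simp
    also have "M ^ n \<le> exp w ^ n"
    proof (rule power_mono)
      have "M = exp (ln M)" using M by simp
      also have "\<dots> \<le> exp w" unfolding exp_le_cancel_iff w_def by simp
      finally show "M \<le> exp w" .
    qed (use M in simp)
    also have "exp w ^ n = exp (w * real n)" by (simp add: exp_of_nat_mult[symmetric] mult.commute)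
    also have "\<dots> \<le> exp (w * t)" using n by (simp add: w_def mult_left_mono)
    finally show ?thesis using M by simp
  qed
  then show ?thesis using M by (intro exI[of _ M] conjI exI[of _ w]) (auto simp: w_def)
qed

text \<open>The constants \<open>M\<close> and \<open>w\<close> are those of an arbitrary exponential bound.  Taking them at least \<open>1\<close>
  saves case distinctions.\<close>

locale half_plane_resolvent =
  fixes T :: "real \<Rightarrow> 'a :: {complex_normed_vector, banach} \<Rightarrow>\<^sub>L 'a"
    and D :: "'a set" and A :: "'a \<Rightarrow> 'a" and \<alpha> K M w :: real
  assumes semigroup: "C0_semigroup T"
    and generator: "is_generator T D (\<lambda>x. - A x)"
    and spectrum: "{z. Re z < 0} \<subseteq> resolvent_set D A"
    and \<alpha>_nonneg: "0 \<le> \<alpha>" and K_ge_1: "1 \<le> K"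
    and resolvent_bound:
      "\<And>z. Re z > 0 \<Longrightarrow>
         onorm (inv_into D (\<lambda>x. z *\<^sub>C x + A x)) \<le> K * (Re z powr (- \<alpha>) + 1)"
    and M_ge_1: "1 \<le> M" and w_ge_1: "1 \<le> w"
    and growth: "\<And>t. 0 \<le> t \<Longrightarrow> norm (T t) \<le> M * exp (w * t)"
begin

definition \<kappa> :: "real \<Rightarrow> real" where "\<kappa> a = K * (a powr (- \<alpha>) + 1)"

definition R :: "complex \<Rightarrow> 'a \<Rightarrow>\<^sub>L 'a" where
  "R z = Blinfun (inv_into D (\<lambda>x. z *\<^sub>C x + A x))"

lemma \<kappa>_ge_1: "1 \<le> \<kappa> a"
proof -
  have "1 * 1 \<le> K * (a powr (- \<alpha>) + 1)" using K_ge_1 by (intro mult_mono) auto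
  then show ?thesis by (simp add: \<kappa>_def)
qed

lemma \<kappa>_antimono: "0 < a \<Longrightarrow> a \<le> b \<Longrightarrow> \<kappa> b \<le> \<kappa> a"
  using K_ge_1 \<alpha>_nonneg by (auto simp: \<kappa>_def intro!: mult_left_mono powr_mono2')

lemma T_scaleC: "t \<ge> 0 \<Longrightarrow> T t (c *\<^sub>C x) = c *\<^sub>C T t x"
  using semigroup by (auto simp: C0_semigroup_def bounded_clinear_def)

lemma T_0: "T 0 x = x"
  using semigroup by (auto simp: C0_semigroup_def)

lemma T_add: "s \<ge> 0 \<Longrightarrow> t \<ge> 0 \<Longrightarrow> T (s + t) x = T s (T t x)"
  using semigroup by (auto simp: C0_semigroup_def)

lemma T_commute: "s \<ge> 0 \<Longrightarrow> t \<ge> 0 \<Longrightarrow> T s (T t x) = T t (T s x)"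
  by (metis T_add add.commute)

lemma T_continuous: "S \<subseteq> {0..} \<Longrightarrow> continuous_on S (\<lambda>t. T t x)"
  using semigroup by (auto simp: C0_semigroup_def intro: continuous_on_subset)

lemma growth_apply: "0 \<le> t \<Longrightarrow> norm (T t x) \<le> M * exp (w * t) * norm x"
  using norm_blinfun[of "T t" x] growth[of t] by (meson mult_right_mono norm_ge_zero order_trans)

lemma generator_limit:
  "x \<in> D \<Longrightarrow> ((\<lambda>h. (T h x - x) /\<^sub>R h) \<longlongrightarrow> - A x) (at_right 0)"
  using generator by (auto simp: is_generator_def)

lemma generator_limitD:
  assumes "((\<lambda>h. (T h x - x) /\<^sub>R h) \<longlongrightarrow> y) (at_right 0)"
  shows "x \<in> D" "A x = - y"
proof -
  show "x \<in> D" using generator assms by (auto simp: is_generator_def)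
  then have "- A x = y" using generator_limit assms tendsto_unique trivial_limit_at_right_real by blast
  then show "A x = - y" by auto
qed

text \<open>The spectral assumption concerns \<open>l - A\<close> in the left half-plane; with \<open>l = - z\<close> it becomes the
  invertibility of \<open>z + A\<close> in the right half-plane.\<close>

lemma resolvent_bij:
  assumes "Re z > 0"
  shows "bij_betw (\<lambda>x. z *\<^sub>C x + A x) D UNIV" "bounded_clinear (inv_into D (\<lambda>x. z *\<^sub>C x + A x))"
proof -
  let ?f = "\<lambda>x. (- z) *\<^sub>C x - A x" and ?g = "\<lambda>x. z *\<^sub>C x + A x"
  have z: "- z \<in> resolvent_set D A" using assms spectrum by auto
  have bij: "bij_betw ?f D UNIV" and lin: "bounded_clinear (inv_into D ?f)"
    using z by (auto simp: resolvent_set_def)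
  have g: "?g x = - ?f x" for x by (simp add: scaleC_minus_left)
  have "bij_betw (\<lambda>x. - x) UNIV (UNIV :: 'a set)" by (rule bij_betw_byWitness[of _ uminus]) auto
  then have "bij_betw (uminus \<circ> ?f) D UNIV" using bij by (rule bij_betw_trans[rotated])
  then show bijg: "bij_betw ?g D UNIV" unfolding comp_def g[symmetric] .
  have "inv_into D ?g y = inv_into D ?f (- y)" for y
  proof (rule inv_into_f_eq)
    show "inj_on ?g D" using bijg by (simp add: bij_betw_def)
    show "inv_into D ?f (- y) \<in> D" using bij by (metis UNIV_I bij_betw_def inv_into_into)
    have "?f (inv_into D ?f (- y)) = - y" using f_inv_into_f[of "- y" ?f D] bij by (simp add: bij_betw_def)
    then show "?g (inv_into D ?f (- y)) = y" unfolding g by simp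
  qed
  then have eq: "inv_into D ?g = inv_into D ?f \<circ> uminus" by auto
  have blin: "bounded_linear (inv_into D ?f)" using lin by (simp add: bounded_clinear_def)
  have cneg: "- (c *\<^sub>C x) = c *\<^sub>C (- x)" for c and x :: 'a
    using scaleC_diff_right[of c 0 x] by simp
  show "bounded_clinear (inv_into D ?g)"
    unfolding bounded_clinear_def
  proof (intro conjI allI)
    show "bounded_linear (inv_into D ?g)"
      unfolding eq by (intro bounded_linear_compose[OF blin, unfolded comp_def[symmetric]] bounded_linear_minus bounded_linear_ident)
    show "inv_into D ?g (c *\<^sub>C x) = c *\<^sub>C inv_into D ?g x" for c x
      unfolding eq comp_def cneg using lin by (simp add: bounded_clinear_def)
  qed
qed

lemma R_apply: "Re z > 0 \<Longrightarrow> blinfun_apply (R z) = inv_into D (\<lambda>x. z *\<^sub>C x + A x)"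
  unfolding R_def using resolvent_bij(2) by (intro bounded_linear_Blinfun_apply) (auto simp: bounded_clinear_def)

lemma R_in_D: assumes "Re z > 0" shows "R z x \<in> D"
  unfolding R_apply[OF assms]
  using inv_into_into[of x "\<lambda>x. z *\<^sub>C x + A x" D] resolvent_bij(1)[OF assms] by (simp add: bij_betw_def)

lemma R_right: "Re z > 0 \<Longrightarrow> z *\<^sub>C R z x + A (R z x) = x"
  using resolvent_bij(1)[of z] R_apply[of z] f_inv_into_f[of x "\<lambda>x. z *\<^sub>C x + A x" D] by (simp add: bij_betw_def)

lemma R_left: assumes "Re z > 0" "x \<in> D" shows "R z (z *\<^sub>C x + A x) = x"
  unfolding R_apply[OF assms(1)]
  using inv_into_f_f[of "\<lambda>x. z *\<^sub>C x + A x" D x] resolvent_bij(1)[OF assms(1)] assms(2) by (simp add: bij_betw_def)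

lemma R_scaleC: "Re z > 0 \<Longrightarrow> R z (c *\<^sub>C x) = c *\<^sub>C R z x"
  using resolvent_bij(2)[of z] R_apply[of z] by (simp add: bounded_clinear_def)

lemma norm_R: "Re z > 0 \<Longrightarrow> norm (R z) \<le> \<kappa> (Re z)"
  using resolvent_bound[of z] by (simp add: norm_blinfun.rep_eq R_apply \<kappa>_def)

lemma norm_R_apply: "Re z \<ge> a \<Longrightarrow> a > 0 \<Longrightarrow> norm (R z x) \<le> \<kappa> a * norm x"
  using norm_blinfun[of "R z" x] norm_R[of z] \<kappa>_antimono[of a "Re z"]
  by (smt (verit) mult_right_mono norm_ge_zero)

lemma resolvent_equation:
  assumes "Re z > 0" "Re v > 0"
  shows "R z x - R v x = (v - z) *\<^sub>C R z (R v x)"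
proof -
  have "z *\<^sub>C R v x + A (R v x) = (z - v) *\<^sub>C R v x + x"
    using R_right[OF assms(2), of x] scaleC_add_left[of "z - v" v "R v x"] by (simp add: add.assoc)
  with R_left[OF assms(1) R_in_D[OF assms(2)], of x]
  have "R v x = R z ((z - v) *\<^sub>C R v x + x)" by simp
  also have "\<dots> = (z - v) *\<^sub>C R z (R v x) + R z x" using assms by (simp add: blinfun.add_right R_scaleC)
  finally have "R v x - R z x = (z - v) *\<^sub>C R z (R v x)" by (simp add: algebra_simps)
  then have "R z x - R v x = - ((z - v) *\<^sub>C R z (R v x))" by (metis minus_diff_eq)
  then show ?thesis by (simp add: scaleC_minus_left[symmetric])
qed

text \<open>The generator only gives derivatives from the right at time zero.  The left derivative at \<open>t\<close> follows from
  \<open>T t y = T (t - \<delta>) (T \<delta> y)\<close>, because \<open>T (t - \<delta>)\<close> is bounded uniformly in \<open>\<delta>\<close>.\<close>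

lemma T_orbit_derivative:
  assumes y: "y \<in> D" and t: "t > 0"
  shows "((\<lambda>s. T s y) has_vector_derivative - T t (A y)) (at t)"
proof -
  define v where "v = - A y"
  define q where "q \<delta> = (T \<delta> y - y) /\<^sub>R \<delta> - v" for \<delta>
  have "(q \<longlongrightarrow> 0) (at_right 0)"
    using tendsto_diff[OF generator_limit[OF y] tendsto_const[of v]] by (simp add: v_def q_def[abs_def])
  then have q: "((\<lambda>\<delta>. norm (q \<delta>)) \<longlongrightarrow> 0) (at_right 0)" by (simp add: tendsto_norm_zero_iff)
  define e where "e s = norm (T s y - T t y - (s - t) *\<^sub>R T t v) / norm (s - t)" for s
  have right: "((\<lambda>\<delta>. e (\<delta> + t)) \<longlongrightarrow> 0) (at_right 0)"
  proof (rule Lim_null_comparison)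
    have "e (\<delta> + t) \<le> norm (T t) * norm (q \<delta>)" if "\<delta> > 0" for \<delta>
    proof -
      have "T (\<delta> + t) y - T t y - \<delta> *\<^sub>R T t v = T t (\<delta> *\<^sub>R q \<delta>)"
        using that t T_add[of t \<delta> y] by (simp add: q_def blinfun.diff_right blinfun.scaleR_right scaleR_diff_right add.commute)
      then have "e (\<delta> + t) = norm (T t (q \<delta>))" using that by (simp add: e_def blinfun.scaleR_right)
      then show ?thesis by (simp add: norm_blinfun)
    qed
    then show "\<forall>\<^sub>F \<delta> in at_right 0. norm (e (\<delta> + t)) \<le> norm (T t) * norm (q \<delta>)"
      by (intro eventually_at_rightI[of 0 1]) (auto simp: e_def)
    show "((\<lambda>\<delta>. norm (T t) * norm (q \<delta>)) \<longlongrightarrow> 0) (at_right 0)"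
      using tendsto_mult_right_zero[OF q] by simp
  qed
  have left: "((\<lambda>\<delta>. e (t - \<delta>)) \<longlongrightarrow> 0) (at_right 0)"
  proof (rule Lim_null_comparison)
    let ?b = "\<lambda>\<delta>. M * exp (w * t) * norm (q \<delta>) + norm (T t v - T (t - \<delta>) v)"
    have "e (t - \<delta>) \<le> ?b \<delta>" if \<delta>: "\<delta> > 0" "\<delta> < t" for \<delta>
    proof -
      have "T t y = T (t - \<delta>) (T \<delta> y)" using \<delta> T_add[of "t - \<delta>" \<delta> y] by simp
      then have "T (t - \<delta>) y - T t y + \<delta> *\<^sub>R T t v = \<delta> *\<^sub>R (T (t - \<delta>) (- q \<delta>) + (T t v - T (t - \<delta>) v))"
        using \<delta> by (simp add: q_def blinfun.diff_right blinfun.scaleR_right scaleR_diff_right scaleR_add_right)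
      then have "e (t - \<delta>) = norm (T (t - \<delta>) (- q \<delta>) + (T t v - T (t - \<delta>) v))" using \<delta> by (simp add: e_def)
      also have "\<dots> \<le> norm (T (t - \<delta>) (- q \<delta>)) + norm (T t v - T (t - \<delta>) v)" by (rule norm_triangle_ineq)
      also have "norm (T (t - \<delta>) (- q \<delta>)) \<le> M * exp (w * (t - \<delta>)) * norm (q \<delta>)"
        using growth_apply[of "t - \<delta>" "- q \<delta>"] \<delta> by simp
      also have "\<dots> \<le> M * exp (w * t) * norm (q \<delta>)"
        using \<delta> M_ge_1 w_ge_1 by (intro mult_right_mono mult_left_mono) auto
      finally show ?thesis by simp
    qed
    then show "\<forall>\<^sub>F \<delta> in at_right 0. norm (e (t - \<delta>)) \<le> ?b \<delta>"
      using t by (intro eventually_at_rightI[of 0 t]) (auto simp: e_def)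
    have "((\<lambda>\<delta>. T (t - \<delta>) v) \<longlongrightarrow> T (t - 0) v) (at_right 0)"
    proof -
      have sub: "{0<..} \<subseteq> {0::real..}" by auto
      have "isCont (\<lambda>s. T s v) t"
        using T_continuous[OF sub, of v] t continuous_on_eq_continuous_at[OF open_greaterThan, of 0 "\<lambda>s. T s v"] by auto
      then have "isCont (\<lambda>s. T s v) (t - 0)" by simp
      moreover have "((\<lambda>\<delta>. t - \<delta>) \<longlongrightarrow> t - 0) (at_right 0)" by (intro tendsto_intros)
      ultimately show ?thesis by (rule isCont_tendsto_compose)
    qed
    then have "((\<lambda>\<delta>. norm (T t v - T (t - \<delta>) v)) \<longlongrightarrow> norm (T t v - T t v)) (at_right 0)"
      by (intro tendsto_norm tendsto_diff tendsto_const) simp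
    then show "(?b \<longlongrightarrow> 0) (at_right 0)"
      using tendsto_add[OF tendsto_mult_right_zero[OF q, of "M * exp (w * t)"]] by fastforce
  qed
  have "(e \<longlongrightarrow> 0) (at_left t)"
    unfolding filterlim_at_left_to_right using left unfolding filterlim_at_right_to_0[of _ _ "- t"] by simp
  moreover have "(e \<longlongrightarrow> 0) (at_right t)"
    unfolding filterlim_at_right_to_0[of _ _ t] by (rule right)
  ultimately have "(e \<longlongrightarrow> 0) (at t)" by (simp add: filterlim_split_at)
  then have "((\<lambda>s. T s y) has_vector_derivative T t v) (at t)"
    unfolding has_vector_derivative_def has_derivative_iff_norm e_def
    by (auto intro: bounded_linear_scaleR_left)
  then show ?thesis by (simp add: v_def blinfun.minus_right)
qed

lemma T_preserves_D:
  assumes "y \<in> D" "t \<ge> 0"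
  shows "T t y \<in> D" "A (T t y) = T t (A y)"
proof -
  have "((\<lambda>h. T t ((T h y - y) /\<^sub>R h)) \<longlongrightarrow> T t (- A y)) (at_right 0)"
    by (intro blinfun.tendsto tendsto_const generator_limit assms)
  moreover have "\<forall>\<^sub>F h in at_right 0. T t ((T h y - y) /\<^sub>R h) = (T h (T t y) - T t y) /\<^sub>R h"
    using T_commute[OF assms(2)] by (intro eventually_at_rightI[of 0 1]) (auto simp: blinfun.scaleR_right blinfun.diff_right)
  ultimately have "((\<lambda>h. (T h (T t y) - T t y) /\<^sub>R h) \<longlongrightarrow> T t (- A y)) (at_right 0)"
    by (rule Lim_transform_eventually)
  from generator_limitD[OF this] show "T t y \<in> D" "A (T t y) = T t (A y)"
    by (auto simp: blinfun.minus_right)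
qed

lemma R_T_commute:
  assumes "Re z > 0" "t \<ge> 0"
  shows "R z (T t x) = T t (R z x)"
proof -
  have "z *\<^sub>C T t (R z x) + A (T t (R z x)) = T t (z *\<^sub>C R z x + A (R z x))"
    using assms T_preserves_D[OF R_in_D, of z t x] by (simp add: T_scaleC blinfun.add_right)
  also have "\<dots> = T t x" using R_right assms by simp
  finally show ?thesis using R_left[OF assms(1) T_preserves_D(1)[OF R_in_D assms(2)], of z x] assms by simp
qed

text \<open>The averages \<open>u r / r\<close> with \<open>u r = \<integral>\<^sub>0\<^sup>r T s x ds\<close> lie in the domain and tend to \<open>x\<close>.\<close>

lemma dense_domain: "closure D = UNIV"
proof -
  have "x \<in> closure D" for x
  proof -
    define u where "u r = integral {0..r} (\<lambda>s. T s x)" for r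
    have int: "(\<lambda>s. T s x) integrable_on {a..b}" if "a \<ge> 0" for a b
      using that by (intro integrable_continuous_real T_continuous) auto
    have du: "(u has_vector_derivative T r x) (at r within {0..b})" if "0 \<le> r" "r \<le> b" for r b
      unfolding u_def using that by (intro integral_has_vector_derivative T_continuous) auto
    have quot: "((\<lambda>r. (u (h + r) - u h) /\<^sub>R r) \<longlongrightarrow> T h x) (at_right 0)" if h: "h \<ge> 0" for h
    proof -
      have "(u has_vector_derivative T h x) (at h within {h..h + 1})"
        using du[of h "h + 1"] h by (auto intro: has_vector_derivative_within_subset)
      then have "((\<lambda>s. norm (u s - u h - (s - h) *\<^sub>R T h x) / norm (s - h)) \<longlongrightarrow> 0) (at h within {h..h+1})"
        by (simp add: has_vector_derivative_def has_derivative_iff_norm)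
      then have "((\<lambda>s. norm (u s - u h - (s - h) *\<^sub>R T h x) / norm (s - h)) \<longlongrightarrow> 0) (at_right h)"
        by (simp add: at_within_Icc_at_right)
      then have "((\<lambda>r. norm (u (r + h) - u h - r *\<^sub>R T h x) / norm r) \<longlongrightarrow> 0) (at_right 0)"
        by (simp add: filterlim_at_right_to_0[of _ _ h])
      moreover have "norm (u (r + h) - u h - r *\<^sub>R T h x) / norm r = norm ((u (h + r) - u h) /\<^sub>R r - T h x)" if "r > 0" for r
      proof -
        have "(u (h + r) - u h) /\<^sub>R r - T h x = (u (r + h) - u h - r *\<^sub>R T h x) /\<^sub>R r"
          using that by (simp add: scaleR_diff_right add.commute)
        then show ?thesis using that by (simp add: divide_inverse_commute)
      qed
      then have "\<forall>\<^sub>F r in at_right 0. norm (u (r + h) - u h - r *\<^sub>R T h x) / norm r = norm ((u (h + r) - u h) /\<^sub>R r - T h x)"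
        by (intro eventually_at_rightI[of 0 1]) auto
      ultimately have "((\<lambda>r. norm ((u (h + r) - u h) /\<^sub>R r - T h x)) \<longlongrightarrow> 0) (at_right 0)"
        by (rule Lim_transform_eventually)
      then have "((\<lambda>r. (u (h + r) - u h) /\<^sub>R r - T h x) \<longlongrightarrow> 0) (at_right 0)"
        by (rule tendsto_norm_zero_cancel)
      then show ?thesis by (simp add: LIM_zero_iff)
    qed
    have shift: "T r (u h) = u (h + r) - u r" if "r \<ge> 0" "h \<ge> 0" for r h
    proof -
      have "((\<lambda>s. T (s + r) x) has_integral (u (h + r) - u (0 + r))) {0..h}"
      proof (rule fundamental_theorem_of_calculus[OF that(2)])
        fix s assume s: "s \<in> {0..h}"
        have "(u has_vector_derivative T (s + r) x) (at (s + r) within {0..h + r})"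
          using s that by (intro du) auto
        then have "(u has_vector_derivative T (s + r) x) (at (s + r) within (\<lambda>s. s + r) ` {0..h})"
          by (rule has_vector_derivative_within_subset) (use that in auto)
        moreover have "((\<lambda>s. s + r) has_vector_derivative 1) (at s within {0..h})"
          by (auto intro!: derivative_eq_intros)
        ultimately have "(u \<circ> (\<lambda>s. s + r) has_vector_derivative 1 *\<^sub>R T (s + r) x) (at s within {0..h})"
          by (rule vector_diff_chain_within[rotated])
        then show "((\<lambda>s. u (s + r)) has_vector_derivative T (s + r) x) (at s within {0..h})"
          by (simp add: comp_def)
      qed
      moreover have "((\<lambda>s. T (s + r) x) has_integral T r (u h)) {0..h}"
      proof -
        have "(blinfun_apply (T r) \<circ> (\<lambda>s. T s x) has_integral T r (u h)) {0..h}"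
          unfolding u_def by (intro has_integral_linear integrable_integral int blinfun.bounded_linear_right) auto
        then show ?thesis
          by (rule has_integral_eq[rotated]) (use that in \<open>auto simp: T_add[symmetric] add.commute\<close>)
      qed
      ultimately have "u (h + r) - u (0 + r) = T r (u h)" by (rule has_integral_unique)
      then show ?thesis by simp
    qed
    have u_0: "u 0 = 0" by (simp add: u_def)
    have inD: "u h \<in> D" if h: "h \<ge> 0" for h
    proof -
      have "((\<lambda>r. (u (h + r) - u h) /\<^sub>R r - (u (0 + r) - u 0) /\<^sub>R r) \<longlongrightarrow> T h x - T 0 x) (at_right 0)"
        by (intro tendsto_diff quot h) auto
      moreover have "\<forall>\<^sub>F r in at_right 0. (u (h + r) - u h) /\<^sub>R r - (u (0 + r) - u 0) /\<^sub>R r = (T r (u h) - u h) /\<^sub>R r"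
        using h u_0 by (intro eventually_at_rightI[of 0 1]) (auto simp: shift algebra_simps)
      ultimately have "((\<lambda>r. (T r (u h) - u h) /\<^sub>R r) \<longlongrightarrow> T h x - T 0 x) (at_right 0)"
        by (rule Lim_transform_eventually)
      then show ?thesis by (rule generator_limitD)
    qed
    have scale: "c *\<^sub>R y \<in> D" if y: "y \<in> D" for c y
    proof -
      have "((\<lambda>h. c *\<^sub>R ((T h y - y) /\<^sub>R h)) \<longlongrightarrow> c *\<^sub>R (- A y)) (at_right 0)"
        by (intro tendsto_intros generator_limit y)
      then have "((\<lambda>h. (T h (c *\<^sub>R y) - c *\<^sub>R y) /\<^sub>R h) \<longlongrightarrow> c *\<^sub>R (- A y)) (at_right 0)"
        by (simp add: blinfun.scaleR_right scaleR_diff_right mult.commute)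
      then show ?thesis by (rule generator_limitD)
    qed
    have "((\<lambda>r. (u r) /\<^sub>R r) \<longlongrightarrow> x) (at_right 0)"
      using quot[of 0] by (simp add: u_def T_0)
    then show ?thesis
      by (rule Lim_in_closed_set[rotated 3])
        (auto intro!: eventually_at_rightI[of 0 1] closure_subset[THEN subsetD] scale inD)
  qed
  then show ?thesis by blast
qed

end

section \<open>Convergence of the implicit Euler scheme\<close>

lemma norm_triangle3: "norm (a + b - c) \<le> norm a + norm b + norm (c :: 'a :: real_normed_vector)"
  using norm_triangle_ineq4[of "a + b" c] norm_triangle_ineq[of a b] by linarith

lemma exp_neg_tendsto_0: "c > 0 \<Longrightarrow> ((\<lambda>t. exp (- c * t)) \<longlongrightarrow> (0 :: real)) at_top"
  by real_asymp

lemma exp_minus_le_one_minus: "exp (- (2 * u)) \<le> 1 - u" if "0 \<le> u" "u \<le> 1 / 2" for u :: real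
proof -
  have "1 \<le> (1 + 2 * u) * (1 - u)" using mult_nonneg_nonneg[of u "1 - 2 * u"] that by (simp add: algebra_simps)
  also have "\<dots> \<le> exp (2 * u) * (1 - u)" using that exp_ge_add_one_self[of "2 * u"] by (intro mult_right_mono) auto
  finally show ?thesis by (simp add: exp_minus field_simps)
qed

context half_plane_resolvent
begin

lemma scaled_orbit_bound:
  assumes "t \<ge> 0"
  shows "norm (exp (- a * t) *\<^sub>R T t x) \<le> M * norm x * exp (- (a - w) * t)"
proof -
  have "norm (exp (- a * t) *\<^sub>R T t x) \<le> exp (- a * t) * (M * exp (w * t) * norm x)"
    using growth_apply[OF assms, of x] by (simp add: mult_left_mono)
  also have "\<dots> = M * norm x * (exp (- a * t) * exp (w * t))" by (simp add: mult_ac)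
  also have "exp (- a * t) * exp (w * t) = exp (- (a - w) * t)" unfolding mult_exp_exp by (simp add: algebra_simps)
  finally show ?thesis .
qed

lemma scaled_orbit_tendsto_0:
  assumes "a > w"
  shows "((\<lambda>t. exp (- a * t) *\<^sub>R T t x) \<longlongrightarrow> 0) at_top"
proof (rule Lim_null_comparison)
  show "\<forall>\<^sub>F t in at_top. norm (exp (- a * t) *\<^sub>R T t x) \<le> M * norm x * exp (- (a - w) * t)"
    unfolding eventually_at_top_linorder using scaled_orbit_bound by blast
  show "((\<lambda>t. M * norm x * exp (- (a - w) * t)) \<longlongrightarrow> 0) at_top"
    by (rule tendsto_mult_right_zero[OF exp_neg_tendsto_0]) (use assms in simp)
qed

text \<open>This is the formula \<open>R l x = \<integral>\<^sub>0\<^sup>\<infinity> exp (- l t) T t x dt\<close> in differential form; it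
  lets estimates replace vector-valued integrals.\<close>

lemma resolvent_orbit_derivative:
  assumes l: "l > 0" and t: "t + s > 0"
  shows "((\<lambda>t. exp (- l * t) *\<^sub>R T (t + s) (R (of_real l) x)) has_vector_derivative
    - (exp (- l * t) *\<^sub>R T (t + s) x)) (at t)"
proof -
  define y where "y = R (of_real l) x"
  have y: "y \<in> D" using l by (simp add: y_def R_in_D)
  have Ay: "l *\<^sub>R y + A y = x" using R_right[of "of_real l" x] l by (simp add: y_def scaleR_scaleC)
  have "((\<lambda>t. t + s) has_vector_derivative 1) (at t)" by (auto intro!: derivative_eq_intros)
  moreover have "((\<lambda>s. T s y) has_vector_derivative - T (t + s) (A y)) (at (t + s) within (\<lambda>t. t + s) ` UNIV)"
    by (rule has_vector_derivative_at_within, rule T_orbit_derivative[OF y]) (use t in simp)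
  ultimately have "((\<lambda>s. T s y) \<circ> (\<lambda>t. t + s) has_vector_derivative 1 *\<^sub>R (- T (t + s) (A y))) (at t)"
    by (rule vector_diff_chain_within)
  then have T': "((\<lambda>t. T (t + s) y) has_vector_derivative - T (t + s) (A y)) (at t)" by (simp add: comp_def)
  have e': "((\<lambda>t. exp (- l * t)) has_field_derivative - l * exp (- l * t)) (at t)"
    by (auto intro!: derivative_eq_intros)
  have "((\<lambda>t. exp (- l * t) *\<^sub>R T (t + s) y) has_vector_derivative exp (- l * t) *\<^sub>R (- T (t + s) (A y)) + (- l * exp (- l * t)) *\<^sub>R T (t + s) y) (at t)"
     by (rule has_vector_derivative_scaleR[OF e' T'])
  moreover have "exp (- l * t) *\<^sub>R (- T (t + s) (A y)) + (- l * exp (- l * t)) *\<^sub>R T (t + s) y = - (exp (- l * t) *\<^sub>R T (t + s) x)"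
    by (simp add: Ay[symmetric] blinfun.add_right blinfun.scaleR_right algebra_simps)
  ultimately show ?thesis by (simp add: y_def)
qed

text \<open>Each factor \<open>R l\<close> improves an exponential orbit bound by \<open>1 / (l - w)\<close>: integrate the derivative of
  \<open>exp (- l t) T (t + s) (R l x)\<close> from \<open>0\<close> to \<open>b\<close> and let \<open>b\<close> tend to infinity.\<close>

lemma hille_yosida_step:
  assumes l: "l > w" and c: "\<And>s. s \<ge> 0 \<Longrightarrow> norm (T s x) \<le> c * exp (w * s)" and s: "s \<ge> 0"
  shows "norm (T s (R (of_real l) x)) \<le> c / (l - w) * exp (w * s)"
proof -
  have lpos: "l > 0" using l w_ge_1 by simp
  define y where "y = R (of_real l) x"
  define g where "g t = exp (- l * t) *\<^sub>R T (t + s) y" for t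
  have c0: "c \<ge> 0" using c[of 0] by (smt (verit) exp_gt_zero mult_neg_pos norm_ge_zero)
  have exps: "exp (- l * t) * (a * exp (w * (t + s))) = a * exp (w * s) * exp (- (l - w) * t)" for t a
    by (simp add: mult_exp_exp algebra_simps)
  have g_diff: "norm (g b - g 0) \<le> c * exp (w * s) / (l - w)" if b: "b > 0" for b
  proof -
    define \<phi> where "\<phi> t = - (c * exp (w * s) / (l - w) * exp (- (l - w) * t))" for t
    have "norm (g b - g 0) \<le> \<phi> b - \<phi> 0"
    proof (rule differentiable_bound_general[OF b])
      have "continuous_on {0..b} (\<lambda>t. T (t + s) y)"
        by (rule continuous_on_compose2[OF T_continuous[of "{0..}"]]) (use s in \<open>auto intro!: continuous_intros\<close>)
      then show "continuous_on {0..b} g" unfolding g_def by (intro continuous_on_scaleR continuous_on_exp continuous_on_mult_left continuous_on_id)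
      show "continuous_on {0..b} \<phi>" unfolding \<phi>_def by (intro continuous_intros)
      fix t assume t: "0 < t" "t < b"
      show "(g has_vector_derivative - (exp (- l * t) *\<^sub>R T (t + s) x)) (at t)"
        unfolding g_def y_def using t s by (intro resolvent_orbit_derivative[OF lpos]) simp
      show "(\<phi> has_vector_derivative c * exp (w * s) * exp (- (l - w) * t)) (at t)"
      proof -
        have "((\<lambda>t. - (k * exp (- (l - w) * t))) has_real_derivative k * (l - w) * exp (- (l - w) * t)) (at t)" for k
          by (auto intro!: derivative_eq_intros simp: algebra_simps)
        from this[of "c * exp (w * s) / (l - w)"] show ?thesis
          unfolding \<phi>_def has_real_derivative_iff_has_vector_derivative[symmetric] using l by simp
      qed
      have "norm (- (exp (- l * t) *\<^sub>R T (t + s) x)) = exp (- l * t) * norm (T (t + s) x)" by simp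
      also have "\<dots> \<le> exp (- l * t) * (c * exp (w * (t + s)))" using t s by (intro mult_left_mono c) auto
      also have "\<dots> = c * exp (w * s) * exp (- (l - w) * t)"
        using exps[of t] by simp
      finally show "norm (- (exp (- l * t) *\<^sub>R T (t + s) x)) \<le> c * exp (w * s) * exp (- (l - w) * t)" .
    qed
    also have "\<dots> \<le> c * exp (w * s) / (l - w)" using l c0 by (simp add: \<phi>_def)
    finally show ?thesis .
  qed
  have g_bound: "norm (g b) \<le> M * exp (w * s) * norm y * exp (- (l - w) * b)" if b: "b > 0" for b
  proof -
    have "norm (g b) = exp (- l * b) * norm (T (b + s) y)" by (simp add: g_def)
    also have "\<dots> \<le> exp (- l * b) * (M * exp (w * (b + s)) * norm y)"
      using b s by (intro mult_left_mono growth_apply) auto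
    also have "\<dots> = M * exp (w * s) * norm y * exp (- (l - w) * b)"
      using exps[of b "M * norm y"] by (simp add: mult_ac)
    finally show ?thesis .
  qed
  have g0: "norm (T s y) \<le> c * exp (w * s) / (l - w) + M * exp (w * s) * norm y * exp (- (l - w) * b)" if "b > 0" for b
  proof -
    have "T s y = g b - (g b - g 0)" by (simp add: g_def)
    then have "norm (T s y) \<le> norm (g b) + norm (g b - g 0)" by (metis norm_triangle_ineq4)
    then show ?thesis using g_diff[OF that] g_bound[OF that] by simp
  qed
  have "((\<lambda>b. c * exp (w * s) / (l - w) + M * exp (w * s) * norm y * exp (- (l - w) * b)) \<longlongrightarrow>
      c * exp (w * s) / (l - w) + M * exp (w * s) * norm y * 0) at_top"
    by (intro tendsto_add tendsto_const tendsto_mult exp_neg_tendsto_0) (use l in simp)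
  then have "norm (T s y) \<le> c * exp (w * s) / (l - w) + M * exp (w * s) * norm y * 0"
    by (rule tendsto_lowerbound) (use g0 in \<open>auto intro: eventually_at_top_linorderI[of 1]\<close>)
  then show ?thesis by (simp add: y_def)
qed

text \<open>The bound on all powers of \<open>R l\<close> keeps the single constant \<open>M\<close>, because the induction is over orbit bounds
  and not over operator norms.\<close>

lemma resolvent_powers:
  assumes l: "l > w" and s: "s \<ge> 0"
  shows "norm (T s ((blinfun_apply (R (of_real l)) ^^ n) x)) \<le> M * norm x / (l - w) ^ n * exp (w * s)"
  using s
proof (induction n arbitrary: s)
  case 0
  then show ?case using growth_apply[of s x] by (simp add: mult_ac)
next
  case (Suc n)
  show ?case
    using hille_yosida_step[OF l Suc.IH Suc.prems] by (simp add: mult.commute)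
qed

text \<open>One step of length \<open>h\<close> of the implicit Euler scheme for \<open>u' = -Au\<close>.\<close>

definition E :: "real \<Rightarrow> 'a \<Rightarrow> 'a" where "E h x = (1 / h) *\<^sub>R R (of_real (1 / h)) x"

lemma E_linear: "bounded_linear (E h)"
  unfolding E_def by (intro bounded_linear_scaleR_right[THEN bounded_linear_compose] blinfun.bounded_linear_right)

lemmas E_simps = linear_0[OF bounded_linear.linear[OF E_linear]]
  linear_add[OF bounded_linear.linear[OF E_linear]] linear_diff[OF bounded_linear.linear[OF E_linear]]
  linear_scale[OF bounded_linear.linear[OF E_linear]] linear_sum[OF bounded_linear.linear[OF E_linear]]

lemma E_scaleC: "h > 0 \<Longrightarrow> E h (c *\<^sub>C x) = c *\<^sub>C E h x"
  by (simp add: E_def R_scaleC scaleR_scaleC scaleC_scaleC mult.commute)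

lemma E_power_linear: "linear (E h ^^ n)"
proof (induction n)
  case (Suc n)
  show ?case unfolding funpow.simps by (rule linear_compose[OF Suc bounded_linear.linear[OF E_linear]])
qed (simp add: id_def linear_id[unfolded id_def])

lemmas E_power_simps = linear_0[OF E_power_linear] linear_add[OF E_power_linear]
  linear_diff[OF E_power_linear] linear_scale[OF E_power_linear] linear_sum[OF E_power_linear]

lemma E_power_scaleC: "h > 0 \<Longrightarrow> (E h ^^ n) (c *\<^sub>C x) = c *\<^sub>C (E h ^^ n) x"
  by (induction n) (auto simp: E_scaleC)

lemma E_power_eq: "(E h ^^ n) x = (1 / h) ^ n *\<^sub>R (blinfun_apply (R (of_real (1 / h))) ^^ n) x"
proof (induction n)
  case (Suc n)
  have "(E h ^^ Suc n) x = E h ((1 / h) ^ n *\<^sub>R (blinfun_apply (R (of_real (1 / h))) ^^ n) x)" using Suc by simp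
  also have "\<dots> = (1 / h) ^ Suc n *\<^sub>R (blinfun_apply (R (of_real (1 / h))) ^^ Suc n) x"
    by (simp add: E_def blinfun.scaleR_right mult.commute)
  finally show ?case .
qed simp

lemma E_power_commute: "(E h ^^ m) ((E h ^^ n) x) = (E h ^^ (m + n)) x"
  by (simp add: funpow_add)

text \<open>A bound of the Euler scheme over times up to \<open>1\<close>, uniform in the step size \<open>h \<le> 1 / (2 w)\<close>.\<close>

definition M1 :: real where "M1 = M * exp (2 * w)"

lemma M1_ge_1: "1 \<le> M1"
  using mult_mono[of 1 M 1 "exp (2 * w)"] M_ge_1 w_ge_1 by (simp add: M1_def)

lemma E_power_bound_exp:
  assumes h: "0 < h" "w * h \<le> 1 / 2"
  shows "norm ((E h ^^ j) x) \<le> M * exp (2 * w * (real j * h)) * norm x"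
proof -
  have l: "1 / h > w" using h by (simp add: field_simps)
  have pos: "1 - w * h > 0" using h by simp
  have "norm ((E h ^^ j) x) = (1 / h) ^ j * norm ((blinfun_apply (R (of_real (1 / h))) ^^ j) x)"
    using h by (simp add: E_power_eq)
  also have "\<dots> \<le> (1 / h) ^ j * (M * norm x / (1 / h - w) ^ j)"
    using resolvent_powers[OF l, of 0 j x] h by (intro mult_left_mono) (auto simp: T_0)
  also have "\<dots> = M * norm x * ((1 / h) / (1 / h - w)) ^ j" unfolding power_divide by simp
  also have "(1 / h) / (1 / h - w) = 1 / (1 - w * h)" using h by (simp add: field_simps)
  also have "(1 / (1 - w * h)) ^ j \<le> exp (2 * w * h) ^ j"
  proof (rule power_mono)
    have "exp (- (2 * (w * h))) \<le> 1 - w * h" using h w_ge_1 by (intro exp_minus_le_one_minus) auto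
    then show "1 / (1 - w * h) \<le> exp (2 * w * h)" using pos by (simp add: exp_minus field_simps)
  qed (use pos in simp)
  also have "exp (2 * w * h) ^ j = exp (2 * w * (real j * h))" by (simp add: exp_of_nat_mult[symmetric] algebra_simps)
  finally have "norm ((E h ^^ j) x) \<le> M * norm x * exp (2 * w * (real j * h))"
    using M_ge_1 by (simp add: mult_left_mono)
  then show ?thesis by (simp only: mult_ac)
qed

lemma E_power_bound:
  assumes h: "0 < h" "w * h \<le> 1 / 2" "real j * h \<le> 1"
  shows "norm ((E h ^^ j) x) \<le> M1 * norm x"
proof -
  have "norm ((E h ^^ j) x) \<le> M * exp (2 * w * (real j * h)) * norm x" by (rule E_power_bound_exp[OF h(1,2)])
  also have "\<dots> \<le> M1 * norm x"
    unfolding M1_def using h M_ge_1 w_ge_1 by (intro mult_right_mono mult_left_mono) auto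
  finally show ?thesis .
qed

lemma scaled_E_power_bound:
  assumes h: "0 < h" "w * h \<le> 1 / 2" "real N * h \<le> 1" and r: "0 \<le> r" "r < 1" and j: "j < N"
  shows "norm (r ^ j *\<^sub>R (E h ^^ j) x) \<le> M1 * norm x"
proof -
  have "real j * h \<le> real N * h" using j h by (intro mult_right_mono) auto
  then have "norm ((E h ^^ j) x) \<le> M1 * norm x" using h by (intro E_power_bound) linarith+
  moreover have "norm (r ^ j *\<^sub>R (E h ^^ j) x) \<le> 1 * norm ((E h ^^ j) x)"
    unfolding norm_scaleR using r by (intro mult_right_mono) (auto simp: power_le_one)
  ultimately show ?thesis by simp
qed

lemma dense_approx:
  assumes "e > 0" shows "\<exists>y\<in>D. norm (x - y) < e"
  using dense_domain assms closure_approachable[of x D] by (auto simp: dist_norm norm_minus_commute)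

lemma E_domain:
  assumes h: "h > 0" and y: "y \<in> D"
  shows "E h y - y = - h *\<^sub>R E h (A y)"
proof -
  have "R (of_real (1 / h)) (of_real (1 / h) *\<^sub>C y + A y) = y" using h y by (intro R_left) auto
  then have "E h y + R (of_real (1 / h)) (A y) = y"
    using h by (simp add: blinfun.add_right R_scaleC E_def scaleR_scaleC)
  then have "E h y = y - R (of_real (1 / h)) (A y)" unfolding eq_diff_eq .
  then have "E h y - y = - R (of_real (1 / h)) (A y)" by simp
  also have "\<dots> = - h *\<^sub>R E h (A y)" using h by (simp add: E_def)
  finally show ?thesis .
qed

lemma E_tendsto_id: "((\<lambda>h. E h x) \<longlongrightarrow> x) (at_right 0)"
proof (rule tendstoI)
  fix e :: real assume e: "e > 0"
  have "e / (2 * (M1 + 1)) > 0" using e M1_ge_1 by simp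
  from dense_approx[OF this] obtain y where y: "y \<in> D" "norm (x - y) < e / (2 * (M1 + 1))" by blast
  define b where "b = min (1 / (2 * w)) (e / (2 * (M1 * norm (A y) + 1)))"
  have b: "b > 0" using w_ge_1 e M1_ge_1 by (auto simp: b_def intro!: divide_pos_pos add_nonneg_pos)
  have "dist (E h x) x < e" if h: "0 < h" "h < b" for h
  proof -
    have wh: "w * h \<le> 1 / 2" using h w_ge_1 by (simp add: b_def field_simps)
    have h1: "real 1 * h \<le> 1" using wh mult_right_mono[OF w_ge_1 less_imp_le[OF h(1)]] by simp
    have E1: "norm (E h z) \<le> M1 * norm z" for z using E_power_bound[OF h(1) wh h1, of z] by simp
    have "E h x - x = E h (x - y) + (E h y - y) - (x - y)" by (simp add: E_simps)
    then have "norm (E h x - x) \<le> norm (E h (x - y)) + norm (E h y - y) + norm (x - y)"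
      using norm_triangle3 by metis
    also have "\<dots> \<le> M1 * norm (x - y) + h * (M1 * norm (A y)) + norm (x - y)"
    proof -
      have "norm (E h y - y) = h * norm (E h (A y))" using h by (simp add: E_domain[OF h(1) y(1)])
      then show ?thesis using E1[of "x - y"] mult_left_mono[OF E1[of "A y"] less_imp_le[OF h(1)]] by linarith
    qed
    also have "\<dots> = (M1 + 1) * norm (x - y) + h * (M1 * norm (A y))" by (simp add: algebra_simps)
    also have "\<dots> < e / 2 + e / 2"
    proof (rule add_less_le_mono)
      show "(M1 + 1) * norm (x - y) < e / 2" using y(2) M1_ge_1 by (simp add: field_simps)
      have "h * (M1 * norm (A y) + 1) \<le> e / 2"
      proof -
        have "h \<le> e / (2 * (M1 * norm (A y) + 1))" using h by (simp add: b_def)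
        moreover have "M1 * norm (A y) + 1 > 0" using M1_ge_1 by (simp add: add_nonneg_pos)
        ultimately show ?thesis by (simp add: pos_le_divide_eq algebra_simps)
      qed
      then show "h * (M1 * norm (A y)) \<le> e / 2" using h by (simp add: algebra_simps)
    qed
    finally show ?thesis by (simp add: dist_norm)
  qed
  then show "\<forall>\<^sub>F h in at_right 0. dist (E h x) x < e" by (intro eventually_at_rightI[OF _ b]) auto
qed

lemma E_T_commute: "h > 0 \<Longrightarrow> t \<ge> 0 \<Longrightarrow> E h (T t x) = T t (E h x)"
  by (simp add: E_def R_T_commute blinfun.scaleR_right)

lemma E_power_T_commute: "h > 0 \<Longrightarrow> t \<ge> 0 \<Longrightarrow> (E h ^^ n) (T t x) = T t ((E h ^^ n) x)"
  by (induction n) (auto simp: E_T_commute)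

lemma euler_local_error:
  assumes y: "y \<in> D"
  shows "((\<lambda>h. (E h y - T h y) /\<^sub>R h) \<longlongrightarrow> 0) (at_right 0)"
proof -
  have "((\<lambda>h. - E h (A y) - (T h y - y) /\<^sub>R h) \<longlongrightarrow> - A y - (- A y)) (at_right 0)"
    by (intro tendsto_intros E_tendsto_id generator_limit y)
  moreover have "- E h (A y) - (T h y - y) /\<^sub>R h = (E h y - T h y) /\<^sub>R h" if "h > 0" for h
  proof -
    have "E h y = y - h *\<^sub>R E h (A y)" using E_domain[OF that y] by (simp add: algebra_simps)
    then show ?thesis using that by (simp add: scaleR_diff_right)
  qed
  then have "\<forall>\<^sub>F h in at_right 0. - E h (A y) - (T h y - y) /\<^sub>R h = (E h y - T h y) /\<^sub>R h"
    by (intro eventually_at_rightI[of 0 1]) auto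
  ultimately show ?thesis using Lim_transform_eventually by fastforce
qed

text \<open>The error is telescoped: each of the \<open>n\<close> steps contributes the local error \<open>E h y - T h y\<close>, transported
  by Euler steps and by the semigroup, both of which are bounded.  The factor \<open>T s\<close> in front makes the
  induction go through with a single \<open>M * M\<close>.\<close>

lemma euler_error:
  assumes h: "0 < h" "w * h \<le> 1 / 2" and s: "s \<ge> 0"
  shows "norm (T s ((E h ^^ n) y - T (real n * h) y))
    \<le> M * M * exp (2 * w * (s + real n * h)) * (real n * norm (E h y - T h y))"
  using s
proof (induction n arbitrary: s)
  case 0
  show ?case by (simp add: T_0)
next
  case (Suc n)
  let ?d = "E h y - T h y"
  have split: "(E h ^^ Suc n) y - T (real (Suc n) * h) y = (E h ^^ n) ?d + T h ((E h ^^ n) y - T (real n * h) y)"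
  proof -
    have "(E h ^^ Suc n) y = (E h ^^ n) (E h y)" by (simp add: funpow_swap1)
    moreover have "T (real (Suc n) * h) y = T h (T (real n * h) y)"
      using T_add[of h "real n * h" y] h by (simp add: algebra_simps)
    moreover have "(E h ^^ n) (T h y) = T h ((E h ^^ n) y)" using h by (simp add: E_power_T_commute)
    ultimately show ?thesis by (simp add: E_power_simps blinfun.diff_right)
  qed
  have "T s ((E h ^^ Suc n) y - T (real (Suc n) * h) y) = T s ((E h ^^ n) ?d) + T (s + h) ((E h ^^ n) y - T (real n * h) y)"
    unfolding split using h Suc.prems by (simp add: blinfun.add_right T_add)
  then have "norm (T s ((E h ^^ Suc n) y - T (real (Suc n) * h) y))
      \<le> norm (T s ((E h ^^ n) ?d)) + norm (T (s + h) ((E h ^^ n) y - T (real n * h) y))"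
    by (simp add: norm_triangle_ineq)
  also have "norm (T s ((E h ^^ n) ?d)) \<le> M * exp (w * s) * (M * exp (2 * w * (real n * h)) * norm ?d)"
    using growth_apply[OF Suc.prems] E_power_bound_exp[OF h, of n ?d] M_ge_1
    by (meson mult_left_mono order_trans mult_nonneg_nonneg exp_ge_zero zero_le_one)
  also have "\<dots> = M * M * norm ?d * exp (w * s + 2 * w * (real n * h))" by (simp add: exp_add)
  also have "\<dots> \<le> M * M * norm ?d * exp (2 * w * (s + real (Suc n) * h))"
    using M_ge_1 w_ge_1 h Suc.prems by (intro mult_left_mono) (auto simp: algebra_simps)
  also have "norm (T (s + h) ((E h ^^ n) y - T (real n * h) y))
      \<le> M * M * exp (2 * w * (s + h + real n * h)) * (real n * norm ?d)"
    using Suc.prems h by (intro Suc.IH) auto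
  finally show ?case by (simp add: algebra_simps)
qed

lemma step_size_tendsto: "t > 0 \<Longrightarrow> filterlim (\<lambda>n. t / real n) (at_right 0) sequentially"
  by (rule tendsto_imp_filterlim_at_right[OF lim_const_over_n]) (auto intro: eventually_sequentiallyI[of 1])

lemma eventually_small_step: "t > 0 \<Longrightarrow> \<forall>\<^sub>F n in sequentially. n \<ge> 1 \<and> w * (t / real n) \<le> 1 / 2"
proof -
  assume t: "t > 0"
  obtain N :: nat where N: "2 * w * t \<le> real N" using real_arch_simple by blast
  show ?thesis
  proof (rule eventually_sequentiallyI[of "max 1 N"])
    fix n assume "max 1 N \<le> n"
    then have "n \<ge> 1" "2 * w * t \<le> real n" using N by (auto intro: order_trans)
    then show "n \<ge> 1 \<and> w * (t / real n) \<le> 1 / 2" by (simp add: field_simps)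
  qed
qed

text \<open>On the domain the local error is \<open>o(h)\<close>, so that the \<open>n\<close> errors of steps of length \<open>t / n\<close> add up to
  \<open>o(1)\<close>; density of the domain and uniform bounds give the rest.\<close>

theorem euler_tendsto:
  assumes t: "t > 0"
  shows "(\<lambda>n. (E (t / real n) ^^ n) x) \<longlonglongrightarrow> T t x"
proof -
  define C where "C = M * M * exp (2 * w * t)"
  have C: "C \<ge> 1" using M_ge_1 w_ge_1 t mult_mono[of 1 "M * M" 1 "exp (2 * w * t)"] mult_mono[of 1 M 1 M] by (simp add: C_def)
  have onD: "(\<lambda>n. (E (t / real n) ^^ n) y - T t y) \<longlonglongrightarrow> 0" if y: "y \<in> D" for y
  proof (rule Lim_null_comparison)
    let ?b = "\<lambda>h. C * (t * norm ((E h y - T h y) /\<^sub>R h))"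
    have "(?b \<longlongrightarrow> C * (t * norm (0 :: 'a))) (at_right 0)"
      by (intro tendsto_intros euler_local_error y)
    from filterlim_compose[OF this step_size_tendsto[OF t]]
    show "(\<lambda>n. ?b (t / real n)) \<longlonglongrightarrow> 0" by simp
    show "\<forall>\<^sub>F n in sequentially. norm ((E (t / real n) ^^ n) y - T t y) \<le> ?b (t / real n)"
      using eventually_small_step[OF t]
    proof eventually_elim
      case (elim n)
      then have h: "0 < t / real n" "w * (t / real n) \<le> 1 / 2" "real n * (t / real n) = t" using t by auto
      show ?case using euler_error[OF h(1,2), of 0 n y] h t elim by (simp add: T_0 C_def)
    qed
  qed
  have bound: "\<forall>\<^sub>F n in sequentially. \<forall>z. norm ((E (t / real n) ^^ n) z) \<le> C * norm z"
    using eventually_small_step[OF t]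
  proof eventually_elim
    case (elim n)
    then have h: "0 < t / real n" "w * (t / real n) \<le> 1 / 2" "real n * (t / real n) = t" using t by auto
    have "M * exp (2 * w * t) \<le> C"
      using M_ge_1 mult_right_mono[of 1 M M] unfolding C_def by (intro mult_right_mono) auto
    then show ?case using E_power_bound_exp[OF h(1,2), of n] unfolding h(3)
      by (meson mult_right_mono norm_ge_zero order_trans)
  qed
  have Tb: "norm (T t z) \<le> C * norm z" for z
  proof -
    have "M * exp (w * t) \<le> C" unfolding C_def
      using M_ge_1 mult_right_mono[of 1 M M] w_ge_1 t by (intro mult_mono) auto
    then show ?thesis using growth_apply[of t z] t by (meson mult_right_mono norm_ge_zero order_trans less_imp_le)
  qed
  show ?thesis
  proof (rule tendstoI)
    fix e :: real assume e: "e > 0"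
    then have "e / (4 * C) > 0" using C by simp
    from dense_approx[OF this] obtain y where y: "y \<in> D" "norm (x - y) < e / (4 * C)" by blast
    have small: "C * norm (x - y) < e / 4" using y(2) C by (simp add: field_simps)
    have "\<forall>\<^sub>F n in sequentially. norm ((E (t / real n) ^^ n) y - T t y) < e / 4"
      using tendstoD[OF onD[OF y(1)], of "e / 4"] e by simp
    with bound show "\<forall>\<^sub>F n in sequentially. dist ((E (t / real n) ^^ n) x) (T t x) < e"
    proof eventually_elim
      case (elim n)
      have "(E (t / real n) ^^ n) x - T t x
        = (E (t / real n) ^^ n) (x - y) + ((E (t / real n) ^^ n) y - T t y) - T t (x - y)"
        by (simp add: E_power_simps blinfun.diff_right)
      then have "norm ((E (t / real n) ^^ n) x - T t x)
        \<le> norm ((E (t / real n) ^^ n) (x - y)) + norm ((E (t / real n) ^^ n) y - T t y) + norm (T t (x - y))"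
        using norm_triangle3 by metis
      also have "\<dots> < e / 4 + e / 4 + e / 4"
        using elim small Tb[of "x - y"] elim(1)[rule_format, of "x - y"] by linarith
      also have "\<dots> < e" using e by simp
      finally show ?case by (simp add: dist_norm)
    qed
  qed
qed

text \<open>Only \<open>t \<ge> 1\<close> matters for the Euler scheme, since \<open>T\<close> is bounded on \<open>[0, 1]\<close>.\<close>

lemma growth_from_euler:
  assumes C: "C \<ge> 0"
    and bound: "\<And>t x. t \<ge> 1 \<Longrightarrow> \<forall>\<^sub>F n in sequentially. norm ((E (t / real n) ^^ n) x) \<le> C * \<kappa> (1 / t) * norm x"
  shows "\<exists>C\<ge>0. \<forall>t\<ge>0. norm (T t) \<le> C * K * (t powr \<alpha> + 1)"
proof (intro exI conjI allI impI)
  define C' where "C' = max C (M * exp w)"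
  show C': "C' \<ge> 0" using C by (simp add: C'_def)
  fix t :: real assume t: "t \<ge> 0"
  show "norm (T t) \<le> C' * K * (t powr \<alpha> + 1)"
  proof (cases "t \<ge> 1")
    case True
    have \<kappa>: "\<kappa> (1 / t) = K * (t powr \<alpha> + 1)" using True by (simp add: \<kappa>_def powr_divide powr_minus)
    have "norm (T t x) \<le> C * \<kappa> (1 / t) * norm x" for x
      by (rule Lim_norm_ubound[OF _ euler_tendsto bound]) (use True in auto)
    then have "norm (T t) \<le> C * \<kappa> (1 / t)" using C \<kappa>_ge_1[of "1 / t"] by (intro norm_blinfun_bound) auto
    also have "\<dots> \<le> C' * \<kappa> (1 / t)" using \<kappa>_ge_1[of "1 / t"] by (intro mult_right_mono) (auto simp: C'_def)
    finally show ?thesis by (simp add: \<kappa> mult.assoc)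
  next
    case False
    have "norm (T t) \<le> M * exp (w * t)" by (rule growth[OF t])
    also have "\<dots> \<le> M * exp w" using False w_ge_1 M_ge_1 t by (intro mult_left_mono) auto
    also have "\<dots> \<le> C' * 1" by (simp add: C'_def)
    also have "\<dots> \<le> C' * (K * (t powr \<alpha> + 1))"
      using C' K_ge_1 mult_mono[of 1 K 1 "t powr \<alpha> + 1"] by (intro mult_left_mono) auto
    finally show ?thesis by (simp add: mult.assoc)
  qed
qed

end

section \<open>From resolvent bounds to the last steps of the Euler scheme\<close>

lemma one_minus_inverse_power: "exp (-2) \<le> (1 - 1 / real n) ^ n" if "n \<ge> 2"
proof -
  have "exp (-2) = exp (- (2 * (1 / real n))) ^ n"
    using that by (simp add: exp_of_nat_mult[symmetric])
  also have "\<dots> \<le> (1 - 1 / real n) ^ n"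
    using that by (intro power_mono exp_minus_le_one_minus) (auto simp: field_simps)
  finally show ?thesis .
qed

context half_plane_resolvent
begin

text \<open>By definition of \<open>E\<close>, \<open>I - \<zeta> E = ((1 - \<zeta>) / h + A) R (1 / h)\<close>, whose inverse is
  \<open>(1 / h + A) R ((1 - \<zeta>) / h) = I + (\<zeta> / h) R ((1 - \<zeta>) / h)\<close>.\<close>

lemma R_eq_of_E:
  assumes h: "h > 0" and \<zeta>: "cmod \<zeta> < 1" and v: "v = x - \<zeta> *\<^sub>C E h x"
  shows "x = v + (\<zeta> / h) *\<^sub>C R ((1 - \<zeta>) / h) v"
proof -
  let ?z = "(1 - \<zeta>) / h" and ?l = "of_real (1 / h) :: complex"
  have z: "Re ?z > 0" using h \<zeta> complex_Re_le_cmod[of \<zeta>] by simp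
  have l: "Re ?l > 0" using h by simp
  have diff: "?l - ?z = \<zeta> / h" using h by (simp add: field_simps)
  have E: "\<zeta> *\<^sub>C E h y = (\<zeta> / h) *\<^sub>C R ?l y" for y
    by (simp add: E_def scaleR_scaleC scaleC_scaleC)
  have "R ?z v = R ?z x - (\<zeta> / h) *\<^sub>C R ?z (R ?l x)" using z by (simp add: v E blinfun.diff_right R_scaleC)
  also have "\<dots> = R ?l x" using resolvent_equation[OF z l, of x] unfolding diff by (simp add: algebra_simps)
  finally have "(\<zeta> / h) *\<^sub>C R ?z v = \<zeta> *\<^sub>C E h x" by (simp add: E)
  then show ?thesis by (simp add: v)
qed

lemma norm_bound_of_E:
  assumes h: "h > 0" and \<zeta>: "cmod \<zeta> \<le> r" "r < 1"
  shows "norm x \<le> (1 + \<kappa> ((1 - r) / h) / h) * norm (x - \<zeta> *\<^sub>C E h x)"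
proof -
  define v where "v = x - \<zeta> *\<^sub>C E h x"
  have "x = v + (\<zeta> / h) *\<^sub>C R ((1 - \<zeta>) / h) v" using R_eq_of_E[OF h _ v_def] \<zeta> by simp
  then have "norm x \<le> norm v + norm ((\<zeta> / h) *\<^sub>C R ((1 - \<zeta>) / h) v)" by (metis norm_triangle_ineq)
  also have "norm ((\<zeta> / h) *\<^sub>C R ((1 - \<zeta>) / h) v) = cmod \<zeta> / h * norm (R ((1 - \<zeta>) / h) v)"
    using h by (simp add: norm_scaleC norm_divide)
  also have "\<dots> \<le> 1 / h * (\<kappa> ((1 - r) / h) * norm v)"
  proof (intro mult_mono norm_R_apply)
    show "(1 - r) / h \<le> Re ((1 - \<zeta>) / complex_of_real h)"
      using h \<zeta> complex_Re_le_cmod[of \<zeta>] by (simp add: divide_right_mono)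
  qed (use h \<zeta> in \<open>auto simp: divide_right_mono\<close>)
  finally show ?thesis by (simp add: v_def algebra_simps)
qed

text \<open>A window of \<open>N\<close> steps of length \<open>t / n\<close> covers a time between \<open>1 / 4\<close> and \<open>1\<close>: short enough for
  the bound \<open>M1\<close>, and long enough that \<open>1 / N\<close> is comparable to the step length.\<close>

lemma eventually_window:
  assumes t: "t \<ge> 1"
  shows "\<forall>\<^sub>F n in sequentially. n \<ge> 2 \<and> w * (t / real n) \<le> 1 / 2 \<and>
    (\<exists>N\<ge>1. 2 * N \<le> n \<and> real N * (t / real n) \<le> 1 \<and> real n \<le> 4 * t * real N)"
proof -
  obtain n0 :: nat where n0: "4 * t \<le> real n0" using real_arch_simple by blast
  have "\<forall>\<^sub>F n in sequentially. n \<ge> 1 \<and> w * (t / real n) \<le> 1 / 2" using t by (intro eventually_small_step) simp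
  moreover have "\<forall>\<^sub>F n in sequentially. n \<ge> max 2 n0" by (rule eventually_ge_at_top)
  ultimately show ?thesis
  proof eventually_elim
    case (elim n)
    then have n: "n \<ge> 2" "real n \<ge> 4 * t" using n0 by auto
    define N where "N = nat \<lfloor>real n / (2 * t)\<rfloor>"
    have q: "real n / (2 * t) \<ge> 2" using n t by (simp add: field_simps)
    have N: "real N \<le> real n / (2 * t)" "real n / (2 * t) - 1 \<le> real N" "N \<ge> 1"
      using q unfolding N_def by linarith+
    have "2 * t * real N \<le> real n" using N(1) t by (simp add: field_simps)
    moreover have "1 * real N \<le> t * real N" using t by (intro mult_right_mono) auto
    ultimately have "real (2 * N) \<le> real n" "t * real N \<le> real n" by auto
    moreover have "real n / (4 * t) \<le> real N" using N(2) q by (simp add: field_simps)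
    then have "real n \<le> 4 * t * real N" using t by (simp add: field_simps)
    ultimately show ?case using elim N n by (intro conjI exI[of _ N]) (auto simp: field_simps)
  qed
qed

text \<open>With \<open>h = t / n\<close>, the two powers of the step length cancel: \<open>N\<close> is at least \<open>1 / (4 h)\<close>, and
  \<open>1 + \<kappa> (1 / t) / h\<close> is at most \<open>2 \<kappa> (1 / t) / h\<close>.\<close>

lemma window_conclusion:
  assumes t: "t \<ge> 1" and n: "n \<ge> 2" "w * (t / real n) \<le> 1 / 2" "real n \<le> 4 * t * real N"
    and c: "c \<ge> 0" and a: "a \<ge> 0"
    and main: "real N * (1 - 1 / real n) ^ n * a \<le> c * (1 + \<kappa> (1 / t) / (t / real n)) * b" and b: "b \<ge> 0"
  shows "a \<le> 8 * exp 2 * c * \<kappa> (1 / t) * b"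
proof -
  define h where "h = t / real n"
  have h: "h > 0" using t n by (simp add: h_def)
  have "1 * h \<le> w * h" using w_ge_1 h by (intro mult_right_mono) auto
  moreover have "w * h \<le> 1 / 2" using n by (simp add: h_def)
  ultimately have h1: "h \<le> \<kappa> (1 / t)" using \<kappa>_ge_1[of "1 / t"] by linarith
  have "1 / (4 * h) * exp (-2) * a \<le> real N * (1 - 1 / real n) ^ n * a"
  proof (intro mult_right_mono mult_mono one_minus_inverse_power)
    show "1 / (4 * h) \<le> real N" using n t by (simp add: h_def field_simps)
  qed (use a n in auto)
  also have "\<dots> \<le> c * (1 + \<kappa> (1 / t) / h) * b" using main by (simp add: h_def)
  finally have "(4 * h * exp 2) * (1 / (4 * h) * exp (-2) * a) \<le> (4 * h * exp 2) * (c * (1 + \<kappa> (1 / t) / h) * b)"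
    using h by (intro mult_left_mono) auto
  moreover have "(4 * h * exp 2) * (1 / (4 * h) * exp (-2) * a) = a"
  proof -
    have "exp 2 * exp (-2) = (1 :: real)" unfolding mult_exp_exp by simp
    then show ?thesis using h by (simp add: field_simps)
  qed
  moreover have "(4 * h * exp 2) * (c * (1 + \<kappa> (1 / t) / h) * b) = 4 * exp 2 * c * b * (h + \<kappa> (1 / t))"
    using h by (simp add: field_simps)
  moreover have "4 * exp 2 * c * b * (h + \<kappa> (1 / t)) \<le> 4 * exp 2 * c * b * (2 * \<kappa> (1 / t))"
    using h1 c b by (intro mult_left_mono) auto
  moreover have "4 * exp 2 * c * b * (2 * \<kappa> (1 / t)) = 8 * exp 2 * c * \<kappa> (1 / t) * b" by simp
  ultimately show ?thesis by linarith
qed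

text \<open>From an \<open>\<ell>\<^sup>p\<close> bound over the window to the last step: \<open>E\<^sup>n x\<close> is \<open>E\<^sup>n\<^sup>-\<^sup>i\<close> applied to
  \<open>E\<^sup>i x\<close> for each \<open>i\<close> in the window, at the cost of a factor \<open>M1\<close>, so each of the \<open>N\<close> summands is
  at least a fixed multiple of the last one.\<close>

lemma window_sum:
  assumes p: "p \<ge> 1" and h: "h > 0" "w * h \<le> 1 / 2" "real N * h \<le> 1"
    and N: "N \<ge> 1" "N \<le> n" and r: "0 \<le> r" "r \<le> 1" and B: "B \<ge> 0"
    and main: "(\<Sum>i\<in>{n-N<..n}. (real N * r ^ i * norm ((E h ^^ i) x)) powr p) \<le> B powr p * (real N * (M1 * norm x) powr p)"
  shows "real N * r ^ n * norm ((E h ^^ n) x) \<le> M1 * M1 * B * norm x"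
proof -
  define a where "a = real N * r ^ n * norm ((E h ^^ n) x) / M1"
  have a: "a \<ge> 0" using r M1_ge_1 by (simp add: a_def)
  have each: "a powr p \<le> (real N * r ^ i * norm ((E h ^^ i) x)) powr p" if i: "i \<in> {n-N<..n}" for i
  proof (rule powr_mono2)
    have "real (n - i) * h \<le> real N * h" using i h by (intro mult_right_mono) auto
    then have "norm ((E h ^^ (n - i)) ((E h ^^ i) x)) \<le> M1 * norm ((E h ^^ i) x)"
      using h by (intro E_power_bound[OF h(1,2)]) linarith
    then have 1: "norm ((E h ^^ n) x) \<le> M1 * norm ((E h ^^ i) x)" using i by (simp add: E_power_commute)
    have "real N * r ^ n * norm ((E h ^^ n) x) \<le> real N * r ^ i * (M1 * norm ((E h ^^ i) x))"
      using i r 1 M1_ge_1 by (intro mult_mono power_decreasing) auto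
    then show "a \<le> real N * r ^ i * norm ((E h ^^ i) x)" using M1_ge_1 by (simp add: a_def field_simps)
  qed (use p a in auto)
  have "real N * a powr p = (\<Sum>i\<in>{n-N<..n}. a powr p)" using N by simp
  also have "\<dots> \<le> (\<Sum>i\<in>{n-N<..n}. (real N * r ^ i * norm ((E h ^^ i) x)) powr p)" by (intro sum_mono each)
  also have "\<dots> \<le> B powr p * (real N * (M1 * norm x) powr p)" by (rule main)
  also have "\<dots> = real N * (B * (M1 * norm x)) powr p" using B M1_ge_1 by (simp add: powr_mult)
  finally have "a powr p \<le> (B * (M1 * norm x)) powr p" using N by simp
  then have "a \<le> B * (M1 * norm x)" using p B M1_ge_1 powr_less_mono2[of p "B * (M1 * norm x)" a] by (force simp: not_le[symmetric])
  then show ?thesis using M1_ge_1 by (simp add: a_def field_simps)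
qed

end

text \<open>The set \<open>P\<close> is the cone of nonnegative elements.  The last assumption says that every element is a
  combination of four nonnegative ones of comparable norm.\<close>

locale positive_half_plane = half_plane_resolvent T D A \<alpha> K M w
  for T :: "real \<Rightarrow> 'a :: {complex_normed_vector, banach} \<Rightarrow>\<^sub>L 'a" and D A \<alpha> K M w +
  fixes P :: "'a set" and c0 :: real
  assumes zero_pos: "0 \<in> P"
    and add_pos: "\<And>x y. x \<in> P \<Longrightarrow> y \<in> P \<Longrightarrow> x + y \<in> P"
    and scale_pos: "\<And>x a. x \<in> P \<Longrightarrow> 0 \<le> a \<Longrightarrow> a *\<^sub>R x \<in> P"
    and closed_pos: "closed P"
    and T_pos: "\<And>t x. 0 \<le> t \<Longrightarrow> x \<in> P \<Longrightarrow> T t x \<in> P"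
    and norm_mono: "\<And>x y. x \<in> P \<Longrightarrow> y - x \<in> P \<Longrightarrow> norm x \<le> norm y"
    and c0_nonneg: "0 \<le> c0"
    and decompose: "\<And>x. \<exists>p1\<in>P. \<exists>p2\<in>P. \<exists>p3\<in>P. \<exists>p4\<in>P. x = p1 - p2 + \<i> *\<^sub>C (p3 - p4) \<and>
      norm p1 \<le> c0 * norm x \<and> norm p2 \<le> c0 * norm x \<and> norm p3 \<le> c0 * norm x \<and> norm p4 \<le> c0 * norm x"
begin

lemma sum_pos: "(\<And>i. i \<in> I \<Longrightarrow> f i \<in> P) \<Longrightarrow> sum f I \<in> P"
  by (induction I rule: infinite_finite_induct) (auto intro: zero_pos add_pos)

text \<open>Riemann sums of a \<open>P\<close>-valued function lie in the closed convex cone \<open>P\<close>.\<close>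

lemma integral_pos:
  fixes f :: "real \<Rightarrow> 'a"
  assumes f: "(f has_integral I) {a..b}" and pos: "\<And>s. s \<in> {a..b} \<Longrightarrow> f s \<in> P"
  shows "I \<in> P"
proof -
  have "\<exists>y\<in>P. dist y I < e" if e: "e > 0" for e
  proof -
    have "\<exists>\<gamma>. gauge \<gamma> \<and> (\<forall>\<D>. \<D> tagged_division_of {a..b} \<and> \<gamma> fine \<D> \<longrightarrow>
        norm ((\<Sum>(x,k)\<in>\<D>. measure lborel k *\<^sub>R f x) - I) < e)"
      using has_integral_real[THEN iffD1, OF f] e by simp
    then obtain \<gamma> where \<gamma>: "gauge \<gamma>" and close: "\<forall>\<D>. \<D> tagged_division_of {a..b} \<and> \<gamma> fine \<D> \<longrightarrow>
        norm ((\<Sum>(x,k)\<in>\<D>. measure lborel k *\<^sub>R f x) - I) < e"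
      by (elim exE conjE) (rule that)
    obtain \<D> where \<D>: "\<D> tagged_division_of {a..b}" "\<gamma> fine \<D>"
      using fine_division_exists_real[OF \<gamma>] .
    have "(\<Sum>(x,k)\<in>\<D>. measure lborel k *\<^sub>R f x) \<in> P"
    proof (rule sum_pos)
      fix p assume p: "p \<in> \<D>"
      obtain x k where xk: "p = (x, k)" by (metis surj_pair)
      have "x \<in> {a..b}" using tag_in_interval[OF \<D>(1), of x k] p xk by simp
      then show "(case p of (x, k) \<Rightarrow> measure lborel k *\<^sub>R f x) \<in> P" by (simp add: xk scale_pos pos)
    qed
    moreover have "norm ((\<Sum>(x,k)\<in>\<D>. measure lborel k *\<^sub>R f x) - I) < e"
      by (rule close[rule_format]) (use \<D> in simp)
    ultimately show ?thesis unfolding dist_norm by (rule bexI[rotated])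
  qed
  then have "I \<in> closure P" by (simp add: closure_approachable)
  then show ?thesis using closed_pos by simp
qed

text \<open>For \<open>a > w\<close> the resolvent is the integral of the positive operators \<open>exp (- a t) T t\<close>.\<close>

lemma R_pos_large:
  assumes a: "a > w" and x: "x \<in> P"
  shows "R (of_real a) x \<in> P"
proof -
  have a0: "a > 0" using a w_ge_1 by simp
  define g where "g t = exp (- a * t) *\<^sub>R T t (R (of_real a) x)" for t
  have "(g \<longlongrightarrow> 0) at_top" unfolding g_def by (rule scaled_orbit_tendsto_0[OF a])
  then have "((\<lambda>t. R (of_real a) x - g t) \<longlongrightarrow> R (of_real a) x - 0) at_top"
    by (intro tendsto_diff tendsto_const)
  moreover have "R (of_real a) x - g t \<in> P" if t: "t \<ge> 0" for t
  proof (rule integral_pos)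
    have "((\<lambda>t. - (exp (- a * t) *\<^sub>R T t x)) has_integral (g t - g 0)) {0..t}"
    proof (rule fundamental_theorem_of_calculus_interior[OF t])
      show "continuous_on {0..t} g" unfolding g_def
        by (intro continuous_on_scaleR continuous_on_exp continuous_on_mult_left continuous_on_id T_continuous) auto
      show "(g has_vector_derivative - (exp (- a * s) *\<^sub>R T s x)) (at s)" if "s \<in> {0<..<t}" for s
        using resolvent_orbit_derivative[OF a0, of s 0 x] that by (simp add: g_def[abs_def])
    qed
    from has_integral_neg[OF this]
    show "((\<lambda>t. exp (- a * t) *\<^sub>R T t x) has_integral (R (of_real a) x - g t)) {0..t}"
      by (simp add: g_def T_0)
  qed (use x in \<open>auto intro!: scale_pos T_pos\<close>)
  then have "\<forall>\<^sub>F t in at_top. R (of_real a) x - g t \<in> P"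
    unfolding eventually_at_top_linorder by blast
  ultimately have "R (of_real a) x - 0 \<in> P"
    by (intro Lim_in_closed_set[OF closed_pos]) auto
  then show ?thesis by simp
qed

text \<open>Positivity passes from \<open>R a\<close> to \<open>R (a - q)\<close> by the fixed point equation
  \<open>y = R a x + q R a y\<close> of \<open>y = R (a - q) x\<close>.\<close>

lemma R_pos_step:
  assumes a: "a > 0" and q: "q \<ge> 0" "q * norm (R (of_real (a + q))) < 1"
    and pos: "\<And>x. x \<in> P \<Longrightarrow> R (of_real (a + q)) x \<in> P" and x: "x \<in> P"
  shows "R (of_real a) x \<in> P"
proof -
  let ?S = "R (of_real (a + q))" and ?y = "R (of_real a) x"
  have fix_eq: "?y = ?S x + q *\<^sub>R ?S ?y"
  proof -
    have "?S x - ?y = (of_real a - of_real (a + q)) *\<^sub>C ?S ?y" using a q by (intro resolvent_equation) auto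
    also have "\<dots> = (- q) *\<^sub>R ?S ?y" by (simp only: scaleR_scaleC of_real_diff[symmetric]) simp
    finally show ?thesis by (simp add: algebra_simps)
  qed
  define y where "y k = ((\<lambda>z. ?S x + q *\<^sub>R ?S z) ^^ k) 0" for k
  have y_pos: "y k \<in> P" for k
  proof (induction k)
    case (Suc k)
    have "y (Suc k) = ?S x + q *\<^sub>R ?S (y k)" by (simp add: y_def)
    also have "\<dots> \<in> P" by (intro add_pos scale_pos pos x q Suc)
    finally show ?case .
  qed (simp add: y_def zero_pos)
  have err: "norm (y k - ?y) \<le> (q * norm ?S) ^ k * norm ?y" for k
  proof (induction k)
    case (Suc k)
    have "y (Suc k) - ?y = (?S x + q *\<^sub>R ?S (y k)) - (?S x + q *\<^sub>R ?S ?y)"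
      using fix_eq by (simp add: y_def)
    also have "\<dots> = q *\<^sub>R ?S (y k - ?y)" by (simp add: blinfun.diff_right scaleR_diff_right)
    finally have "norm (y (Suc k) - ?y) = q * norm (?S (y k - ?y))" using q by simp
    also have "\<dots> \<le> q * (norm ?S * norm (y k - ?y))" using q by (intro mult_left_mono norm_blinfun) auto
    also have "\<dots> \<le> q * (norm ?S * ((q * norm ?S) ^ k * norm ?y))" using q Suc by (intro mult_left_mono) auto
    finally show ?case by (simp add: mult_ac)
  qed (simp add: y_def)
  have "(\<lambda>k. (q * norm ?S) ^ k * norm ?y) \<longlonglongrightarrow> 0 * norm ?y"
    using q by (intro tendsto_mult tendsto_const LIMSEQ_power_zero) auto
  then have "(\<lambda>k. (q * norm ?S) ^ k * norm ?y) \<longlonglongrightarrow> 0" by simp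
  from Lim_null_comparison[OF always_eventually[OF allI[OF err]] this]
  have "(\<lambda>k. y k - ?y) \<longlonglongrightarrow> 0" .
  then have "y \<longlonglongrightarrow> ?y" by (simp add: LIM_zero_iff)
  then show ?thesis using closed_sequentially[OF closed_pos] y_pos by blast
qed

text \<open>From \<open>a > w\<close>, where the Laplace representation is available, positivity is carried to every \<open>a > 0\<close> in steps
  of a fixed length \<open>q\<close>; the resolvent bound is uniform on \<open>[a, \<infinity>)\<close>, so that finitely many steps suffice.\<close>

lemma R_pos:
  assumes a: "a > 0" and x: "x \<in> P"
  shows "R (of_real a) x \<in> P"
proof -
  define q where "q = 1 / (2 * \<kappa> a)"
  have q: "q > 0" using \<kappa>_ge_1[of a] by (simp add: q_def)
  have claim: "R (of_real b) x \<in> P" if "b \<ge> a" "b + real k * q > w" "x \<in> P" for b k x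
    using that
  proof (induction k arbitrary: b x)
    case 0
    then show ?case by (simp add: R_pos_large)
  next
    case (Suc k)
    show ?case
    proof (rule R_pos_step[where q = q])
      have "norm (R (of_real (b + q))) \<le> \<kappa> (b + q)" using norm_R[of "of_real (b + q)"] a q Suc.prems by simp
      also have "\<dots> \<le> \<kappa> a" using a q Suc.prems by (intro \<kappa>_antimono) auto
      finally have "q * norm (R (of_real (b + q))) \<le> q * \<kappa> a" using q by (intro mult_left_mono) auto
      also have "\<dots> < 1" using \<kappa>_ge_1[of a] by (simp add: q_def)
      finally show "q * norm (R (of_real (b + q))) < 1" .
      show "R (of_real (b + q)) y \<in> P" if "y \<in> P" for y
        by (rule Suc.IH) (use Suc.prems q that in \<open>auto simp: algebra_simps\<close>)
    qed (use Suc.prems a q in auto)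
  qed
  obtain k where "w < real k * q" using q reals_Archimedean3 by blast
  then show ?thesis using claim[of a k x] a x by simp
qed

lemma E_pos: "h > 0 \<Longrightarrow> x \<in> P \<Longrightarrow> E h x \<in> P"
  unfolding E_def by (intro scale_pos R_pos) auto

lemma E_power_pos: "h > 0 \<Longrightarrow> x \<in> P \<Longrightarrow> (E h ^^ k) x \<in> P"
  by (induction k) (auto intro: E_pos)

text \<open>The element \<open>G = (I - r E)\<^sup>-\<^sup>1 F\<close> is given by the resolvent at \<open>(1 - r) / h\<close>.  As a solution of
  \<open>G = F + r E G\<close> it exceeds the partial sums of the Neumann series by the nonnegative elements \<open>r\<^sup>m E\<^sup>m G\<close>.\<close>

lemma dominated_neumann:
  assumes h: "h > 0" and r: "0 \<le> r" "r < 1" and F: "F \<in> P"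
  shows "\<exists>G\<in>P. norm G \<le> (1 + \<kappa> ((1 - r) / h) / h) * norm F \<and>
    (\<forall>m. G - (\<Sum>k<m. r ^ k *\<^sub>R (E h ^^ k) F) \<in> P)"
proof -
  define z where "z = (1 - r) / h"
  have z: "z > 0" using h r by (simp add: z_def)
  define G where "G = F + (r / h) *\<^sub>R R (of_real z) F"
  have G: "G \<in> P" unfolding G_def using h r z F by (intro add_pos scale_pos R_pos) auto
  have step: "G = F + r *\<^sub>R E h G"
  proof -
    let ?l = "of_real (1 / h) :: complex"
    have eq: "R ?l F - R (of_real z) F = (of_real z - ?l) *\<^sub>C R ?l (R (of_real z) F)"
      using h z by (intro resolvent_equation) auto
    have "of_real z - ?l = of_real (- (r / h))" using h by (simp add: z_def field_simps)
    with eq have "R ?l F - R (of_real z) F = (- (r / h)) *\<^sub>R R ?l (R (of_real z) F)" by (simp only: scaleR_scaleC)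
    then have "R ?l G = R (of_real z) F" by (simp add: G_def blinfun.add_right blinfun.scaleR_right algebra_simps)
    then show ?thesis by (simp add: E_def G_def)
  qed
  have "G - (\<Sum>k<m. r ^ k *\<^sub>R (E h ^^ k) F) = r ^ m *\<^sub>R (E h ^^ m) G" for m
  proof (induction m)
    case (Suc m)
    have "(E h ^^ m) G = (E h ^^ m) (F + r *\<^sub>R E h G)" using step by simp
    also have "\<dots> = (E h ^^ m) F + r *\<^sub>R (E h ^^ Suc m) G" by (simp add: E_power_simps funpow_swap1)
    finally have "r ^ m *\<^sub>R (E h ^^ m) G = r ^ m *\<^sub>R (E h ^^ m) F + r ^ Suc m *\<^sub>R (E h ^^ Suc m) G"
      by (simp only: scaleR_add_right scaleR_scaleR power_Suc2)
    moreover have "G - (\<Sum>k<Suc m. r ^ k *\<^sub>R (E h ^^ k) F) = (G - (\<Sum>k<m. r ^ k *\<^sub>R (E h ^^ k) F)) - r ^ m *\<^sub>R (E h ^^ m) F"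
      by simp
    ultimately show ?case using Suc by simp
  qed simp
  then have "G - (\<Sum>k<m. r ^ k *\<^sub>R (E h ^^ k) F) \<in> P" for m
    using h r G by (simp add: scale_pos E_power_pos)
  moreover have "norm G \<le> (1 + \<kappa> ((1 - r) / h) / h) * norm F"
  proof -
    have "norm G \<le> norm F + r / h * norm (R (of_real z) F)"
      unfolding G_def using norm_triangle_ineq[of F "(r / h) *\<^sub>R R (of_real z) F"] r h by simp
    also have "r / h * norm (R (of_real z) F) \<le> 1 / h * (\<kappa> z * norm F)"
      using z r h by (intro mult_mono norm_R_apply divide_right_mono) auto
    finally show ?thesis by (simp add: z_def algebra_simps)
  qed
  ultimately show ?thesis using G by blast
qed

lemma growth_from_positive:
  assumes C: "C \<ge> 0"
    and bound: "\<And>t x. t \<ge> 1 \<Longrightarrow> x \<in> P \<Longrightarrow>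
      \<forall>\<^sub>F n in sequentially. norm ((E (t / real n) ^^ n) x) \<le> C * \<kappa> (1 / t) * norm x"
  shows "\<exists>C\<ge>0. \<forall>t\<ge>0. norm (T t) \<le> C * K * (t powr \<alpha> + 1)"
proof (rule growth_from_euler[where C = "4 * (C * c0)"])
  show "0 \<le> 4 * (C * c0)" using C c0_nonneg by simp
  fix t :: real and x assume t: "t \<ge> 1"
  obtain p1 p2 p3 p4 where P: "p1 \<in> P" "p2 \<in> P" "p3 \<in> P" "p4 \<in> P"
    and x: "x = p1 - p2 + \<i> *\<^sub>C (p3 - p4)"
    and n: "norm p1 \<le> c0 * norm x" "norm p2 \<le> c0 * norm x" "norm p3 \<le> c0 * norm x" "norm p4 \<le> c0 * norm x"
    using decompose[of x] by metis
  have C\<kappa>: "C * \<kappa> (1 / t) \<ge> 0" using C \<kappa>_ge_1[of "1 / t"] by simp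
  show "\<forall>\<^sub>F n in sequentially. norm ((E (t / real n) ^^ n) x) \<le> 4 * (C * c0) * \<kappa> (1 / t) * norm x"
    using bound[OF t P(1)] bound[OF t P(2)] bound[OF t P(3)] bound[OF t P(4)] eventually_ge_at_top[of 1]
  proof eventually_elim
    case (elim k)
    let ?E = "E (t / real k) ^^ k"
    have h: "t / real k > 0" using t elim by simp
    have each: "norm (?E p) \<le> C * \<kappa> (1 / t) * (c0 * norm x)"
      if "norm (?E p) \<le> C * \<kappa> (1 / t) * norm p" "norm p \<le> c0 * norm x" for p
      using that mult_left_mono[OF that(2) C\<kappa>] by linarith
    have "?E x = ?E p1 - ?E p2 + \<i> *\<^sub>C (?E p3 - ?E p4)"
      unfolding x by (simp add: E_power_simps E_power_scaleC[OF h])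
    then have "norm (?E x) \<le> norm (?E p1 - ?E p2) + norm (?E p3 - ?E p4)"
      by (metis norm_triangle_ineq norm_scaleC norm_ii mult_1)
    also have "\<dots> \<le> (norm (?E p1) + norm (?E p2)) + (norm (?E p3) + norm (?E p4))"
      by (intro add_mono norm_triangle_ineq4)
    also have "\<dots> \<le> 4 * (C * \<kappa> (1 / t) * (c0 * norm x))"
      using each[OF elim(1) n(1)] each[OF elim(2) n(2)] each[OF elim(3) n(3)] each[OF elim(4) n(4)] by linarith
    finally show ?case by (simp add: mult_ac)
  qed
qed

text \<open>If \<open>g\<close> is an upper bound of the first \<open>N\<close> elements \<open>f j\<close>, then \<open>N r\<^sup>n E\<^sup>n x\<close>, which is the sum of
  \<open>r\<^sup>n\<^sup>-\<^sup>j E\<^sup>n\<^sup>-\<^sup>j (f j)\<close> over \<open>j < N\<close>, lies below a part of the Neumann series of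
  \<open>(I - r E)\<^sup>-\<^sup>1 g\<close>.\<close>

lemma growth_from_upper_bounds:
  assumes c1: "c1 \<ge> 0"
    and upper: "\<And>S B. finite S \<Longrightarrow> S \<noteq> {} \<Longrightarrow> S \<subseteq> P \<Longrightarrow> (\<And>f. f \<in> S \<Longrightarrow> norm f \<le> B) \<Longrightarrow>
      \<exists>g\<in>P. norm g \<le> c1 * B \<and> (\<forall>f\<in>S. g - f \<in> P)"
  shows "\<exists>C\<ge>0. \<forall>t\<ge>0. norm (T t) \<le> C * K * (t powr \<alpha> + 1)"
proof (rule growth_from_positive[where C = "8 * exp 2 * (c1 * M1)"])
  show "0 \<le> 8 * exp 2 * (c1 * M1)" using c1 M1_ge_1 by simp
  fix t :: real and x assume t: "t \<ge> 1" and x: "x \<in> P"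
  show "\<forall>\<^sub>F n in sequentially. norm ((E (t / real n) ^^ n) x) \<le> 8 * exp 2 * (c1 * M1) * \<kappa> (1 / t) * norm x"
    using eventually_window[OF t]
  proof eventually_elim
    case (elim n)
    then obtain N where N: "N \<ge> 1" "2 * N \<le> n" "real N * (t / real n) \<le> 1" "real n \<le> 4 * t * real N" by blast
    define h where "h = t / real n"
    define r where "r = 1 - 1 / real n"
    have n2: "n \<ge> 2" and wh: "w * h \<le> 1 / 2" using elim by (auto simp: h_def)
    have h: "h > 0" using t n2 by (simp add: h_def)
    have r: "0 \<le> r" "r < 1" using n2 by (auto simp: r_def)
    have rh: "(1 - r) / h = 1 / t" using t n2 by (simp add: r_def h_def)
    define f where "f j = r ^ j *\<^sub>R (E h ^^ j) x" for j
    have f_pos: "f j \<in> P" for j using r h x by (simp add: f_def scale_pos E_power_pos)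
    have f_norm: "norm (f j) \<le> M1 * norm x" if "j < N" for j
      unfolding f_def using scaled_E_power_bound[OF h wh _ r that] N(3) by (simp add: h_def)
    have "\<exists>g\<in>P. norm g \<le> c1 * (M1 * norm x) \<and> (\<forall>f'\<in>f ` {..<N}. g - f' \<in> P)"
      by (rule upper) (use f_pos f_norm N(1) in \<open>auto simp: lessThan_empty_iff\<close>)
    then obtain g where g: "g \<in> P" "norm g \<le> c1 * (M1 * norm x)" "\<And>j. j < N \<Longrightarrow> g - f j \<in> P"
      by blast
    obtain G where G: "norm G \<le> (1 + \<kappa> ((1 - r) / h) / h) * norm g"
      "\<And>m. G - (\<Sum>k<m. r ^ k *\<^sub>R (E h ^^ k) g) \<in> P"
      using dominated_neumann[OF h r g(1)] by blast
    define u where "u = (real N * r ^ n) *\<^sub>R (E h ^^ n) x"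
    have u_pos: "u \<in> P" using r h x by (simp add: u_def scale_pos E_power_pos)
    have u_eq: "u = (\<Sum>j<N. r ^ (n - j) *\<^sub>R (E h ^^ (n - j)) (f j))"
    proof -
      have "r ^ (n - j) *\<^sub>R (E h ^^ (n - j)) (f j) = r ^ n *\<^sub>R (E h ^^ n) x" if "j < N" for j
        using that N(2) by (simp add: f_def E_power_simps E_power_commute power_add[symmetric])
      then show ?thesis by (simp add: u_def scaleR_scaleR[symmetric] scaleR_conv_of_real del: scaleR_scaleR) (simp add: sum_constant_scaleR)
    qed
    define v where "v = (\<Sum>j<N. r ^ (n - j) *\<^sub>R (E h ^^ (n - j)) g)"
    have "v - u = (\<Sum>j<N. r ^ (n - j) *\<^sub>R (E h ^^ (n - j)) (g - f j))"
      unfolding u_eq v_def by (simp add: sum_subtractf[symmetric] E_power_simps scaleR_diff_right)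
    then have vu: "v - u \<in> P" using g(3) r h by (auto intro!: sum_pos scale_pos E_power_pos)
    have v_eq: "v = (\<Sum>k\<in>{n-N<..n}. r ^ k *\<^sub>R (E h ^^ k) g)"
      unfolding v_def using N
      by (intro sum.reindex_bij_witness[of _ "\<lambda>k. n - k" "\<lambda>j. n - j"]) auto
    have "(\<Sum>k<Suc n. r ^ k *\<^sub>R (E h ^^ k) g) - v = (\<Sum>k\<in>{..<Suc n} - {n-N<..n}. r ^ k *\<^sub>R (E h ^^ k) g)"
      unfolding v_eq by (intro sum_diff[symmetric]) auto
    also have "\<dots> \<in> P" using g(1) r h by (auto intro!: sum_pos scale_pos E_power_pos)
    finally have "(G - (\<Sum>k<Suc n. r ^ k *\<^sub>R (E h ^^ k) g)) + ((\<Sum>k<Suc n. r ^ k *\<^sub>R (E h ^^ k) g) - v) + (v - u) \<in> P"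
      using G(2)[of "Suc n"] vu by (intro add_pos)
    then have "G - u \<in> P" by simp
    from norm_mono[OF u_pos this] have "norm u \<le> norm G" .
    also have "\<dots> \<le> (1 + \<kappa> (1 / t) / h) * norm g" using G(1) unfolding rh .
    also have "\<dots> \<le> (1 + \<kappa> (1 / t) / h) * (c1 * (M1 * norm x))"
      using h \<kappa>_ge_1[of "1 / t"] by (intro mult_left_mono g) auto
    finally have "real N * r ^ n * norm ((E h ^^ n) x) \<le> c1 * M1 * (1 + \<kappa> (1 / t) / h) * norm x"
      using r by (simp add: u_def mult_ac)
    then show ?case
      using window_conclusion[OF t n2 _ N(4), of "c1 * M1" "norm ((E h ^^ n) x)" "norm x"] wh c1 M1_ge_1
      by (simp add: h_def r_def)
  qed
qed

end

section \<open>Hilbert spaces\<close>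

lemma taylor_coefficient:
  fixes f :: "complex \<Rightarrow> complex"
  assumes \<rho>: "\<rho> > 0" and sums: "\<And>z. z \<in> ball c \<rho> \<Longrightarrow> (\<lambda>n. a n * (z - c) ^ n) sums f z"
  shows "(deriv ^^ n) f c = fact n * a n"
proof -
  have "(\<lambda>u. f (c + u)) has_fps_expansion Abs_fps a"
  proof (rule has_fps_expansionI)
    have "\<forall>\<^sub>F u in nhds 0. u \<in> ball (0 :: complex) \<rho>"
      using \<rho> by (intro eventually_nhds_in_open) auto
    then show "\<forall>\<^sub>F u in nhds 0. (\<lambda>n. fps_nth (Abs_fps a) n * u ^ n) sums f (c + u)"
    proof eventually_elim
      case (elim u)
      then have "c + u \<in> ball c \<rho>" by (simp add: dist_norm)
      from sums[OF this] show ?case by simp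
    qed
  qed
  from fps_nth_fps_expansion[OF this, of n]
  have "(deriv ^^ n) (\<lambda>u. f (c + u)) 0 = fact n * a n" by (simp add: field_simps)
  moreover have "(deriv ^^ n) f c = (deriv ^^ n) (f \<circ> (\<lambda>u. c + u)) 0" by (rule higher_deriv_shift_0)
  ultimately show ?thesis by (simp add: comp_def)
qed

context half_plane_resolvent
begin

context
  fixes \<phi> :: "'a \<Rightarrow> complex"
  assumes \<phi>_linear: "bounded_clinear \<phi>" and \<phi>_bound: "\<And>x. cmod (\<phi> x) \<le> norm x"
begin

lemma \<phi>_simps: "\<phi> (x + y) = \<phi> x + \<phi> y" "\<phi> (x - y) = \<phi> x - \<phi> y" "\<phi> (c *\<^sub>C x) = c * \<phi> x"
  "\<phi> (sum f I) = (\<Sum>i\<in>I. \<phi> (f i))" "\<phi> (r *\<^sub>R x) = r *\<^sub>R \<phi> x"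
  using \<phi>_linear unfolding bounded_clinear_def
  by (auto simp: scaleC_complex_def linear_simps bounded_linear.linear linear_sum)

text \<open>Iterating the resolvent equation gives the Taylor expansion of \<open>\<phi> (R z x)\<close> at \<open>l\<close>, whose coefficients are
  the powers of \<open>R l\<close>.\<close>

lemma R_scalar_sums:
  assumes l: "Re l > 0" and z: "Re z > 0" and small: "cmod (z - l) * norm (R l) < 1"
  shows "(\<lambda>k. ((-1) ^ k * \<phi> ((blinfun_apply (R l) ^^ Suc k) x)) * (z - l) ^ k) sums \<phi> (R z x)"
proof -
  let ?S = "blinfun_apply (R l)"
  have lin: "(?S ^^ k) (u + c *\<^sub>C v) = (?S ^^ k) u + c *\<^sub>C (?S ^^ k) v" for k c u v
    by (induction k) (auto simp: blinfun.add_right R_scaleC[OF l])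
  have step: "R z x = ?S x + (l - z) *\<^sub>C ?S (R z x)"
    using resolvent_equation[OF l z, of x] scaleC_minus_left[of "z - l" "?S (R z x)"]
    by (simp add: algebra_simps)
  have partial: "\<phi> (R z x) - (\<Sum>k<n. ((-1) ^ k * \<phi> ((?S ^^ Suc k) x)) * (z - l) ^ k) = (l - z) ^ n * \<phi> ((?S ^^ n) (R z x))" for n
  proof (induction n)
    case (Suc n)
    have "(?S ^^ n) (R z x) = (?S ^^ n) (?S x) + (l - z) *\<^sub>C (?S ^^ n) (?S (R z x))"
      using step lin by metis
    then have rec: "\<phi> ((?S ^^ n) (R z x)) = \<phi> ((?S ^^ Suc n) x) + (l - z) * \<phi> ((?S ^^ Suc n) (R z x))"
      by (simp only: funpow_Suc_right comp_apply \<phi>_simps)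
    have pow: "(-1) ^ n * (z - l) ^ n = (l - z) ^ n"
      unfolding power_mult_distrib[symmetric] by simp
    have "\<phi> (R z x) - (\<Sum>k<Suc n. ((-1) ^ k * \<phi> ((?S ^^ Suc k) x)) * (z - l) ^ k)
        = (\<phi> (R z x) - (\<Sum>k<n. ((-1) ^ k * \<phi> ((?S ^^ Suc k) x)) * (z - l) ^ k))
          - ((-1) ^ n * (z - l) ^ n) * \<phi> ((?S ^^ Suc n) x)"
      by (simp del: funpow.simps)
    also have "\<dots> = (l - z) ^ Suc n * \<phi> ((?S ^^ Suc n) (R z x))"
      unfolding Suc pow rec by (simp add: algebra_simps del: funpow.simps)
    finally show ?case .
  qed simp
  have norm_pow: "norm ((?S ^^ k) u) \<le> norm (R l) ^ k * norm u" for k u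
  proof (induction k)
    case (Suc k)
    have "norm ((?S ^^ Suc k) u) \<le> norm (R l) * norm ((?S ^^ k) u)" by (simp add: norm_blinfun)
    also have "\<dots> \<le> norm (R l) * (norm (R l) ^ k * norm u)" by (intro mult_left_mono Suc) auto
    finally show ?case by (simp add: mult_ac)
  qed simp
  have "(\<lambda>n. (cmod (z - l) * norm (R l)) ^ n * norm (R z x)) \<longlonglongrightarrow> 0 * norm (R z x)"
    using small by (intro tendsto_mult tendsto_const LIMSEQ_power_zero) auto
  then have lim: "(\<lambda>n. (cmod (z - l) * norm (R l)) ^ n * norm (R z x)) \<longlonglongrightarrow> 0" by simp
  have "norm ((l - z) ^ n * \<phi> ((?S ^^ n) (R z x))) \<le> (cmod (z - l) * norm (R l)) ^ n * norm (R z x)" for n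
  proof -
    have "norm ((l - z) ^ n * \<phi> ((?S ^^ n) (R z x))) = cmod (z - l) ^ n * cmod (\<phi> ((?S ^^ n) (R z x)))"
      by (simp add: norm_mult norm_power norm_minus_commute)
    also have "\<dots> \<le> cmod (z - l) ^ n * (norm (R l) ^ n * norm (R z x))"
      by (intro mult_left_mono order_trans[OF \<phi>_bound norm_pow]) auto
    finally show ?thesis by (simp add: power_mult_distrib mult_ac)
  qed
  from Lim_null_comparison[OF always_eventually[OF allI[OF this]] lim]
  have "(\<lambda>n. (l - z) ^ n * \<phi> ((?S ^^ n) (R z x))) \<longlonglongrightarrow> 0" .
  then have "(\<lambda>n. \<phi> (R z x) - (\<Sum>k<n. ((-1) ^ k * \<phi> ((?S ^^ Suc k) x)) * (z - l) ^ k)) \<longlonglongrightarrow> 0"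
    unfolding partial .
  from tendsto_diff[OF tendsto_const[of "\<phi> (R z x)"] this]
  show ?thesis unfolding sums_def by simp
qed

lemma R_scalar_ball:
  assumes l: "Re l > 0"
  shows "\<exists>\<rho>>0. \<forall>z\<in>ball l \<rho>. (\<lambda>k. ((-1) ^ k * \<phi> ((blinfun_apply (R l) ^^ Suc k) x)) * (z - l) ^ k) sums \<phi> (R z x)"
proof (intro exI conjI ballI)
  define \<rho> where "\<rho> = min (Re l) (1 / (norm (R l) + 1))"
  show "\<rho> > 0" using l by (simp add: \<rho>_def add_nonneg_pos)
  fix z assume "z \<in> ball l \<rho>"
  then have z: "cmod (z - l) < \<rho>" by (simp add: dist_norm norm_minus_commute)
  have "Re l - Re z \<le> cmod (z - l)" using abs_Re_le_cmod[of "z - l"] by simp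
  then have "Re z > 0" using z by (simp add: \<rho>_def)
  moreover have "cmod (z - l) * norm (R l) < 1"
  proof -
    have "cmod (z - l) < 1 / (norm (R l) + 1)" using z by (simp add: \<rho>_def)
    then have "cmod (z - l) * (norm (R l) + 1) < 1" by (simp add: pos_less_divide_eq add_nonneg_pos)
    moreover have "cmod (z - l) * norm (R l) \<le> cmod (z - l) * (norm (R l) + 1)" by (intro mult_left_mono) auto
    ultimately show ?thesis by linarith
  qed
  ultimately show "(\<lambda>k. ((-1) ^ k * \<phi> ((blinfun_apply (R l) ^^ Suc k) x)) * (z - l) ^ k) sums \<phi> (R z x)"
    by (rule R_scalar_sums[OF l])
qed

lemma R_scalar_holomorphic: "(\<lambda>z. \<phi> (R z x)) holomorphic_on {z. Re z > 0}"
proof -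
  have "(\<lambda>z. \<phi> (R z x)) analytic_on {l}" if l: "Re l > 0" for l
  proof -
    obtain \<rho> where \<rho>: "\<rho> > 0" and
      sums: "\<forall>z\<in>ball l \<rho>. (\<lambda>k. ((-1) ^ k * \<phi> ((blinfun_apply (R l) ^^ Suc k) x)) * (z - l) ^ k) sums \<phi> (R z x)"
      using R_scalar_ball[OF l, of x] by (elim exE conjE) (rule that)
    have "(\<lambda>z. \<phi> (R z x)) holomorphic_on ball l \<rho>"
      by (rule power_series_holomorphic) (rule sums[rule_format])
    then show ?thesis using \<rho> by (auto simp: analytic_on_def)
  qed
  then have "(\<lambda>z. \<phi> (R z x)) analytic_on {z. Re z > 0}" by (subst analytic_on_analytic_at) auto
  then show ?thesis by (rule analytic_imp_holomorphic)
qed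

lemma R_scalar_deriv:
  assumes l: "Re l > 0"
  shows "(deriv ^^ k) (\<lambda>z. \<phi> (R z x)) l = fact k * ((-1) ^ k * \<phi> ((blinfun_apply (R l) ^^ Suc k) x))"
proof -
  obtain \<rho> where \<rho>: "\<rho> > 0" and
    sums: "\<forall>z\<in>ball l \<rho>. (\<lambda>k. ((-1) ^ k * \<phi> ((blinfun_apply (R l) ^^ Suc k) x)) * (z - l) ^ k) sums \<phi> (R z x)"
    using R_scalar_ball[OF l, of x] by (elim exE conjE) (rule that)
  show ?thesis by (rule taylor_coefficient[OF \<rho> sums[rule_format]])
qed

text \<open>Cauchy's estimate on the disc around \<open>l\<close> that touches the line \<open>Re z = a\<close>.  It bounds the powers of
  \<open>R l\<close> by \<open>(Re l - a)\<^sup>-\<^sup>k\<close> with \<open>a > 0\<close> arbitrary, whereas the semigroup bound only gives \<open>a = w\<close>.\<close>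

lemma R_scalar_cauchy:
  assumes a: "0 < a" "a < Re l"
  shows "cmod (\<phi> ((blinfun_apply (R l) ^^ Suc k) x)) \<le> \<kappa> a * norm x / (Re l - a) ^ k"
proof -
  let ?f = "\<lambda>z. \<phi> (R z x)" and ?r = "Re l - a"
  have re: "Re z \<ge> a" if "cmod (l - z) \<le> ?r" for z
    using that abs_Re_le_cmod[of "l - z"] by simp
  have sub: "cball l ?r \<subseteq> {z. Re z > 0}" using re a by (force simp: dist_norm)
  have "norm ((deriv ^^ k) ?f l) \<le> fact k * (\<kappa> a * norm x) / ?r ^ k"
  proof (rule Cauchy_inequality)
    show "?f holomorphic_on ball l ?r"
      by (rule holomorphic_on_subset[OF R_scalar_holomorphic]) (use sub ball_subset_cball in blast)
    show "continuous_on (cball l ?r) ?f"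
      by (rule continuous_on_subset[OF holomorphic_on_imp_continuous_on[OF R_scalar_holomorphic] sub])
    show "norm (?f z) \<le> \<kappa> a * norm x" if "norm (l - z) = ?r" for z
      using order_trans[OF \<phi>_bound norm_R_apply[OF re a(1)]] that by simp
  qed (use a in simp)
  then have "fact k * cmod (\<phi> ((blinfun_apply (R l) ^^ Suc k) x)) \<le> fact k * (\<kappa> a * norm x / ?r ^ k)"
    using a by (simp add: R_scalar_deriv norm_mult norm_power)
  then show ?thesis by (subst (asm) mult_le_cancel_left_pos) auto
qed

end

lemma R_power_cauchy:
  assumes a: "0 < a" "a < Re l"
  shows "norm ((blinfun_apply (R l) ^^ Suc k) x) \<le> \<kappa> a * norm x / (Re l - a) ^ k"
proof -
  obtain \<phi> where \<phi>: "bounded_clinear \<phi>" "\<And>x. cmod (\<phi> x) \<le> norm x"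
    "\<phi> ((blinfun_apply (R l) ^^ Suc k) x) = norm ((blinfun_apply (R l) ^^ Suc k) x)"
    using norming_functional by metis
  from R_scalar_cauchy[OF \<phi>(1,2) a, of k x] show ?thesis unfolding \<phi>(3) by simp
qed

text \<open>The spectral radius of \<open>E\<close> is at most \<open>1\<close>, as the Cauchy estimate shows with \<open>a\<close> small: for \<open>a\<close> half of
  \<open>(1 - r) / h\<close> the powers of \<open>r E\<close> decay with the ratio \<open>2 r / (1 + r)\<close>.\<close>

lemma E_power_decay:
  assumes h: "h > 0" and r: "0 \<le> r" "r < 1"
  shows "(\<lambda>m. r ^ m * norm ((E h ^^ m) x)) \<longlonglongrightarrow> 0"
proof -
  define a where "a = (1 - r) / (2 * h)"
  have a: "0 < a" using h r by (simp add: a_def)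
  have a': "a < 1 / h"
  proof -
    have "a = ((1 - r) / 2) / h" by (simp add: a_def)
    also have "\<dots> < 1 / h" using h r by (intro divide_strict_right_mono) auto
    finally show ?thesis .
  qed
  define b where "b = 2 * r / (1 + r)"
  have b: "0 \<le> b" "b < 1" using r by (auto simp: b_def field_simps)
  define C where "C = \<kappa> a * norm x / h"
  have bound: "r ^ Suc k * norm ((E h ^^ Suc k) x) \<le> r * C * b ^ k" for k
  proof -
    have "norm ((E h ^^ Suc k) x) = (1 / h) ^ Suc k * norm ((blinfun_apply (R (of_real (1 / h))) ^^ Suc k) x)"
      unfolding E_power_eq using h by (simp del: funpow.simps)
    also have "\<dots> \<le> (1 / h) ^ Suc k * (\<kappa> a * norm x / (1 / h - a) ^ k)"
      using R_power_cauchy[of a "of_real (1 / h)" k x] a a' h by (intro mult_left_mono) auto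
    also have "\<dots> = C * ((1 / h) / (1 / h - a)) ^ k"
    proof -
      have "u ^ Suc k * (X / v ^ k) = (X * u) * (u / v) ^ k" for u v X :: real by (simp add: power_divide)
      from this[of "1 / h" "\<kappa> a * norm x" "1 / h - a"] show ?thesis by (simp only: C_def) simp
    qed
    also have "(1 / h) / (1 / h - a) = 2 / (1 + r)" using h r by (simp add: a_def field_simps)
    finally have "r ^ Suc k * norm ((E h ^^ Suc k) x) \<le> r ^ Suc k * (C * (2 / (1 + r)) ^ k)"
      using r by (intro mult_left_mono) auto
    also have "\<dots> = r * C * b ^ k" by (simp add: b_def power_divide power_mult_distrib)
    finally show ?thesis .
  qed
  have "(\<lambda>k. r * C * b ^ k) \<longlonglongrightarrow> r * C * 0"
    using b by (intro tendsto_mult tendsto_const LIMSEQ_power_zero) auto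
  then have lim: "(\<lambda>k. r * C * b ^ k) \<longlonglongrightarrow> 0" by simp
  have "norm (r ^ Suc k * norm ((E h ^^ Suc k) x)) \<le> r * C * b ^ k" for k using bound[of k] r by simp
  from Lim_null_comparison[OF always_eventually[OF allI[OF this]] lim]
  show ?thesis by (rule LIMSEQ_imp_Suc)
qed

end

text \<open>Plancherel's identity for the discrete Fourier transform on \<open>m\<close> points.\<close>

lemma hilbert_parseval:
  fixes v :: "nat \<Rightarrow> 'a :: {complex_normed_vector, banach}"
    and ip :: "'a \<Rightarrow> 'a \<Rightarrow> complex"
  assumes ip: "hilbert_inner ip" and m: "m \<ge> 1"
  defines "\<omega> \<equiv> cis (2 * pi / real m)"
  shows "(\<Sum>k<m. (norm (\<Sum>j<m. (\<omega> ^ k) ^ j *\<^sub>C v j))\<^sup>2) = real m * (\<Sum>j<m. (norm (v j))\<^sup>2)"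
proof -
  have ip_add: "ip (x + y) z = ip x z + ip y z" for x y z using ip unfolding hilbert_inner_def by blast
  have ip_scale: "ip (c *\<^sub>C x) y = c * ip x y" for x y c using ip unfolding hilbert_inner_def by blast
  have ip_cnj: "ip y x = cnj (ip x y)" for x y using ip unfolding hilbert_inner_def by blast
  have ip_norm: "ip x x = complex_of_real ((norm x)\<^sup>2)" for x using ip unfolding hilbert_inner_def by blast
  have ip_zero: "ip 0 y = 0" for y using ip_add[of 0 0 y] by simp
  have ip_sum: "ip (sum f I) y = (\<Sum>i\<in>I. ip (f i) y)" for f :: "nat \<Rightarrow> 'a" and I y
    by (induction I rule: infinite_finite_induct) (auto simp: ip_add ip_zero)
  have ip_sum2: "ip y (sum f I) = (\<Sum>i\<in>I. ip y (f i))" for f :: "nat \<Rightarrow> 'a" and I y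
    unfolding ip_cnj[of _ "sum f I"] ip_sum ip_cnj[of y] by simp
  have ip_scale2: "ip y (c *\<^sub>C x) = cnj c * ip y x" for c x y
    using ip_cnj[of y "c *\<^sub>C x"] ip_cnj[of y x] by (simp add: ip_scale)
  have \<omega>\<omega>: "\<omega> * cnj \<omega> = 1" by (simp add: \<omega>_def cis_cnj cis_mult)
  have \<omega>m: "\<omega> ^ m = 1" using m by (simp add: \<omega>_def Complex.DeMoivre)
  have inj: "j = l" if "j < m" "l < m" "\<omega> ^ j = \<omega> ^ l" for j l
  proof -
    have "\<omega> ^ i = exp (2 * of_real pi * \<i> * of_nat i / of_nat m)" for i
    proof -
      have "\<omega> ^ i = cis (real i * (2 * pi / real m))" by (simp add: \<omega>_def Complex.DeMoivre)
      also have "\<dots> = exp (2 * of_real pi * \<i> * of_nat i / of_nat m)" unfolding cis_conv_exp by (simp add: mult_ac)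
      finally show ?thesis .
    qed
    then have "j mod m = l mod m" using that(3) complex_root_unity_eq[OF m, of j l] by simp
    then show ?thesis using that by simp
  qed
  have orth: "(\<Sum>k<m. (\<omega> ^ k) ^ j * cnj ((\<omega> ^ k) ^ l)) = (if j = l then of_nat m else 0)" if "j < m" "l < m" for j l
  proof -
    define q where "q = \<omega> ^ j * cnj \<omega> ^ l"
    have eq: "(\<omega> ^ k) ^ j * cnj ((\<omega> ^ k) ^ l) = q ^ k" for k
      by (simp add: q_def power_mult_distrib power_mult[symmetric] mult.commute)
    have qm: "q ^ m = 1"
    proof -
      have "q ^ m = (\<omega> ^ m) ^ j * cnj ((\<omega> ^ m) ^ l)"
        by (simp add: q_def power_mult_distrib power_mult[symmetric] mult.commute)
      then show ?thesis by (simp add: \<omega>m)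
    qed
    have \<omega>l: "cnj \<omega> ^ l * \<omega> ^ l = 1" using \<omega>\<omega> by (simp add: power_mult_distrib[symmetric] mult.commute)
    show ?thesis
    proof (cases "j = l")
      case True
      then have "q = 1" using \<omega>l by (simp add: q_def mult.commute)
      then show ?thesis unfolding eq using True by simp
    next
      case False
      have "q \<noteq> 1"
      proof
        assume "q = 1"
        then have "\<omega> ^ j * (cnj \<omega> ^ l * \<omega> ^ l) = \<omega> ^ l" by (simp add: q_def mult.assoc[symmetric])
        then show False using inj[OF that] False \<omega>l by simp
      qed
      then have "(\<Sum>k<m. q ^ k) = 0" using geometric_sum[of q m] qm by simp
      then show ?thesis unfolding eq using False by simp
    qed
  qed
  have expand: "complex_of_real ((norm (\<Sum>j<m. (\<omega> ^ k) ^ j *\<^sub>C v j))\<^sup>2)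
    = (\<Sum>j<m. \<Sum>l<m. ((\<omega> ^ k) ^ j * cnj ((\<omega> ^ k) ^ l)) * ip (v j) (v l))" for k
    unfolding ip_norm[symmetric] ip_sum unfolding ip_sum2 unfolding ip_scale ip_scale2 by (simp only: mult_ac)
  have "complex_of_real (\<Sum>k<m. (norm (\<Sum>j<m. (\<omega> ^ k) ^ j *\<^sub>C v j))\<^sup>2)
    = (\<Sum>k<m. \<Sum>j<m. \<Sum>l<m. ((\<omega> ^ k) ^ j * cnj ((\<omega> ^ k) ^ l)) * ip (v j) (v l))"
    by (simp only: of_real_sum expand)
  also have "\<dots> = (\<Sum>j<m. \<Sum>l<m. \<Sum>k<m. ((\<omega> ^ k) ^ j * cnj ((\<omega> ^ k) ^ l)) * ip (v j) (v l))"
    by (rule trans[OF sum.swap], rule sum.cong[OF refl], rule sum.swap)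
  also have "\<dots> = (\<Sum>j<m. \<Sum>l<m. (if j = l then of_nat m else 0) * ip (v j) (v l))"
    by (intro sum.cong refl) (simp only: sum_distrib_right[symmetric] lessThan_iff orth)
  also have "\<dots> = (\<Sum>j<m. of_nat m * ip (v j) (v j))"
    by (intro sum.cong refl) (simp add: if_distrib[of "\<lambda>c. c * _"] cong: if_cong)
  also have "\<dots> = complex_of_real (real m * (\<Sum>j<m. (norm (v j))\<^sup>2))"
    by (simp add: ip_norm sum_distrib_left)
  finally show ?thesis by (simp only: of_real_eq_iff)
qed

context half_plane_resolvent
begin

text \<open>The convolution of \<open>f\<^sub>j = r\<^sup>j E\<^sup>j y\<close>, \<open>j < N\<close>, with \<open>r\<^sup>k E\<^sup>k\<close> is \<open>v\<^sub>i = min (i + 1) N f\<^sub>i\<close>.  Its discrete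
  Fourier transform over \<open>m\<close> points solves \<open>(I - r \<eta> E) V = \<Sum> \<eta>\<^sup>i f\<^sub>i - N f\<^sub>m\<close> for every \<open>m\<close>-th root of unity
  \<open>\<eta>\<close>; the last term comes from wrapping around and vanishes as \<open>m\<close> grows.  Thus \<open>norm_bound_of_E\<close> at
  each frequency and Plancherel's identity yield the \<open>\<ell>\<^sup>2\<close> bound.\<close>

lemma hilbert_window:
  assumes ip: "hilbert_inner (ip :: 'a \<Rightarrow> 'a \<Rightarrow> complex)"
    and h: "h > 0" "w * h \<le> 1 / 2" "real N * h \<le> 1" and N: "N \<ge> 1" "2 * N \<le> n" and r: "0 \<le> r" "r < 1"
  shows "(\<Sum>i\<in>{n-N<..n}. (real N * r ^ i * norm ((E h ^^ i) y))\<^sup>2)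
    \<le> (1 + \<kappa> ((1 - r) / h) / h)\<^sup>2 * (real N * (M1 * norm y)\<^sup>2)"
proof -
  define B where "B = 1 + \<kappa> ((1 - r) / h) / h"
  define f where "f i = r ^ i *\<^sub>R (E h ^^ i) y" for i
  define v where "v i = real (min (Suc i) N) *\<^sub>R f i" for i
  have rEf: "r *\<^sub>R E h (f i) = f (Suc i)" for i by (simp add: f_def E_simps)
  have rEv: "r *\<^sub>R E h (v i) = real (min (Suc i) N) *\<^sub>R f (Suc i)" for i
    unfolding v_def E_simps rEf[symmetric] by (simp add: mult.commute)
  have f_norm: "norm (f i) \<le> M1 * norm y" if "i < N" for i
    unfolding f_def by (rule scaled_E_power_bound[OF h r that])
  define e where "e m = real N *\<^sub>R f m" for m
  have key: "(\<Sum>i\<in>{n-N<..n}. (real N * r ^ i * norm ((E h ^^ i) y))\<^sup>2) \<le> B\<^sup>2 * (real N * (M1 * norm y + norm (e m))\<^sup>2)"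
    if m: "m > n" for m
  proof -
    \<comment> \<open>The right-hand side of the equation for the transform, with the wrap-around term placed at index \<open>0\<close>.\<close>
    define g where "g i = (if i < N then f i else 0) - (if i = 0 then e m else 0)" for i
    define \<omega> where "\<omega> = cis (2 * pi / real m)"
    have "real m * (2 * pi / real m) = 2 * pi" using m by simp
    then have \<omega>m: "\<omega> ^ m = 1" unfolding \<omega>_def Complex.DeMoivre by simp
    have tele: "(\<Sum>i<Suc k. \<eta> ^ i *\<^sub>C v i) - (of_real r * \<eta>) *\<^sub>C E h (\<Sum>i<Suc k. \<eta> ^ i *\<^sub>C v i)
      = (\<Sum>i<Suc k. \<eta> ^ i *\<^sub>C (if i < N then f i else 0)) - \<eta> ^ Suc k *\<^sub>C (r *\<^sub>R E h (v k))" for \<eta> :: complex and k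
    proof (induction k)
      case 0
      show ?case using N h by (simp add: v_def E_scaleC scaleR_scaleC scaleC_scaleC mult.commute)
    next
      case (Suc k)
      have v: "v (Suc k) = (if Suc k < N then f (Suc k) else 0) + r *\<^sub>R E h (v k)"
      proof (cases "Suc k < N")
        case True
        have "real (Suc (Suc k)) = 1 + real (Suc k)" by simp
        moreover have "min (Suc (Suc k)) N = Suc (Suc k)" "min (Suc k) N = Suc k" using True by auto
        ultimately show ?thesis using True unfolding rEv unfolding v_def by (simp only: if_True scaleR_add_left scaleR_one)
      next
        case False
        then show ?thesis unfolding rEv unfolding v_def by (simp add: min_def)
      qed
      have Ev: "(of_real r * \<eta>) *\<^sub>C E h (\<eta> ^ Suc k *\<^sub>C v (Suc k)) = \<eta> ^ Suc (Suc k) *\<^sub>C (r *\<^sub>R E h (v (Suc k)))"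
        using h by (simp add: E_scaleC scaleR_scaleC scaleC_scaleC mult_ac)
      have "(\<Sum>i<Suc (Suc k). \<eta> ^ i *\<^sub>C v i) - (of_real r * \<eta>) *\<^sub>C E h (\<Sum>i<Suc (Suc k). \<eta> ^ i *\<^sub>C v i)
        = ((\<Sum>i<Suc k. \<eta> ^ i *\<^sub>C v i) - (of_real r * \<eta>) *\<^sub>C E h (\<Sum>i<Suc k. \<eta> ^ i *\<^sub>C v i))
          + (\<eta> ^ Suc k *\<^sub>C v (Suc k) - (of_real r * \<eta>) *\<^sub>C E h (\<eta> ^ Suc k *\<^sub>C v (Suc k)))"
        unfolding sum.lessThan_Suc[of _ "Suc k"] E_simps scaleC_add_right by (simp only: add_diff_add)
      also have "\<dots> = (\<Sum>i<Suc k. \<eta> ^ i *\<^sub>C (if i < N then f i else 0)) - \<eta> ^ Suc k *\<^sub>C (r *\<^sub>R E h (v k))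
          + (\<eta> ^ Suc k *\<^sub>C ((if Suc k < N then f (Suc k) else 0) + r *\<^sub>R E h (v k)) - \<eta> ^ Suc (Suc k) *\<^sub>C (r *\<^sub>R E h (v (Suc k))))"
        unfolding Suc Ev v[symmetric] ..
      also have "\<dots> = (\<Sum>i<Suc (Suc k). \<eta> ^ i *\<^sub>C (if i < N then f i else 0)) - \<eta> ^ Suc (Suc k) *\<^sub>C (r *\<^sub>R E h (v (Suc k)))"
        unfolding sum.lessThan_Suc[of _ "Suc k"] scaleC_add_right by simp
      finally show ?case .
    qed
    have each: "(norm (\<Sum>i<m. (\<omega> ^ k) ^ i *\<^sub>C v i))\<^sup>2 \<le> B\<^sup>2 * (norm (\<Sum>i<m. (\<omega> ^ k) ^ i *\<^sub>C g i))\<^sup>2" for k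
    proof -
      define \<eta> where "\<eta> = \<omega> ^ k"
      have \<eta>m: "\<eta> ^ m = 1" unfolding \<eta>_def by (metis \<omega>m power_mult mult.commute power_one)
      have \<eta>1: "cmod \<eta> = 1" by (simp add: \<eta>_def \<omega>_def norm_power)
      obtain k' where k': "m = Suc k'" using m by (cases m) auto
      have "(\<Sum>i<m. \<eta> ^ i *\<^sub>C v i) - (of_real r * \<eta>) *\<^sub>C E h (\<Sum>i<m. \<eta> ^ i *\<^sub>C v i)
        = (\<Sum>i<m. \<eta> ^ i *\<^sub>C (if i < N then f i else 0)) - e m"
        using tele[where k = k' and \<eta> = \<eta>] \<eta>m N m unfolding k' rEv by (simp add: e_def min_def)
      also have "e m = (\<Sum>i<m. \<eta> ^ i *\<^sub>C (if i = 0 then e m else 0))"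
      proof -
        have "(\<Sum>i<m. \<eta> ^ i *\<^sub>C (if i = 0 then e m else 0)) = (\<Sum>i<m. if i = 0 then e m else 0)"
          by (intro sum.cong) auto
        then show ?thesis using k' by simp
      qed
      finally have eq: "(\<Sum>i<m. \<eta> ^ i *\<^sub>C v i) - (of_real r * \<eta>) *\<^sub>C E h (\<Sum>i<m. \<eta> ^ i *\<^sub>C v i) = (\<Sum>i<m. \<eta> ^ i *\<^sub>C g i)"
        by (simp add: sum_subtractf[symmetric] scaleC_diff_right g_def)
      have "norm (\<Sum>i<m. \<eta> ^ i *\<^sub>C v i) \<le> B * norm (\<Sum>i<m. \<eta> ^ i *\<^sub>C g i)"
        unfolding B_def eq[symmetric] using h(1) r \<eta>1 by (intro norm_bound_of_E) (auto simp: norm_mult)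
      from power_mono[OF this, of 2] show ?thesis by (simp add: \<eta>_def power_mult_distrib)
    qed
    have "real m * (\<Sum>i<m. (norm (v i))\<^sup>2) = (\<Sum>k<m. (norm (\<Sum>i<m. (\<omega> ^ k) ^ i *\<^sub>C v i))\<^sup>2)"
      unfolding \<omega>_def using m by (intro hilbert_parseval[OF ip, symmetric]) simp
    also have "\<dots> \<le> (\<Sum>k<m. B\<^sup>2 * (norm (\<Sum>i<m. (\<omega> ^ k) ^ i *\<^sub>C g i))\<^sup>2)" by (intro sum_mono each)
    also have "\<dots> = B\<^sup>2 * (real m * (\<Sum>i<m. (norm (g i))\<^sup>2))"
      unfolding sum_distrib_left[symmetric] \<omega>_def using m by (subst hilbert_parseval[OF ip]) simp_all
    finally have "real m * (\<Sum>i<m. (norm (v i))\<^sup>2) \<le> real m * (B\<^sup>2 * (\<Sum>i<m. (norm (g i))\<^sup>2))" by (simp add: mult_ac)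
    then have "(\<Sum>i<m. (norm (v i))\<^sup>2) \<le> B\<^sup>2 * (\<Sum>i<m. (norm (g i))\<^sup>2)" using m by simp
    also have "(\<Sum>i<m. (norm (g i))\<^sup>2) \<le> real N * (M1 * norm y + norm (e m))\<^sup>2"
    proof -
      have "(\<Sum>i<m. (norm (g i))\<^sup>2) = (\<Sum>i<N. (norm (g i))\<^sup>2)"
        using N m by (intro sum.mono_neutral_right) (auto simp: g_def)
      also have "\<dots> \<le> (\<Sum>i<N. (M1 * norm y + norm (e m))\<^sup>2)"
      proof (intro sum_mono power_mono)
        fix i assume i: "i \<in> {..<N}"
        have "norm (g i) \<le> norm (f i) + norm (e m)"
          using i norm_triangle_ineq4[of "f i" "e m"] by (cases "i = 0") (auto simp: g_def)
        then show "norm (g i) \<le> M1 * norm y + norm (e m)" using f_norm[of i] i by simp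
      qed simp
      finally show ?thesis by simp
    qed
    finally have "(\<Sum>i<m. (norm (v i))\<^sup>2) \<le> B\<^sup>2 * (real N * (M1 * norm y + norm (e m))\<^sup>2)"
      by (simp add: mult_left_mono)
    moreover have "(\<Sum>i\<in>{n-N<..n}. (real N * r ^ i * norm ((E h ^^ i) y))\<^sup>2) = (\<Sum>i\<in>{n-N<..n}. (norm (v i))\<^sup>2)"
      using N r by (intro sum.cong) (auto simp: v_def f_def min_def mult_ac)
    moreover have "\<dots> \<le> (\<Sum>i<m. (norm (v i))\<^sup>2)" using m by (intro sum_mono2) auto
    ultimately show ?thesis by linarith
  qed
  have "(\<lambda>m. norm (e m)) \<longlonglongrightarrow> real N * 0"
  proof -
    have "norm (e m) = real N * (r ^ m * norm ((E h ^^ m) y))" for m using r by (simp add: e_def f_def)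
    then show ?thesis using tendsto_mult[OF tendsto_const E_power_decay[OF h(1) r, of y], of "real N"] by simp
  qed
  then have "(\<lambda>m. B\<^sup>2 * (real N * (M1 * norm y + norm (e m))\<^sup>2)) \<longlonglongrightarrow> B\<^sup>2 * (real N * (M1 * norm y + real N * 0)\<^sup>2)"
    by (intro tendsto_intros)
  from LIMSEQ_le_const[OF this] key
  have "(\<Sum>i\<in>{n-N<..n}. (real N * r ^ i * norm ((E h ^^ i) y))\<^sup>2) \<le> B\<^sup>2 * (real N * (M1 * norm y + real N * 0)\<^sup>2)"
    by (meson Suc_le_lessD)
  then show ?thesis by (simp add: B_def)
qed

lemma euler_bound_from_window:
  assumes p: "p \<ge> 1" and t: "t \<ge> 1"
    and main: "\<And>h N n r. h > 0 \<Longrightarrow> w * h \<le> 1 / 2 \<Longrightarrow> real N * h \<le> 1 \<Longrightarrow> N \<ge> 1 \<Longrightarrow> 2 * N \<le> n \<Longrightarrow> 0 \<le> r \<Longrightarrow> r < 1 \<Longrightarrow>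
      (\<Sum>i\<in>{n-N<..n}. (real N * r ^ i * norm ((E h ^^ i) x)) powr p)
      \<le> (1 + \<kappa> ((1 - r) / h) / h) powr p * (real N * (M1 * norm x) powr p)"
  shows "\<forall>\<^sub>F n in sequentially. norm ((E (t / real n) ^^ n) x) \<le> 8 * exp 2 * (M1 * M1) * \<kappa> (1 / t) * norm x"
  using eventually_window[OF t]
proof eventually_elim
  case (elim n)
  then obtain N where N: "N \<ge> 1" "2 * N \<le> n" "real N * (t / real n) \<le> 1" "real n \<le> 4 * t * real N" by blast
  define h where "h = t / real n"
  define r where "r = 1 - 1 / real n"
  have n2: "n \<ge> 2" and wh: "w * h \<le> 1 / 2" using elim by (auto simp: h_def)
  have h: "h > 0" using t n2 by (simp add: h_def)
  have r: "0 \<le> r" "r < 1" using n2 by (auto simp: r_def)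
  have rh: "(1 - r) / h = 1 / t" using t n2 by (simp add: r_def h_def)
  have Nh: "real N * h \<le> 1" using N by (simp add: h_def)
  define B where "B = 1 + \<kappa> (1 / t) / h"
  have B: "B \<ge> 0" using \<kappa>_ge_1[of "1 / t"] h by (simp add: B_def)
  have "real N * r ^ n * norm ((E h ^^ n) x) \<le> M1 * M1 * B * norm x"
    using main[OF h wh Nh N(1,2) r] unfolding rh B_def[symmetric]
    by (intro window_sum[where p = p and h = h]) (use p h wh Nh N r B in auto)
  then show ?case
    using window_conclusion[OF t n2 _ N(4), of "M1 * M1" "norm ((E h ^^ n) x)" "norm x"] wh M1_ge_1
    by (simp add: h_def r_def B_def)
qed

theorem growth_hilbert:
  assumes ip: "hilbert_inner (ip :: 'a \<Rightarrow> 'a \<Rightarrow> complex)"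
  shows "\<exists>C\<ge>0. \<forall>t\<ge>0. norm (T t) \<le> C * K * (t powr \<alpha> + 1)"
proof (rule growth_from_euler[where C = "8 * exp 2 * (M1 * M1)"])
  show "0 \<le> 8 * exp 2 * (M1 * M1)" using M1_ge_1 by simp
  fix t :: real and x assume t: "t \<ge> 1"
  show "\<forall>\<^sub>F n in sequentially. norm ((E (t / real n) ^^ n) x) \<le> 8 * exp 2 * (M1 * M1) * \<kappa> (1 / t) * norm x"
  proof (rule euler_bound_from_window[of 2, OF _ t])
    fix h r :: real and N n :: nat assume *: "h > 0" "w * h \<le> 1 / 2" "real N * h \<le> 1" "N \<ge> 1" "2 * N \<le> n" "0 \<le> r" "r < 1"
    have "0 \<le> 1 + \<kappa> ((1 - r) / h) / h" using * \<kappa>_ge_1[of "(1 - r) / h"] by simp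
    then show "(\<Sum>i\<in>{n-N<..n}. (real N * r ^ i * norm ((E h ^^ i) x)) powr 2)
      \<le> (1 + \<kappa> ((1 - r) / h) / h) powr 2 * (real N * (M1 * norm x) powr 2)"
      using hilbert_window[OF ip *, of x] * M1_ge_1 by simp
  qed simp
qed

end

section \<open>Positive semigroups on \<open>L\<^sup>p\<close>\<close>

text \<open>The \<open>\<ell>\<^sup>p\<close> norm of a nonnegative vector is the supremum of its pairings with a countable family of
  nonnegative vectors \<open>c\<close>.  Countability lets inequalities that hold almost everywhere for each \<open>c\<close> be
  combined.  The optimal vector is \<open>d\<^sub>i = (v\<^sub>i / S)\<^sup>p\<^sup>-\<^sup>1\<close>, admissible by Young's inequality; rounding it down to
  rationals keeps it admissible.\<close>

lemma rational_dual_family: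
  fixes I :: "nat set" and p :: real
  assumes I: "finite I" and p: "p \<ge> 1"
  obtains C :: "(nat \<Rightarrow> real) set" where "countable C"
    "\<And>c i. c \<in> C \<Longrightarrow> i \<in> I \<Longrightarrow> 0 \<le> c i"
    "\<And>c v. c \<in> C \<Longrightarrow> \<forall>i\<in>I. 0 \<le> v i \<Longrightarrow> (\<Sum>i\<in>I. c i * v i) \<le> (\<Sum>i\<in>I. v i powr p) powr (1 / p)"
    "\<And>v G. \<forall>i\<in>I. 0 \<le> v i \<Longrightarrow> 0 \<le> G \<Longrightarrow> \<forall>c\<in>C. (\<Sum>i\<in>I. c i * v i) \<le> G \<Longrightarrow>
      (\<Sum>i\<in>I. v i powr p) \<le> G powr p"
proof -
  \<comment> \<open>The nonnegative vectors in the unit ball of the dual space, whose norm is expressed by duality in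
    order to cover \<open>p = 1\<close> as well.\<close>
  define adm where "adm c \<longleftrightarrow> (\<forall>i\<in>I. 0 \<le> c i) \<and>
      (\<forall>v. (\<forall>i\<in>I. 0 \<le> v i) \<longrightarrow> (\<Sum>i\<in>I. c i * v i) \<le> (\<Sum>i\<in>I. v i powr p) powr (1 / p))" for c :: "nat \<Rightarrow> real"
  define C where "C = {c \<in> PiE I (\<lambda>_. \<rat>). adm c}"
  have "countable (PiE I (\<lambda>_. \<rat> :: real set))" by (intro countable_PiE I countable_rat)
  then have countable: "countable C" unfolding C_def by (rule countable_subset[rotated]) auto
  have young: "a powr (p - 1) * b \<le> (p - 1) / p * a powr p + b powr p / p" if "0 \<le> a" "0 \<le> b" for a b
  proof (cases "p = 1")
    case True
    then show ?thesis using that by (cases "a = 0") auto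
  next
    case False
    then have p1: "p > 1" using p by simp
    have "a powr (p - 1) * b \<le> (a powr (p - 1)) powr (p / (p - 1)) / (p / (p - 1)) + b powr p / p"
      using p1 that by (intro Youngs_inequality) (auto simp: field_simps)
    also have "(a powr (p - 1)) powr (p / (p - 1)) = a powr p" using p1 by (simp add: powr_powr)
    finally show ?thesis using p1 by (simp add: field_simps)
  qed
  have sup: "(\<Sum>i\<in>I. v i powr p) \<le> G powr p"
    if v: "\<forall>i\<in>I. 0 \<le> v i" and G: "0 \<le> G" and le: "\<forall>c\<in>C. (\<Sum>i\<in>I. c i * v i) \<le> G" for v G
  proof -
    define S where "S = (\<Sum>i\<in>I. v i powr p) powr (1 / p)"
    have S0: "S \<ge> 0" by (simp add: S_def)
    have Sp: "S powr p = (\<Sum>i\<in>I. v i powr p)" using p by (simp add: S_def powr_powr sum_nonneg)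
    have "S \<le> G"
    proof (cases "S = 0")
      case False
      then have S: "S > 0" using S0 by simp
      define d where "d i = (v i / S) powr (p - 1)" for i
      have d0: "d i \<ge> 0" for i by (simp add: d_def)
      have normed: "(\<Sum>i\<in>I. (v i / S) powr p) = 1"
      proof -
        have "(\<Sum>i\<in>I. (v i / S) powr p) = (\<Sum>i\<in>I. v i powr p / S powr p)"
          using v S by (intro sum.cong refl) (simp add: powr_divide)
        then show ?thesis unfolding sum_divide_distrib[symmetric] Sp[symmetric] using S by simp
      qed
      have d_adm: "(\<Sum>i\<in>I. d i * y i) \<le> (\<Sum>i\<in>I. y i powr p) powr (1 / p)" if y: "\<forall>i\<in>I. 0 \<le> y i" for y
      proof -
        define Y where "Y = (\<Sum>i\<in>I. y i powr p) powr (1 / p)"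
        have Yp: "Y powr p = (\<Sum>i\<in>I. y i powr p)" using p by (simp add: Y_def powr_powr sum_nonneg)
        show ?thesis
        proof (cases "Y = 0")
          case True
          then have "(\<Sum>i\<in>I. y i powr p) = 0" using Yp p by simp
          then have "\<forall>i\<in>I. y i powr p = 0" using I by (subst (asm) sum_nonneg_eq_0_iff) auto
          then have "(\<Sum>i\<in>I. d i * y i) = 0" by (intro sum.neutral) auto
          then show ?thesis by simp
        next
          case False
          then have Y: "Y > 0" by (simp add: Y_def less_le)
          have normedY: "(\<Sum>i\<in>I. (y i / Y) powr p) = 1"
          proof -
            have "(\<Sum>i\<in>I. (y i / Y) powr p) = (\<Sum>i\<in>I. y i powr p / Y powr p)"
              using y Y by (intro sum.cong refl) (simp add: powr_divide)
            then show ?thesis unfolding sum_divide_distrib[symmetric] Yp[symmetric] using Y by simp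
          qed
          have "(\<Sum>i\<in>I. d i * (y i / Y)) \<le> (\<Sum>i\<in>I. (p - 1) / p * (v i / S) powr p + (y i / Y) powr p / p)"
            unfolding d_def using v y S Y by (intro sum_mono young) auto
          also have "\<dots> = (p - 1) / p * (\<Sum>i\<in>I. (v i / S) powr p) + (\<Sum>i\<in>I. (y i / Y) powr p) / p"
            by (simp only: sum.distrib sum_distrib_left sum_divide_distrib)
          also have "\<dots> = 1" unfolding normed normedY using p by (simp add: field_simps)
          finally have "(\<Sum>i\<in>I. d i * y i) / Y \<le> 1" by (simp add: sum_divide_distrib)
          then show ?thesis using Y by (simp add: Y_def[symmetric])
        qed
      qed
      have d_sum: "(\<Sum>i\<in>I. d i * v i) = S"
      proof -
        have "d i * v i = S * (v i / S) powr p" if i: "i \<in> I" for i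
        proof (cases "v i = 0")
          case False
          then have "v i / S > 0" using v S i by (simp add: less_le)
          then have "(v i / S) powr p = (v i / S) powr (p - 1) * (v i / S)"
            by (metis powr_add powr_one less_imp_le diff_add_cancel)
          then show ?thesis using S by (simp add: d_def)
        qed (use p in simp)
        then have "(\<Sum>i\<in>I. d i * v i) = S * (\<Sum>i\<in>I. (v i / S) powr p)" by (simp add: sum_distrib_left)
        then show ?thesis by (simp add: normed)
      qed
      have approx: "S - (\<Sum>i\<in>I. v i) * (1 / real k) \<le> G" if k: "k \<ge> 1" for k :: nat
      proof -
        define c where "c = (\<lambda>i\<in>I. of_int \<lfloor>real k * d i\<rfloor> / real k)"
        have c: "0 \<le> c i" "c i \<le> d i" "d i \<le> c i + 1 / real k" if "i \<in> I" for i
        proof -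
          have fl: "of_int \<lfloor>real k * d i\<rfloor> \<le> real k * d i" "real k * d i \<le> of_int \<lfloor>real k * d i\<rfloor> + 1" by linarith+
          have "0 \<le> \<lfloor>real k * d i\<rfloor>" using d0[of i] by simp
          then show "0 \<le> c i" using that by (simp add: c_def)
          show "c i \<le> d i" using that fl(1) k by (simp add: c_def field_simps)
          show "d i \<le> c i + 1 / real k" using that fl(2) k by (simp add: c_def field_simps)
        qed
        have "c \<in> PiE I (\<lambda>_. \<rat>)" by (auto simp: c_def)
        moreover have "adm c" unfolding adm_def
        proof (intro conjI ballI allI impI c(1))
          fix y :: "nat \<Rightarrow> real" assume y: "\<forall>i\<in>I. 0 \<le> y i"
          have "(\<Sum>i\<in>I. c i * y i) \<le> (\<Sum>i\<in>I. d i * y i)" using c(2) y by (intro sum_mono mult_right_mono) auto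
          also note d_adm[OF y]
          finally show "(\<Sum>i\<in>I. c i * y i) \<le> (\<Sum>i\<in>I. y i powr p) powr (1 / p)" .
        qed
        ultimately have "c \<in> C" by (simp add: C_def)
        then have cG: "(\<Sum>i\<in>I. c i * v i) \<le> G" using le by blast
        have "S \<le> (\<Sum>i\<in>I. (c i + 1 / real k) * v i)" unfolding d_sum[symmetric]
          using c(3) v by (intro sum_mono mult_right_mono) auto
        also have "\<dots> = (\<Sum>i\<in>I. c i * v i) + (\<Sum>i\<in>I. v i) * (1 / real k)"
          unfolding distrib_right sum.distrib sum_distrib_left[symmetric] by simp
        finally show ?thesis using cG by linarith
      qed
      have "(\<lambda>k. S - (\<Sum>i\<in>I. v i) * (1 / real k)) \<longlonglongrightarrow> S - (\<Sum>i\<in>I. v i) * 0"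
        by (intro tendsto_diff tendsto_const tendsto_mult lim_1_over_n)
      from LIMSEQ_le_const2[OF this] approx show ?thesis by auto
    qed (use G in simp)
    then have "S powr p \<le> G powr p" using S0 p by (intro powr_mono2) auto
    then show ?thesis by (simp add: Sp)
  qed
  show thesis
  proof (rule that[OF countable])
    show "0 \<le> c i" if "c \<in> C" "i \<in> I" for c i using that by (simp add: C_def adm_def)
    show "(\<Sum>i\<in>I. c i * v i) \<le> (\<Sum>i\<in>I. v i powr p) powr (1 / p)" if "c \<in> C" "\<forall>i\<in>I. 0 \<le> v i" for c v
      using that by (simp add: C_def adm_def)
  qed (rule sup)
qed

text \<open>Nonnegative elements are represented by functions that are nonnegative everywhere: \<open>U\<close> is the set of these
  functions and \<open>\<Psi>\<close> their embedding, whose image is the cone (\<open>nonneg_eq\<close>).\<close>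

locale Lp_model =
  fixes \<Phi> :: "('m \<Rightarrow> complex) \<Rightarrow> 'a :: {complex_normed_vector, banach}" and p :: real and M :: "'m measure"
  assumes p_ge_1: "1 \<le> p" and identifies: "identifies_Lp \<Phi> p M"
begin

definition U :: "('m \<Rightarrow> real) set" where
  "U = {u. u \<in> borel_measurable M \<and> (\<forall>w. 0 \<le> u w) \<and> integrable M (\<lambda>w. u w powr p)}"

definition \<Psi> :: "('m \<Rightarrow> real) \<Rightarrow> 'a" where "\<Psi> u = \<Phi> (\<lambda>w. complex_of_real (u w))"

lemma Lp_measurable: "f \<in> Lp_functions p M \<Longrightarrow> f \<in> borel_measurable M"
  by (simp add: Lp_functions_def)

lemma Lp_dominated:
  assumes f: "f \<in> Lp_functions p M" and g: "g \<in> borel_measurable M" and le: "\<And>w. cmod (g w) \<le> cmod (f w)"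
  shows "g \<in> Lp_functions p M"
  unfolding Lp_functions_def
proof (intro CollectI conjI g)
  show "integrable M (\<lambda>w. cmod (g w) powr p)"
  proof (rule Bochner_Integration.integrable_bound)
    show "integrable M (\<lambda>w. cmod (f w) powr p)" using f by (simp add: Lp_functions_def)
    show "AE w in M. norm (cmod (g w) powr p) \<le> norm (cmod (f w) powr p)"
      using le p_ge_1 by (auto intro!: powr_mono2)
  qed (use g in measurable)
qed

lemma powr_add_le: "(a + b) powr p \<le> 2 powr p * (a powr p + b powr p)" if "0 \<le> a" "0 \<le> b" for a b :: real
proof -
  have "(a + b) powr p \<le> (2 * max a b) powr p" using that p_ge_1 by (intro powr_mono2) auto
  also have "\<dots> = 2 powr p * (max a b) powr p" using that by (simp add: powr_mult)
  also have "(max a b) powr p \<le> a powr p + b powr p" by (auto simp: max_def)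
  finally show ?thesis by (simp add: mult_left_mono)
qed

lemma Lp_add:
  assumes "f \<in> Lp_functions p M" "g \<in> Lp_functions p M"
  shows "(\<lambda>w. f w + g w) \<in> Lp_functions p M"
  unfolding Lp_functions_def
proof (intro CollectI conjI)
  have f: "f \<in> borel_measurable M" "integrable M (\<lambda>w. cmod (f w) powr p)"
    and g: "g \<in> borel_measurable M" "integrable M (\<lambda>w. cmod (g w) powr p)"
    using assms by (auto simp: Lp_functions_def)
  show "(\<lambda>w. f w + g w) \<in> borel_measurable M" using f g by measurable
  show "integrable M (\<lambda>w. cmod (f w + g w) powr p)"
  proof (rule Bochner_Integration.integrable_bound)
    show "integrable M (\<lambda>w. 2 powr p * (cmod (f w) powr p + cmod (g w) powr p))" using f g by simp
    have "cmod (f w + g w) powr p \<le> 2 powr p * (cmod (f w) powr p + cmod (g w) powr p)" for w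
      using p_ge_1 by (intro order_trans[OF powr_mono2[OF _ _ norm_triangle_ineq] powr_add_le]) auto
    then show "AE w in M. norm (cmod (f w + g w) powr p) \<le> norm (2 powr p * (cmod (f w) powr p + cmod (g w) powr p))"
      by (simp add: abs_of_nonneg)
  qed (use f g in measurable)
qed

lemma Lp_scale:
  assumes "f \<in> Lp_functions p M"
  shows "(\<lambda>w. c * f w) \<in> Lp_functions p M"
  using assms by (auto simp: Lp_functions_def norm_mult powr_mult)

lemma \<Phi>_add: "f \<in> Lp_functions p M \<Longrightarrow> g \<in> Lp_functions p M \<Longrightarrow> \<Phi> (\<lambda>w. f w + g w) = \<Phi> f + \<Phi> g"
  using identifies by (auto simp: identifies_Lp_def)

lemma \<Phi>_scale: "f \<in> Lp_functions p M \<Longrightarrow> \<Phi> (\<lambda>w. c * f w) = c *\<^sub>C \<Phi> f"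
  using identifies by (auto simp: identifies_Lp_def)

lemma \<Phi>_norm: "f \<in> Lp_functions p M \<Longrightarrow> norm (\<Phi> f) powr p = (\<integral>w. cmod (f w) powr p \<partial>M)"
  using identifies p_ge_1 by (auto simp: identifies_Lp_def Lp_norm_def powr_powr)

lemma \<Phi>_surj: "\<exists>f\<in>Lp_functions p M. x = \<Phi> f"
  using identifies by (auto simp: identifies_Lp_def)

lemma Lp_diff:
  assumes "f \<in> Lp_functions p M" "g \<in> Lp_functions p M"
  shows "(\<lambda>w. f w - g w) \<in> Lp_functions p M" "\<Phi> (\<lambda>w. f w - g w) = \<Phi> f - \<Phi> g"
  using Lp_add[OF assms(1) Lp_scale[OF assms(2), of "-1"]] \<Phi>_add[OF assms(1) Lp_scale[OF assms(2), of "-1"]]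
    \<Phi>_scale[OF assms(2), of "-1"] scaleC_minus_left[of 1 "\<Phi> g"] by auto

lemma \<Phi>_mono:
  assumes "f \<in> Lp_functions p M" "g \<in> Lp_functions p M" "\<And>w. cmod (f w) \<le> cmod (g w)"
  shows "norm (\<Phi> f) \<le> norm (\<Phi> g)"
proof -
  have "norm (\<Phi> f) powr p \<le> norm (\<Phi> g) powr p"
    unfolding \<Phi>_norm[OF assms(1)] \<Phi>_norm[OF assms(2)]
    using assms p_ge_1 by (intro integral_mono powr_mono2) (auto simp: Lp_functions_def)
  then show ?thesis using powr_less_mono2[of p "norm (\<Phi> g)" "norm (\<Phi> f)"] p_ge_1 by (force simp: not_le[symmetric])
qed

lemma \<Phi>_eq_0_iff:
  assumes f: "f \<in> Lp_functions p M"
  shows "\<Phi> f = 0 \<longleftrightarrow> (AE w in M. f w = 0)"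
proof -
  have int: "integrable M (\<lambda>w. cmod (f w) powr p)" using f by (simp add: Lp_functions_def)
  have "\<Phi> f = 0 \<longleftrightarrow> norm (\<Phi> f) powr p = 0" using p_ge_1 by simp
  also have "\<dots> \<longleftrightarrow> (AE w in M. cmod (f w) powr p = 0)"
    unfolding \<Phi>_norm[OF f] by (rule integral_nonneg_eq_0_iff_AE[OF int]) simp
  finally show ?thesis by simp
qed

lemma \<Phi>_cong_AE:
  assumes "f \<in> Lp_functions p M" "g \<in> Lp_functions p M" "AE w in M. f w = g w"
  shows "\<Phi> f = \<Phi> g"
  using \<Phi>_eq_0_iff[OF Lp_diff(1)[OF assms(1,2)]] Lp_diff(2)[OF assms(1,2)] assms(3) by auto

lemma U_Lp: "u \<in> U \<Longrightarrow> (\<lambda>w. complex_of_real (u w)) \<in> Lp_functions p M"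
  unfolding U_def Lp_functions_def by auto

lemma UI_Lp:
  assumes "f \<in> Lp_functions p M" "u \<in> borel_measurable M" "\<And>w. 0 \<le> u w" "\<And>w. u w \<le> cmod (f w)"
  shows "u \<in> U"
proof -
  have "(\<lambda>w. complex_of_real (u w)) \<in> Lp_functions p M"
    by (rule Lp_dominated[OF assms(1)]) (use assms in \<open>auto intro: borel_measurable_of_real\<close>)
  then show ?thesis using assms by (auto simp: Lp_functions_def U_def)
qed

lemma U_add: "u \<in> U \<Longrightarrow> v \<in> U \<Longrightarrow> (\<lambda>w. u w + v w) \<in> U"
  using UI_Lp[OF Lp_add[OF U_Lp U_Lp], of u v "\<lambda>w. u w + v w"] unfolding U_def
  by (auto simp: of_real_add[symmetric] simp del: of_real_add)

lemma U_scale: "u \<in> U \<Longrightarrow> 0 \<le> c \<Longrightarrow> (\<lambda>w. c * u w) \<in> U"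
  unfolding U_def by (auto simp: powr_mult)

lemma U_zero: "(\<lambda>w. 0) \<in> U"
  unfolding U_def by simp

lemma U_sum: "finite I \<Longrightarrow> (\<And>i. i \<in> I \<Longrightarrow> u i \<in> U) \<Longrightarrow> (\<lambda>w. \<Sum>i\<in>I. u i w) \<in> U"
  by (induction I rule: finite_induct) (auto intro: U_add U_zero)

lemma \<Psi>_add: "u \<in> U \<Longrightarrow> v \<in> U \<Longrightarrow> \<Psi> (\<lambda>w. u w + v w) = \<Psi> u + \<Psi> v"
  using \<Phi>_add[OF U_Lp U_Lp] by (simp add: \<Psi>_def)

lemma \<Psi>_scale: "u \<in> U \<Longrightarrow> \<Psi> (\<lambda>w. c * u w) = c *\<^sub>R \<Psi> u"
  using \<Phi>_scale[OF U_Lp, of u "of_real c"] by (simp add: \<Psi>_def scaleR_scaleC)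

lemma \<Psi>_zero: "\<Psi> (\<lambda>w. 0) = 0"
  using \<Psi>_scale[OF U_zero, of 0] by simp

lemma \<Psi>_sum: "finite I \<Longrightarrow> (\<And>i. i \<in> I \<Longrightarrow> u i \<in> U) \<Longrightarrow> \<Psi> (\<lambda>w. \<Sum>i\<in>I. u i w) = (\<Sum>i\<in>I. \<Psi> (u i))"
  by (induction I rule: finite_induct) (auto simp: \<Psi>_zero \<Psi>_add U_sum)

lemma \<Psi>_norm: "u \<in> U \<Longrightarrow> norm (\<Psi> u) powr p = (\<integral>w. u w powr p \<partial>M)"
  using \<Phi>_norm[OF U_Lp, of u] by (auto simp: \<Psi>_def U_def)

text \<open>The order of the cone is the order almost everywhere of the representing functions.\<close>

lemma \<Psi>_diff_AE:
  assumes u: "u \<in> U" and v: "v \<in> U" and z: "z \<in> U" and eq: "\<Psi> v - \<Psi> u = \<Psi> z"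
  shows "AE w in M. v w - u w = z w"
proof -
  let ?c = "\<lambda>u w. complex_of_real (u w)"
  have "\<Phi> (\<lambda>w. (?c v w - ?c u w) - ?c z w) = 0"
    using Lp_diff(2)[OF Lp_diff(1)[OF U_Lp[OF v] U_Lp[OF u]] U_Lp[OF z]] Lp_diff(2)[OF U_Lp[OF v] U_Lp[OF u]] eq
    by (simp add: \<Psi>_def)
  then have "AE w in M. (?c v w - ?c u w) - ?c z w = 0"
    using \<Phi>_eq_0_iff[OF Lp_diff(1)[OF Lp_diff(1)[OF U_Lp[OF v] U_Lp[OF u]] U_Lp[OF z]]] by simp
  then show ?thesis
    by eventually_elim (simp only: of_real_diff[symmetric] of_real_eq_0_iff right_minus_eq)
qed

lemma nonneg_eq: "Lp_nonneg \<Phi> p M = \<Psi> ` U"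
proof (intro equalityI subsetI)
  fix x assume "x \<in> Lp_nonneg \<Phi> p M"
  then obtain f where f: "f \<in> Lp_functions p M" "AE w in M. f w \<in> \<real>\<^sub>\<ge>\<^sub>0" "x = \<Phi> f"
    by (auto simp: Lp_nonneg_def)
  define u where "u w = max 0 (Re (f w))" for w
  have u: "u \<in> U"
  proof (rule UI_Lp[OF f(1)])
    show "u \<in> borel_measurable M" using Lp_measurable[OF f(1)] unfolding u_def by measurable
    show "0 \<le> u w" "u w \<le> cmod (f w)" for w using complex_Re_le_cmod[of "f w"] by (auto simp: u_def)
  qed
  have "AE w in M. f w = complex_of_real (u w)"
    using f(2) by eventually_elim (auto simp: complex_nonneg_Reals_iff u_def complex_eq_iff)
  then have "x = \<Psi> u" unfolding \<Psi>_def f(3) by (intro \<Phi>_cong_AE f(1) U_Lp u)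
  then show "x \<in> \<Psi> ` U" using u by blast
next
  fix x assume "x \<in> \<Psi> ` U"
  then obtain u where u: "u \<in> U" "x = \<Psi> u" by blast
  then have "AE w in M. complex_of_real (u w) \<in> \<real>\<^sub>\<ge>\<^sub>0" by (auto simp: U_def)
  then show "x \<in> Lp_nonneg \<Phi> p M" using U_Lp[OF u(1)] u(2) by (auto simp: Lp_nonneg_def \<Psi>_def)
qed

lemma \<Psi>_mono:
  assumes u: "u \<in> U" and v: "v \<in> U" and le: "\<And>w. u w \<le> v w"
  shows "\<Psi> v - \<Psi> u \<in> \<Psi> ` U"
proof -
  have "(\<lambda>w. v w - u w) \<in> U"
    by (rule UI_Lp[OF U_Lp[OF v]]) (use u v le in \<open>auto simp: U_def\<close>)
  moreover have "\<Psi> v - \<Psi> u = \<Psi> (\<lambda>w. v w - u w)"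
    using Lp_diff(2)[OF U_Lp[OF v] U_Lp[OF u]] by (simp add: \<Psi>_def)
  ultimately show ?thesis by simp
qed

lemma nonneg_closed: "closed (\<Psi> ` U)"
  unfolding closed_sequential_limits
proof (intro allI impI, elim conjE)
  fix x l assume xP: "\<forall>n. x n \<in> \<Psi> ` U" and lim: "x \<longlonglongrightarrow> l"
  obtain f where f: "f \<in> Lp_functions p M" "l = \<Phi> f" using \<Phi>_surj by blast
  \<comment> \<open>\<open>d w\<close> bounds the distance of \<open>f w\<close> to every nonnegative number from below.\<close>
  define d where "d w = max \<bar>Im (f w)\<bar> (max 0 (- Re (f w)))" for w
  have d_le: "d w \<le> cmod (f w - complex_of_real c)" if "c \<ge> 0" for w c
  proof -
    have "\<bar>Im (f w)\<bar> \<le> cmod (f w - complex_of_real c)" using abs_Im_le_cmod[of "f w - complex_of_real c"] by simp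
    moreover have "\<bar>Re (f w) - c\<bar> \<le> cmod (f w - complex_of_real c)"
      using abs_Re_le_cmod[of "f w - complex_of_real c"] by simp
    ultimately show ?thesis using that by (auto simp: d_def)
  qed
  have d: "d \<in> U"
  proof (rule UI_Lp[OF f(1)])
    show "d \<in> borel_measurable M" using Lp_measurable[OF f(1)] unfolding d_def by measurable
    show "0 \<le> d w" "d w \<le> cmod (f w)" for w using d_le[of 0 w] by (auto simp: d_def)
  qed
  have "norm (\<Psi> d) \<le> norm (x n - l)" for n
  proof -
    obtain u where u: "u \<in> U" "x n = \<Psi> u" using xP by blast
    have "norm (\<Psi> d) \<le> norm (\<Phi> (\<lambda>w. f w - complex_of_real (u w)))"
      unfolding \<Psi>_def using d u d_le
      by (intro \<Phi>_mono U_Lp Lp_diff(1) f(1)) (auto simp: U_def)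
    also have "\<dots> = norm (x n - l)"
      using Lp_diff(2)[OF f(1) U_Lp[OF u(1)]] u(2) f(2) by (simp add: \<Psi>_def norm_minus_commute)
    finally show ?thesis .
  qed
  moreover have "(\<lambda>n. norm (x n - l)) \<longlonglongrightarrow> 0"
    using lim by (simp add: LIM_zero_iff tendsto_norm_zero_iff)
  ultimately have "norm (\<Psi> d) \<le> 0" using LIMSEQ_le_const by blast
  then have "AE w in M. complex_of_real (d w) = 0"
    using \<Phi>_eq_0_iff[OF U_Lp[OF d]] by (simp add: \<Psi>_def)
  then have "AE w in M. f w \<in> \<real>\<^sub>\<ge>\<^sub>0"
    by eventually_elim (auto simp: complex_nonneg_Reals_iff d_def max_def split: if_splits)
  then show "l \<in> \<Psi> ` U" unfolding nonneg_eq[symmetric] using f by (auto simp: Lp_nonneg_def)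
qed

lemma nonneg_norm_mono:
  assumes "x \<in> \<Psi> ` U" "y - x \<in> \<Psi> ` U"
  shows "norm x \<le> norm y"
proof -
  obtain u z where uz: "u \<in> U" "z \<in> U" "x = \<Psi> u" "y - x = \<Psi> z" using assms by blast
  have "y = (y - x) + x" by simp
  then have "y = \<Psi> (\<lambda>w. z w + u w)" using uz by (simp only: \<Psi>_add)
  then show ?thesis unfolding uz(3) \<Psi>_def
    using uz by (auto intro!: \<Phi>_mono U_Lp U_add simp: U_def simp del: of_real_add)
qed

lemma nonneg_decompose:
  "\<exists>p1\<in>\<Psi> ` U. \<exists>p2\<in>\<Psi> ` U. \<exists>p3\<in>\<Psi> ` U. \<exists>p4\<in>\<Psi> ` U. x = p1 - p2 + \<i> *\<^sub>C (p3 - p4) \<and>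
    norm p1 \<le> norm x \<and> norm p2 \<le> norm x \<and> norm p3 \<le> norm x \<and> norm p4 \<le> norm x"
proof -
  obtain f where f: "f \<in> Lp_functions p M" "x = \<Phi> f" using \<Phi>_surj by blast
  have *: "(\<lambda>w. max 0 (g (f w))) \<in> U \<and> norm (\<Psi> (\<lambda>w. max 0 (g (f w)))) \<le> norm x"
    if g: "g \<in> borel_measurable borel" "\<And>z. g z \<le> cmod z" for g :: "complex \<Rightarrow> real"
  proof -
    have "(\<lambda>w. g (f w)) \<in> borel_measurable M"
      using measurable_compose[OF Lp_measurable[OF f(1)] g(1)] by simp
    then have U: "(\<lambda>w. max 0 (g (f w))) \<in> U"
      by (intro UI_Lp[OF f(1)]) (use g in \<open>auto intro: borel_measurable_max\<close>)
    then show ?thesis unfolding f(2) \<Psi>_def using g by (auto intro!: \<Phi>_mono U_Lp f(1))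
  qed
  define u1 u2 u3 u4 where "u1 w = max 0 (Re (f w))" and "u2 w = max 0 (- Re (f w))"
    and "u3 w = max 0 (Im (f w))" and "u4 w = max 0 (- Im (f w))" for w
  have le: "Re z \<le> cmod z" "- Re z \<le> cmod z" "Im z \<le> cmod z" "- Im z \<le> cmod z" for z
    using abs_Re_le_cmod[of z] abs_Im_le_cmod[of z] by linarith+
  have u1: "u1 \<in> U" "norm (\<Psi> u1) \<le> norm x" using *[of Re] le(1) by (auto simp: u1_def[abs_def])
  have u2: "u2 \<in> U" "norm (\<Psi> u2) \<le> norm x" using *[of "\<lambda>z. - Re z"] le(2) by (auto simp: u2_def[abs_def])
  have u3: "u3 \<in> U" "norm (\<Psi> u3) \<le> norm x" using *[of Im] le(3) by (auto simp: u3_def[abs_def])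
  have u4: "u4 \<in> U" "norm (\<Psi> u4) \<le> norm x" using *[of "\<lambda>z. - Im z"] le(4) by (auto simp: u4_def[abs_def])
  have re: "\<Psi> u1 - \<Psi> u2 = \<Phi> (\<lambda>w. complex_of_real (u1 w) - complex_of_real (u2 w))"
    using Lp_diff(2)[OF U_Lp[OF u1(1)] U_Lp[OF u2(1)]] by (simp add: \<Psi>_def)
  have im: "\<i> *\<^sub>C (\<Psi> u3 - \<Psi> u4) = \<Phi> (\<lambda>w. \<i> * (complex_of_real (u3 w) - complex_of_real (u4 w)))"
    using Lp_diff(2)[OF U_Lp[OF u3(1)] U_Lp[OF u4(1)]] \<Phi>_scale[OF Lp_diff(1)[OF U_Lp[OF u3(1)] U_Lp[OF u4(1)]], of \<i>]
    by (simp add: \<Psi>_def)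
  have "f = (\<lambda>w. (complex_of_real (u1 w) - complex_of_real (u2 w)) + \<i> * (complex_of_real (u3 w) - complex_of_real (u4 w)))"
    by (auto simp: fun_eq_iff complex_eq_iff u1_def u2_def u3_def u4_def)
  then have "x = \<Psi> u1 - \<Psi> u2 + \<i> *\<^sub>C (\<Psi> u3 - \<Psi> u4)"
    unfolding f(2) re im
    using \<Phi>_add[OF Lp_diff(1)[OF U_Lp[OF u1(1)] U_Lp[OF u2(1)]] Lp_scale[OF Lp_diff(1)[OF U_Lp[OF u3(1)] U_Lp[OF u4(1)]], of \<i>]]
    by simp
  then show ?thesis using u1 u2 u3 u4 by blast
qed

end

context positive_half_plane
begin

text \<open>The case \<open>L\<^sup>p\<close> of the convolution bound.  Let \<open>F\<close> be the pointwise \<open>\<ell>\<^sup>p\<close> norm of \<open>f\<^sub>j = r\<^sup>j E\<^sup>j x\<close>,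
  \<open>j < N\<close>, and \<open>G = (I - r E)\<^sup>-\<^sup>1 F\<close>.  For an admissible \<open>c\<close>, the sum of \<open>c\<^sub>i N f\<^sub>i\<close> over the
  window is the sum over \<open>k\<close> of \<open>r\<^sup>k E\<^sup>k\<close> applied to shifted combinations \<open>s k\<close> of the \<open>f\<^sub>j\<close>, each of which lies
  below \<open>F\<close>; so it lies below \<open>G\<close>.  Taking the supremum over countably many \<open>c\<close> pointwise and
  integrating gives the claim.  This is Minkowski's inequality for the positive operators \<open>r\<^sup>k E\<^sup>k\<close>.\<close>

lemma Lp_window:
  fixes \<Phi> :: "('m \<Rightarrow> complex) \<Rightarrow> 'a"
  assumes model: "Lp_model \<Phi> p \<mu>" and P: "P = Lp_nonneg \<Phi> p \<mu>" and x: "x \<in> P"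
    and h: "h > 0" "w * h \<le> 1 / 2" "real N * h \<le> 1" and N: "N \<ge> 1" "2 * N \<le> n" and r: "0 \<le> r" "r < 1"
  shows "(\<Sum>i\<in>{n-N<..n}. (real N * r ^ i * norm ((E h ^^ i) x)) powr p)
    \<le> (1 + \<kappa> ((1 - r) / h) / h) powr p * (real N * (M1 * norm x) powr p)"
proof -
  interpret Lp: Lp_model \<Phi> p \<mu> by (rule model)
  have P_eq: "P = Lp.\<Psi> ` Lp.U" using P Lp.nonneg_eq by simp
  have p: "p \<ge> 1" by (rule Lp.p_ge_1)
  let ?I = "{n-N<..n}"
  define B where "B = 1 + \<kappa> ((1 - r) / h) / h"
  have B: "B \<ge> 0" using \<kappa>_ge_1[of "(1 - r) / h"] h by (simp add: B_def)
  define f where "f j = r ^ j *\<^sub>R (E h ^^ j) x" for j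
  have f_pos: "f j \<in> P" for j using r h x by (simp add: f_def scale_pos E_power_pos)
  have "\<forall>j. \<exists>u. u \<in> Lp.U \<and> f j = Lp.\<Psi> u" using f_pos unfolding P_eq by blast
  then obtain u where u: "\<And>j. u j \<in> Lp.U" "\<And>j. f j = Lp.\<Psi> (u j)" by metis
  have u0: "0 \<le> u j w" for j w using u(1) by (auto simp: Lp.U_def)
  have f_norm: "norm (f j) \<le> M1 * norm x" if "j < N" for j
    unfolding f_def by (rule scaled_E_power_bound[OF h r that])
  define F0 where "F0 w = (\<Sum>j<N. u j w powr p) powr (1 / p)" for w
  have F0_powr: "F0 w powr p = (\<Sum>j<N. u j w powr p)" for w
    using p by (simp add: F0_def powr_powr sum_nonneg)
  have F0: "F0 \<in> Lp.U"
  proof -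
    have [measurable]: "u j \<in> borel_measurable \<mu>" for j using u(1) by (auto simp: Lp.U_def)
    have "F0 \<in> borel_measurable \<mu>" unfolding F0_def by measurable
    moreover have "integrable \<mu> (\<lambda>w. F0 w powr p)" using u(1) unfolding F0_powr Lp.U_def by auto
    ultimately show ?thesis by (simp add: Lp.U_def F0_def)
  qed
  define F where "F = Lp.\<Psi> F0"
  have F: "F \<in> P" using F0 by (simp add: F_def P_eq)
  have F_norm: "norm F powr p \<le> real N * (M1 * norm x) powr p"
  proof -
    have "norm F powr p = (\<integral>w. (\<Sum>j<N. u j w powr p) \<partial>\<mu>)" unfolding F_def Lp.\<Psi>_norm[OF F0] F0_powr ..
    also have "\<dots> = (\<Sum>j<N. norm (f j) powr p)"
      using u by (subst Bochner_Integration.integral_sum) (auto simp: Lp.\<Psi>_norm Lp.U_def)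
    also have "\<dots> \<le> (\<Sum>j<N. (M1 * norm x) powr p)" using f_norm p by (intro sum_mono powr_mono2) auto
    finally show ?thesis by simp
  qed
  obtain G where G: "G \<in> P" "norm G \<le> B * norm F" "\<And>m. G - (\<Sum>k<m. r ^ k *\<^sub>R (E h ^^ k) F) \<in> P"
    using dominated_neumann[OF h(1) r F] unfolding B_def by blast
  obtain g where g: "g \<in> Lp.U" "G = Lp.\<Psi> g" using G(1) unfolding P_eq by blast
  have g0: "0 \<le> g w" for w using g(1) by (auto simp: Lp.U_def)
  have fin: "finite ?I" by simp
  obtain C :: "(nat \<Rightarrow> real) set" where C: "countable C"
    and C0: "\<And>c i. c \<in> C \<Longrightarrow> i \<in> ?I \<Longrightarrow> 0 \<le> c i"
    and C1: "\<And>c v. c \<in> C \<Longrightarrow> \<forall>i\<in>?I. 0 \<le> v i \<Longrightarrow> (\<Sum>i\<in>?I. c i * v i) \<le> (\<Sum>i\<in>?I. v i powr p) powr (1 / p)"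
    and C2: "\<And>v G. \<forall>i\<in>?I. 0 \<le> v i \<Longrightarrow> 0 \<le> G \<Longrightarrow> \<forall>c\<in>C. (\<Sum>i\<in>?I. c i * v i) \<le> G \<Longrightarrow> (\<Sum>i\<in>?I. v i powr p) \<le> G powr p"
    by (rule rational_dual_family[OF fin p]) (rule that, assumption+)
  have NU: "(\<lambda>w. real N * u i w) \<in> Lp.U" for i by (intro Lp.U_scale u) simp
  have "AE w in \<mu>. (\<Sum>i\<in>?I. c i * (real N * u i w)) \<le> g w" if c: "c \<in> C" for c
  proof -
    define s where "s k = (\<Sum>i\<in>{i\<in>?I. k \<le> i \<and> i - k < N}. c i *\<^sub>R f (i - k))" for k
    have Fs: "F - s k \<in> P" for k
    proof -
      let ?J = "{i\<in>?I. k \<le> i \<and> i - k < N}"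
      define s0 where "s0 w = (\<Sum>i\<in>?J. c i * u (i - k) w)" for w
      have s0: "s0 \<in> Lp.U" unfolding s0_def using C0[OF c] u(1) by (intro Lp.U_sum Lp.U_scale) auto
      have "s k = Lp.\<Psi> s0" unfolding s_def s0_def
        using C0[OF c] u by (subst Lp.\<Psi>_sum) (auto intro!: Lp.U_scale simp: Lp.\<Psi>_scale)
      moreover have "s0 w \<le> F0 w" for w
      proof -
        define v where "v i = (if i \<in> ?J then u (i - k) w else 0)" for i
        have v: "\<forall>i\<in>?I. 0 \<le> v i" using u0 by (simp add: v_def)
        have "s0 w = (\<Sum>i\<in>?I. c i * v i)"
          unfolding s0_def by (intro sum.mono_neutral_cong_left) (auto simp: v_def)
        also have "\<dots> \<le> (\<Sum>i\<in>?I. v i powr p) powr (1 / p)" by (rule C1[OF c v])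
        also have "\<dots> \<le> F0 w" unfolding F0_def
        proof (rule powr_mono2)
          have "(\<Sum>i\<in>?I. v i powr p) = (\<Sum>i\<in>?J. u (i - k) w powr p)"
            by (intro sum.mono_neutral_cong_right) (auto simp: v_def)
          also have "\<dots> = (\<Sum>j\<in>(\<lambda>i. i - k) ` ?J. u j w powr p)"
            by (intro sum.reindex_cong[symmetric, where l = "\<lambda>i. i - k"]) (auto simp: inj_on_def)
          also have "\<dots> \<le> (\<Sum>j<N. u j w powr p)" by (intro sum_mono2) auto
          finally show "(\<Sum>i\<in>?I. v i powr p) \<le> (\<Sum>j<N. u j w powr p)" .
        qed (use p in \<open>auto intro: sum_nonneg\<close>)
        finally show ?thesis .
      qed
      ultimately show ?thesis unfolding P_eq F_def using Lp.\<Psi>_mono[OF s0 F0] by simp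
    qed
    have conv: "real N *\<^sub>R f i = (\<Sum>k<Suc n. if k \<le> i \<and> i - k < N then r ^ k *\<^sub>R (E h ^^ k) (f (i - k)) else 0)"
      if i: "i \<in> ?I" for i
    proof -
      have "(\<Sum>k<Suc n. if k \<le> i \<and> i - k < N then r ^ k *\<^sub>R (E h ^^ k) (f (i - k)) else 0)
        = (\<Sum>k\<in>{i-N<..i}. f i)"
      proof (intro sum.mono_neutral_cong_right)
        fix k assume k: "k \<in> {i-N<..i}"
        then have "k \<le> i" "i - k < N" using i N by auto
        moreover from this have "r ^ k *\<^sub>R (E h ^^ k) (f (i - k)) = f i"
          by (simp add: f_def E_power_simps E_power_commute power_add[symmetric])
        ultimately show "(if k \<le> i \<and> i - k < N then r ^ k *\<^sub>R (E h ^^ k) (f (i - k)) else 0) = f i" by simp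
      qed (use i N in auto)
      also have "card {i-N<..i} = N" using i N by auto
      then have "(\<Sum>k\<in>{i-N<..i}. f i) = real N *\<^sub>R f i" by (simp add: sum_constant_scaleR)
      finally show ?thesis ..
    qed
    have "(\<Sum>i\<in>?I. c i *\<^sub>R (real N *\<^sub>R f i))
      = (\<Sum>i\<in>?I. \<Sum>k<Suc n. if k \<le> i \<and> i - k < N then r ^ k *\<^sub>R (E h ^^ k) (c i *\<^sub>R f (i - k)) else 0)"
    proof (intro sum.cong refl)
      fix i assume i: "i \<in> ?I"
      show "c i *\<^sub>R (real N *\<^sub>R f i) = (\<Sum>k<Suc n. if k \<le> i \<and> i - k < N then r ^ k *\<^sub>R (E h ^^ k) (c i *\<^sub>R f (i - k)) else 0)"
        unfolding conv[OF i] scaleR_sum_right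
        by (intro sum.cong refl) (auto simp: E_power_simps mult.commute)
    qed
    also have "\<dots> = (\<Sum>k<Suc n. \<Sum>i\<in>?I. if k \<le> i \<and> i - k < N then r ^ k *\<^sub>R (E h ^^ k) (c i *\<^sub>R f (i - k)) else 0)"
      by (rule sum.swap)
    also have "\<dots> = (\<Sum>k<Suc n. r ^ k *\<^sub>R (E h ^^ k) (s k))"
      unfolding s_def E_power_simps scaleR_sum_right
      by (intro sum.cong refl sum.mono_neutral_cong_right) auto
    finally have eq: "(\<Sum>i\<in>?I. c i *\<^sub>R (real N *\<^sub>R f i)) = (\<Sum>k<Suc n. r ^ k *\<^sub>R (E h ^^ k) (s k))" .
    have "(\<Sum>k<Suc n. r ^ k *\<^sub>R (E h ^^ k) (F - s k)) \<in> P"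
      using Fs r h by (intro sum_pos scale_pos E_power_pos) auto
    then have "(\<Sum>k<Suc n. r ^ k *\<^sub>R (E h ^^ k) F) - (\<Sum>k<Suc n. r ^ k *\<^sub>R (E h ^^ k) (s k)) \<in> P"
      by (simp only: E_power_simps scaleR_diff_right sum_subtractf)
    from add_pos[OF G(3)[of "Suc n"] this]
    have GP: "G - (\<Sum>i\<in>?I. c i *\<^sub>R (real N *\<^sub>R f i)) \<in> P"
      unfolding eq by (simp del: sum.lessThan_Suc)
    define z0 where "z0 w = (\<Sum>i\<in>?I. c i * (real N * u i w))" for w
    have z0: "z0 \<in> Lp.U" unfolding z0_def using C0[OF c] u(1) by (intro Lp.U_sum Lp.U_scale) auto
    have "Lp.\<Psi> z0 = (\<Sum>i\<in>?I. Lp.\<Psi> (\<lambda>w. c i * (real N * u i w)))" unfolding z0_def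
      using C0[OF c] u(1) by (intro Lp.\<Psi>_sum Lp.U_scale) auto
    also have "\<dots> = (\<Sum>i\<in>?I. c i *\<^sub>R (real N *\<^sub>R f i))"
      unfolding Lp.\<Psi>_scale[OF NU] Lp.\<Psi>_scale[OF u(1)] u(2) ..
    finally have "(\<Sum>i\<in>?I. c i *\<^sub>R (real N *\<^sub>R f i)) = Lp.\<Psi> z0" by (rule sym)
    with GP obtain y where y: "y \<in> Lp.U" "Lp.\<Psi> g - Lp.\<Psi> z0 = Lp.\<Psi> y" unfolding P_eq g(2) by auto
    from Lp.\<Psi>_diff_AE[OF z0 g(1) y] have "AE w in \<mu>. g w - z0 w = y w" .
    then show ?thesis
    proof eventually_elim
      case (elim w)
      moreover have "0 \<le> y w" using y(1) by (auto simp: Lp.U_def)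
      ultimately show ?case by (simp add: z0_def)
    qed
  qed
  then have "AE w in \<mu>. \<forall>c\<in>C. (\<Sum>i\<in>?I. c i * (real N * u i w)) \<le> g w"
    by (subst AE_ball_countable[OF C]) blast
  then have AE: "AE w in \<mu>. (\<Sum>i\<in>?I. (real N * u i w) powr p) \<le> g w powr p"
  proof eventually_elim
    case (elim w)
    show ?case by (rule C2[OF _ g0 elim]) (use u0 in simp)
  qed
  have int: "integrable \<mu> (\<lambda>w. (real N * u i w) powr p)" for i using NU[of i] by (simp add: Lp.U_def)
  have "(\<Sum>i\<in>?I. (real N * r ^ i * norm ((E h ^^ i) x)) powr p) = (\<Sum>i\<in>?I. norm (Lp.\<Psi> (\<lambda>w. real N * u i w)) powr p)"
    using r by (intro sum.cong refl) (simp add: Lp.\<Psi>_scale u(1) u(2)[symmetric] f_def mult.assoc)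
  also have "\<dots> = (\<integral>w. (\<Sum>i\<in>?I. (real N * u i w) powr p) \<partial>\<mu>)"
    using int by (simp only: Lp.\<Psi>_norm[OF NU] Bochner_Integration.integral_sum)
  also have "\<dots> \<le> (\<integral>w. g w powr p \<partial>\<mu>)"
    using AE int g(1) by (intro integral_mono_AE Bochner_Integration.integrable_sum) (auto simp: Lp.U_def)
  also have "\<dots> = norm G powr p" using Lp.\<Psi>_norm[OF g(1)] g(2) by simp
  also have "\<dots> \<le> (B * norm F) powr p" using G(2) p by (intro powr_mono2) auto
  also have "\<dots> = B powr p * norm F powr p" using B by (simp add: powr_mult)
  also have "\<dots> \<le> B powr p * (real N * (M1 * norm x) powr p)" by (intro mult_left_mono F_norm) auto
  finally show ?thesis by (simp add: B_def)
qed

end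

context half_plane_resolvent
begin

theorem growth_Lp:
  fixes \<Phi> :: "('m \<Rightarrow> complex) \<Rightarrow> 'a"
  assumes p: "1 \<le> p" and \<Phi>: "identifies_Lp \<Phi> p \<mu>"
    and pos: "\<And>t. t \<ge> 0 \<Longrightarrow> positive_operator (Lp_nonneg \<Phi> p \<mu>) (T t)"
  shows "\<exists>C\<ge>0. \<forall>t\<ge>0. norm (T t) \<le> C * K * (t powr \<alpha> + 1)"
proof -
  define P where "P = Lp_nonneg \<Phi> p \<mu>"
  interpret Lp: Lp_model \<Phi> p \<mu> using p \<Phi> by unfold_locales
  have P_eq: "P = Lp.\<Psi> ` Lp.U" using Lp.nonneg_eq by (simp add: P_def)
  interpret positive_half_plane T D A \<alpha> K M w P 1
  proof unfold_locales
    show "0 \<in> P" unfolding P_eq using Lp.U_zero Lp.\<Psi>_zero by (intro image_eqI[of _ _ "\<lambda>w. 0"]) auto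
    show "x + y \<in> P" if "x \<in> P" "y \<in> P" for x y
    proof -
      obtain u v where "u \<in> Lp.U" "v \<in> Lp.U" "x = Lp.\<Psi> u" "y = Lp.\<Psi> v" using \<open>x \<in> P\<close> \<open>y \<in> P\<close> unfolding P_eq by blast
      then show ?thesis unfolding P_eq using Lp.\<Psi>_add Lp.U_add by (intro image_eqI[of _ _ "\<lambda>w. u w + v w"]) auto
    qed
    show "a *\<^sub>R x \<in> P" if "x \<in> P" "0 \<le> a" for x a
    proof -
      obtain u where "u \<in> Lp.U" "x = Lp.\<Psi> u" using \<open>x \<in> P\<close> unfolding P_eq by blast
      then show ?thesis unfolding P_eq using Lp.\<Psi>_scale Lp.U_scale \<open>0 \<le> a\<close> by (intro image_eqI[of _ _ "\<lambda>w. a * u w"]) auto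
    qed
    show "closed P" unfolding P_eq by (rule Lp.nonneg_closed)
    show "T t x \<in> P" if "0 \<le> t" "x \<in> P" for t x
      using pos that by (simp add: P_def positive_operator_def)
    show "norm x \<le> norm y" if "x \<in> P" "y - x \<in> P" for x y
      using Lp.nonneg_norm_mono that unfolding P_eq by blast
    show "\<exists>p1\<in>P. \<exists>p2\<in>P. \<exists>p3\<in>P. \<exists>p4\<in>P. x = p1 - p2 + \<i> *\<^sub>C (p3 - p4) \<and>
      norm p1 \<le> 1 * norm x \<and> norm p2 \<le> 1 * norm x \<and> norm p3 \<le> 1 * norm x \<and> norm p4 \<le> 1 * norm x" for x
      using Lp.nonneg_decompose[of x] unfolding P_eq mult_1 .
  qed simp
  have model: "Lp_model \<Phi> p \<mu>" by unfold_locales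
  show ?thesis
  proof (rule growth_from_positive[where C = "8 * exp 2 * (M1 * M1)"])
    show "0 \<le> 8 * exp 2 * (M1 * M1)" using M1_ge_1 by simp
    fix t :: real and x assume t: "t \<ge> 1" and x: "x \<in> P"
    show "\<forall>\<^sub>F n in sequentially. norm ((E (t / real n) ^^ n) x) \<le> 8 * exp 2 * (M1 * M1) * \<kappa> (1 / t) * norm x"
      by (rule euler_bound_from_window[OF p t]) (rule Lp_window[OF model P_def x])
  qed
qed

end

section \<open>Positive semigroups on lattices of continuous functions\<close>

text \<open>Elements are evaluated at points through \<open>ev\<close>; positivity and the norm are then pointwise notions.\<close>

locale Cb_model =
  fixes J :: "'a :: {complex_normed_vector, banach} \<Rightarrow> ('w :: topological_space \<Rightarrow>\<^sub>C complex)"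
  assumes embeds: "embeds_Cb J" and lattice: "Cb_banach_lattice (range J)"
    and unit_or_sublattice: "const_bcontfun 1 \<in> range J \<or> Cb_sublattice (range J)"
begin

abbreviation ev :: "'a \<Rightarrow> 'w \<Rightarrow> complex" where "ev x w \<equiv> apply_bcontfun (J x) w"

lemma J_linear: "bounded_linear J"
  using embeds by (simp add: embeds_Cb_def bounded_clinear_def)

lemma ev_add: "ev (x + y) w = ev x w + ev y w"
  by (simp add: linear_add[OF bounded_linear.linear[OF J_linear]] plus_bcontfun.rep_eq)

lemma ev_diff: "ev (x - y) w = ev x w - ev y w"
  by (simp add: linear_diff[OF bounded_linear.linear[OF J_linear]] minus_bcontfun.rep_eq)

lemma ev_scaleR: "ev (r *\<^sub>R x) w = complex_of_real r * ev x w"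
  by (simp add: linear_scale[OF bounded_linear.linear[OF J_linear]] scaleR_bcontfun.rep_eq scaleR_conv_of_real)

lemma ev_zero: "ev 0 w = 0"
  using ev_scaleR[of 0 0 w] by simp

lemma J_scaleC: "J (c *\<^sub>C x) = c *\<^sub>C J x"
  using embeds by (simp add: embeds_Cb_def bounded_clinear_def)

lemma ev_le_norm: "cmod (ev x w) \<le> norm x"
  using norm_bounded[of "J x" w] embeds by (simp add: embeds_Cb_def)

lemma norm_le: "(\<And>w. cmod (ev x w) \<le> b) \<Longrightarrow> norm x \<le> b"
  using norm_bound[of "J x" b] embeds by (simp add: embeds_Cb_def)

lemma J_inj: "J x = J y \<Longrightarrow> x = y"
proof -
  assume "J x = J y"
  then have "norm (x - y) \<le> 0" by (intro norm_le) (simp add: ev_diff)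
  then show "x = y" by simp
qed

lemma nonneg_iff: "x \<in> Cb_nonneg J \<longleftrightarrow> (\<forall>w. Im (ev x w) = 0 \<and> 0 \<le> Re (ev x w))"
  by (auto simp: Cb_nonneg_def complex_nonneg_Reals_iff)

lemma real_iff: "J x \<in> real_valued_in (range J) \<longleftrightarrow> (\<forall>w. Im (ev x w) = 0)"
  by (auto simp: real_valued_in_def complex_is_Real_iff)

lemma real_parts:
  "\<exists>a b. x = a + \<i> *\<^sub>C b \<and> J a \<in> real_valued_in (range J) \<and> J b \<in> real_valued_in (range J) \<and>
    norm a \<le> norm x \<and> norm b \<le> norm x"
proof -
  have "J x \<in> {g + \<i> *\<^sub>C h | g h. g \<in> real_valued_in (range J) \<and> h \<in> real_valued_in (range J)}"
    using lattice unfolding Cb_banach_lattice_def by blast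
  then obtain g h where gh: "J x = g + \<i> *\<^sub>C h" "g \<in> real_valued_in (range J)" "h \<in> real_valued_in (range J)"
    by blast
  then obtain a b where ab: "g = J a" "h = J b" by (auto simp: real_valued_in_def)
  have "J x = J (a + \<i> *\<^sub>C b)"
    using gh ab by (simp add: linear_add[OF bounded_linear.linear[OF J_linear]] J_scaleC)
  then have x: "x = a + \<i> *\<^sub>C b" by (rule J_inj)
  have im: "Im (ev a w) = 0" "Im (ev b w) = 0" for w using gh ab real_iff by blast+
  have ev_x: "ev x w = ev a w + \<i> * ev b w" for w
    unfolding x ev_add J_scaleC scaleC_bcontfun_apply by (simp add: scaleC_complex_def)
  have "cmod (ev a w) \<le> norm x" "cmod (ev b w) \<le> norm x" for w
  proof -
    have "cmod (ev a w) = \<bar>Re (ev x w)\<bar>" "cmod (ev b w) = \<bar>Im (ev x w)\<bar>"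
      using im[of w] by (auto simp: ev_x cmod_def)
    then show "cmod (ev a w) \<le> norm x" "cmod (ev b w) \<le> norm x"
      using abs_Re_le_cmod[of "ev x w"] abs_Im_le_cmod[of "ev x w"] ev_le_norm[of x w] by linarith+
  qed
  then show ?thesis using x gh ab norm_le by blast
qed

lemma unit_bounds:
  assumes e: "J e = const_bcontfun 1"
  shows "ev e w = 1" "norm e \<le> 1"
proof -
  show 1: "ev e w = 1" for w using e by (simp add: const_bcontfun.rep_eq)
  show "norm e \<le> 1" by (rule norm_le) (simp add: 1)
qed

text \<open>With the constant function \<open>1\<close> available, \<open>a = p - (p - a)\<close> for the constant \<open>p = norm a\<close>; in a sublattice,
  positive and negative parts are available.\<close>

lemma real_decompose:
  assumes a: "J a \<in> real_valued_in (range J)"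
  shows "\<exists>p1\<in>Cb_nonneg J. \<exists>p2\<in>Cb_nonneg J. a = p1 - p2 \<and> norm p1 \<le> 2 * norm a \<and> norm p2 \<le> 2 * norm a"
proof -
  have im: "Im (ev a w) = 0" for w using a real_iff by blast
  have re: "\<bar>Re (ev a w)\<bar> \<le> norm a" for w
    using abs_Re_le_cmod[of "ev a w"] ev_le_norm[of a w] by linarith
  show ?thesis
    using unit_or_sublattice
  proof
    assume "const_bcontfun 1 \<in> range J"
    then obtain e where e: "J e = const_bcontfun 1" by (metis imageE)
    define p1 where "p1 = norm a *\<^sub>R e"
    have n1: "norm p1 \<le> norm a" using unit_bounds(2)[OF e] by (simp add: p1_def mult_left_le)
    have "p1 \<in> Cb_nonneg J" by (simp add: nonneg_iff p1_def ev_scaleR unit_bounds(1)[OF e])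
    moreover have "p1 - a \<in> Cb_nonneg J"
      using im re by (simp add: nonneg_iff p1_def ev_diff ev_scaleR unit_bounds(1)[OF e] abs_le_iff)
    moreover have "norm (p1 - a) \<le> 2 * norm a" using n1 norm_triangle_ineq4[of p1 a] by simp
    moreover have "a = p1 - (p1 - a)" by simp
    moreover have "norm p1 \<le> 2 * norm a" using n1 norm_ge_zero[of a] by linarith
    ultimately show ?thesis by blast
  next
    assume sub: "Cb_sublattice (range J)"
    have "J 0 \<in> real_valued_in (range J)" unfolding real_iff by (simp add: ev_zero)
    with sub a obtain p q where
      p: "\<And>w. ev p w = complex_of_real (max (Re (ev a w)) (Re (ev 0 w)))" and
      q: "\<And>w. ev q w = complex_of_real (min (Re (ev a w)) (Re (ev 0 w)))"
      unfolding Cb_sublattice_def by blast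
    define p2 where "p2 = 0 - q"
    have ev2: "ev p2 w = complex_of_real (- min (Re (ev a w)) 0)" for w
      unfolding p2_def ev_diff q ev_zero by simp
    have ev1: "ev p w = complex_of_real (max (Re (ev a w)) 0)" for w by (simp add: p ev_zero)
    have "p \<in> Cb_nonneg J" "p2 \<in> Cb_nonneg J" unfolding nonneg_iff ev1 ev2 by auto
    moreover have "a = p - p2"
    proof (rule J_inj, rule bcontfun_eqI)
      fix w show "ev a w = ev (p - p2) w"
        unfolding ev_diff ev1 ev2 using im[of w] by (auto simp: complex_eq_iff max_def min_def)
    qed
    moreover have "norm p \<le> 2 * norm a"
    proof (rule norm_le)
      show "cmod (ev p w) \<le> 2 * norm a" for w
        unfolding ev1 norm_of_real using re[of w] norm_ge_zero[of a] by linarith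
    qed
    moreover have "norm p2 \<le> 2 * norm a"
    proof (rule norm_le)
      show "cmod (ev p2 w) \<le> 2 * norm a" for w
        unfolding ev2 norm_of_real using re[of w] norm_ge_zero[of a] by linarith
    qed
    ultimately show ?thesis by blast
  qed
qed

text \<open>The upper bound is the constant \<open>B\<close> or the pointwise maximum, neither of which exceeds \<open>B\<close>.\<close>

lemma common_upper_bound:
  assumes "finite S" "S \<noteq> {}" "S \<subseteq> Cb_nonneg J" "\<And>f. f \<in> S \<Longrightarrow> norm f \<le> B"
  shows "\<exists>g\<in>Cb_nonneg J. norm g \<le> B \<and> (\<forall>f\<in>S. g - f \<in> Cb_nonneg J)"
  using unit_or_sublattice
proof
  assume "const_bcontfun 1 \<in> range J"
  then obtain e where e: "J e = const_bcontfun 1" by (metis imageE)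
  have B: "B \<ge> 0" using assms(2,4) by (meson ex_in_conv norm_ge_zero order_trans)
  have "B *\<^sub>R e - f \<in> Cb_nonneg J" if f: "f \<in> S" for f
  proof -
    have "Re (ev f w) \<le> B" for w
      using complex_Re_le_cmod[of "ev f w"] ev_le_norm[of f w] assms(4)[OF f] by linarith
    moreover have "Im (ev f w) = 0" for w using f assms(3) nonneg_iff by blast
    ultimately show ?thesis by (simp add: nonneg_iff ev_diff ev_scaleR unit_bounds(1)[OF e])
  qed
  moreover have "B *\<^sub>R e \<in> Cb_nonneg J" using B by (simp add: nonneg_iff ev_scaleR unit_bounds(1)[OF e])
  moreover have "norm (B *\<^sub>R e) \<le> B" using B unit_bounds(2)[OF e] by (simp add: mult_left_le)
  ultimately show ?thesis by blast
next
  assume sub: "Cb_sublattice (range J)"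
  show ?thesis
    using assms
  proof (induction S rule: finite_ne_induct)
    case (singleton f)
    then show ?case by (intro bexI[of _ f]) (auto simp: nonneg_iff ev_zero)
  next
    case (insert f S)
    then obtain g where g: "g \<in> Cb_nonneg J" "norm g \<le> B" "\<And>f. f \<in> S \<Longrightarrow> g - f \<in> Cb_nonneg J" by auto
    have f: "f \<in> Cb_nonneg J" "norm f \<le> B" using insert.prems by auto
    have "J f \<in> real_valued_in (range J)" "J g \<in> real_valued_in (range J)"
      using f g unfolding real_iff nonneg_iff by auto
    with sub obtain m where m: "\<And>w. ev m w = complex_of_real (max (Re (ev f w)) (Re (ev g w)))"
      unfolding Cb_sublattice_def by blast
    have "m \<in> Cb_nonneg J" using f g by (auto simp: nonneg_iff m le_max_iff_disj)
    moreover have "norm m \<le> B"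
    proof (rule norm_le)
      fix w
      have "0 \<le> Re (ev f w)" "0 \<le> Re (ev g w)" using f g nonneg_iff by blast+
      moreover have "Re (ev f w) \<le> B" "Re (ev g w) \<le> B"
        using complex_Re_le_cmod[of "ev f w"] ev_le_norm[of f w] complex_Re_le_cmod[of "ev g w"] ev_le_norm[of g w] f g
        by linarith+
      ultimately show "cmod (ev m w) \<le> B" unfolding m norm_of_real by auto
    qed
    moreover have "m - f' \<in> Cb_nonneg J" if f': "f' \<in> insert f S" for f'
    proof (cases "f' = f")
      case True
      then show ?thesis using f by (auto simp: nonneg_iff ev_diff m)
    next
      case False
      then have "g - f' \<in> Cb_nonneg J" using f' g(3) by blast
      then show ?thesis using g(1) f(1) by (auto simp: nonneg_iff ev_diff m le_max_iff_disj)
    qed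
    ultimately show ?case by blast
  qed
qed

lemma nonneg_closed: "closed (Cb_nonneg J)"
  unfolding closed_sequential_limits
proof (intro allI impI, elim conjE)
  fix x l assume x: "\<forall>n. x n \<in> Cb_nonneg J" and lim: "x \<longlonglongrightarrow> l"
  have "ev l w \<in> \<real>\<^sub>\<ge>\<^sub>0" for w
  proof -
    have lim0: "(\<lambda>n. norm (x n - l)) \<longlonglongrightarrow> 0" using lim by (simp add: LIM_zero_iff tendsto_norm_zero_iff)
    have "norm (ev (x n) w - ev l w) \<le> norm (x n - l)" for n
      using ev_le_norm[of "x n - l" w] by (simp add: ev_diff)
    from Lim_null_comparison[OF always_eventually[OF allI[OF this]] lim0]
    have "(\<lambda>n. ev (x n) w - ev l w) \<longlonglongrightarrow> 0" .
    then have "(\<lambda>n. ev (x n) w) \<longlonglongrightarrow> ev l w" by (simp add: LIM_zero_iff)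
    then show ?thesis
      using closed_sequentially[OF closed_nonneg_Reals_complex, of "\<lambda>n. ev (x n) w"] x by (auto simp: Cb_nonneg_def)
  qed
  then show "l \<in> Cb_nonneg J" by (simp add: Cb_nonneg_def)
qed

lemma nonneg_norm_mono:
  assumes "x \<in> Cb_nonneg J" "y - x \<in> Cb_nonneg J"
  shows "norm x \<le> norm y"
proof (rule norm_le)
  fix w
  have "Im (ev x w) = 0" "0 \<le> Re (ev x w)" "Re (ev x w) \<le> Re (ev y w)"
    using assms by (auto simp: nonneg_iff ev_diff)
  then have "cmod (ev x w) \<le> cmod (ev y w)" using complex_Re_le_cmod[of "ev y w"] by (simp add: cmod_eq_Re)
  then show "cmod (ev x w) \<le> norm y" using ev_le_norm[of y w] by linarith
qed

end

context half_plane_resolvent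
begin

theorem growth_Cb:
  fixes J :: "'a \<Rightarrow> ('w :: topological_space \<Rightarrow>\<^sub>C complex)"
  assumes J: "embeds_Cb J" "Cb_banach_lattice (range J)"
      "const_bcontfun 1 \<in> range J \<or> Cb_sublattice (range J)"
    and pos: "\<And>t. t \<ge> 0 \<Longrightarrow> positive_operator (Cb_nonneg J) (T t)"
  shows "\<exists>C\<ge>0. \<forall>t\<ge>0. norm (T t) \<le> C * K * (t powr \<alpha> + 1)"
proof -
  interpret Cb: Cb_model J using J by unfold_locales
  define P where "P = Cb_nonneg J"
  interpret positive_half_plane T D A \<alpha> K M w P 2
  proof unfold_locales
    show "0 \<in> P" by (simp add: P_def Cb.nonneg_iff Cb.ev_zero)
    show "x + y \<in> P" if "x \<in> P" "y \<in> P" for x y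
      using that by (simp add: P_def Cb.nonneg_iff Cb.ev_add)
    show "a *\<^sub>R x \<in> P" if "x \<in> P" "0 \<le> a" for x a
      using that by (simp add: P_def Cb.nonneg_iff Cb.ev_scaleR)
    show "closed P" unfolding P_def by (rule Cb.nonneg_closed)
    show "T t x \<in> P" if "0 \<le> t" "x \<in> P" for t x
      using pos that by (simp add: P_def positive_operator_def)
    show "norm x \<le> norm y" if "x \<in> P" "y - x \<in> P" for x y
      using Cb.nonneg_norm_mono that unfolding P_def by blast
    show "\<exists>p1\<in>P. \<exists>p2\<in>P. \<exists>p3\<in>P. \<exists>p4\<in>P. x = p1 - p2 + \<i> *\<^sub>C (p3 - p4) \<and>
      norm p1 \<le> 2 * norm x \<and> norm p2 \<le> 2 * norm x \<and> norm p3 \<le> 2 * norm x \<and> norm p4 \<le> 2 * norm x" for x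
    proof -
      obtain a b where ab: "x = a + \<i> *\<^sub>C b" "J a \<in> real_valued_in (range J)" "J b \<in> real_valued_in (range J)"
        "norm a \<le> norm x" "norm b \<le> norm x" using Cb.real_parts by blast
      obtain p1 p2 where p: "p1 \<in> P" "p2 \<in> P" "a = p1 - p2" "norm p1 \<le> 2 * norm a" "norm p2 \<le> 2 * norm a"
        using Cb.real_decompose[OF ab(2)] unfolding P_def by blast
      obtain p3 p4 where q: "p3 \<in> P" "p4 \<in> P" "b = p3 - p4" "norm p3 \<le> 2 * norm b" "norm p4 \<le> 2 * norm b"
        using Cb.real_decompose[OF ab(3)] unfolding P_def by blast
      show ?thesis
        using ab p q by (intro bexI[of _ p1] bexI[of _ p2] bexI[of _ p3] bexI[of _ p4]) auto
    qed
  qed simp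
  show ?thesis
  proof (rule growth_from_upper_bounds[of 1])
    show "\<exists>g\<in>P. norm g \<le> 1 * B \<and> (\<forall>f\<in>S. g - f \<in> P)"
      if "finite S" "S \<noteq> {}" "S \<subseteq> P" "\<And>f. f \<in> S \<Longrightarrow> norm f \<le> B" for S B
      using Cb.common_upper_bound[of S B] that unfolding P_def by simp
  qed simp
qed

end

section \<open>Asymptotically analytic semigroups\<close>

text \<open>A crude form of Jordan's inequality.\<close>

lemma sin_ge_quarter:
  assumes "0 \<le> y" "y \<le> pi / 2"
  shows "y / 4 \<le> sin y"
proof (cases "y \<le> pi / 3")
  case True
  have "sin 0 - 0 / 4 \<le> sin y - y / 4"
  proof (rule DERIV_nonneg_imp_nondecreasing[OF assms(1)])
    fix x assume x: "0 \<le> x" "x \<le> y"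
    have "1 / 2 \<le> cos x" using cos_monotone_0_pi_le[of x "pi / 3"] x True by (simp add: cos_60)
    moreover have "((\<lambda>x. sin x - x / 4) has_real_derivative cos x - 1 / 4) (at x)"
      by (auto intro!: derivative_eq_intros)
    ultimately show "\<exists>d. ((\<lambda>x. sin x - x / 4) has_real_derivative d) (at x) \<and> 0 \<le> d" by (intro exI[of _ "cos x - 1 / 4"]) simp
  qed
  then show ?thesis by simp
next
  case False
  have "1 / 2 \<le> sqrt 3 / 2" by simp
  also have "\<dots> = sin (pi / 3)" by (simp add: sin_60)
  also have "\<dots> \<le> sin y" using False assms by (intro sin_monotone_2pi_le) auto
  finally show ?thesis using assms pi_less_4 by simp
qed

text \<open>The circle of radius \<open>\<rho> \<le> l\<close> around \<open>l\<close> comes closest to the origin at \<open>s = 1 / 2\<close>, and the chord from there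
  to the point with parameter \<open>s\<close> has length \<open>2 \<rho> |sin (pi (s - 1 / 2))|\<close>.\<close>

lemma circle_distance:
  assumes "0 < \<rho>" "\<rho> \<le> l" "0 \<le> s" "s \<le> 1"
  shows "\<rho>\<^sup>2 * (s - 1 / 2)\<^sup>2 \<le> (cmod (circlepath (complex_of_real l) \<rho> s))\<^sup>2"
proof -
  define u where "u = s - 1 / 2"
  have "exp (2 * complex_of_real pi * \<i> * complex_of_real s) = - cis (2 * pi * u)"
  proof -
    have "2 * complex_of_real pi * \<i> * complex_of_real s = \<i> * complex_of_real (2 * pi * u) + \<i> * complex_of_real pi"
      by (simp add: u_def algebra_simps)
    then show ?thesis by (simp add: exp_add cis_conv_exp)
  qed
  then have \<gamma>: "circlepath (complex_of_real l) \<rho> s = Complex (l - \<rho> * cos (2 * pi * u)) (- (\<rho> * sin (2 * pi * u)))"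
    by (simp add: circlepath complex_eq_iff)
  have "\<bar>sin (pi * u)\<bar> = sin (pi * \<bar>u\<bar>)"
  proof -
    have "0 \<le> sin (pi * \<bar>u\<bar>)" using assms by (intro sin_ge_zero) (auto simp: u_def abs_if field_simps)
    then show ?thesis by (cases "u \<ge> 0") (auto simp: abs_if)
  qed
  moreover have "pi * \<bar>u\<bar> / 4 \<le> sin (pi * \<bar>u\<bar>)"
    using assms by (intro sin_ge_quarter) (auto simp: u_def abs_if field_simps)
  moreover have "2 * \<bar>u\<bar> \<le> pi * \<bar>u\<bar>" using pi_ge_two by (intro mult_right_mono) auto
  ultimately have "\<bar>u\<bar> / 2 \<le> \<bar>sin (pi * u)\<bar>" by linarith
  then have "(\<bar>u\<bar> / 2)\<^sup>2 \<le> \<bar>sin (pi * u)\<bar>\<^sup>2" by (intro power_mono) auto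
  then have s2: "u\<^sup>2 \<le> 4 * (sin (pi * u))\<^sup>2" by (simp add: power_divide)
  have cos: "cos (2 * pi * u) = 1 - 2 * (sin (pi * u))\<^sup>2"
    using cos_double_sin[of "pi * u"] by (simp add: mult.assoc)
  have "\<rho>\<^sup>2 * u\<^sup>2 \<le> \<rho>\<^sup>2 * (4 * (sin (pi * u))\<^sup>2)" by (intro mult_left_mono s2) auto
  also have "\<dots> = 2 * \<rho>\<^sup>2 * (1 - cos (2 * pi * u))" by (simp add: cos)
  also have "\<dots> = (\<rho> - \<rho> * cos (2 * pi * u))\<^sup>2 + (\<rho> * sin (2 * pi * u))\<^sup>2"
  proof -
    have "(\<rho> - \<rho> * c)\<^sup>2 + (\<rho> * d)\<^sup>2 = 2 * \<rho>\<^sup>2 * (1 - c)" if "c\<^sup>2 + d\<^sup>2 = 1" for c d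
      using that by algebra
    then show ?thesis by simp
  qed
  also have "\<dots> \<le> (l - \<rho> * cos (2 * pi * u))\<^sup>2 + (\<rho> * sin (2 * pi * u))\<^sup>2"
  proof (intro add_right_mono power_mono)
    have "\<rho> * cos (2 * pi * u) \<le> \<rho> * 1" using assms by (intro mult_left_mono) auto
    then show "0 \<le> \<rho> - \<rho> * cos (2 * pi * u)" by simp
  qed (use assms in simp)
  also have "\<dots> = (cmod (circlepath (complex_of_real l) \<rho> s))\<^sup>2" by (simp add: \<gamma> cmod_power2)
  finally show ?thesis by (simp add: u_def)
qed

text \<open>Cauchy's formula on the circle around \<open>l\<close> touching the line \<open>Re z = a\<close>.  The decay \<open>1 / (1 + |z|\<^sup>2)\<close> is
  integrable along the circle, uniformly in its radius, which gains one power of \<open>l - a\<close> over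
  Cauchy's estimate with the supremum.\<close>

lemma circle_average_bound:
  fixes g :: "complex \<Rightarrow> complex"
  assumes hol: "g holomorphic_on {z. Re z > 0}" and a: "0 < a" "a < l" and B: "0 \<le> B"
    and bound: "\<And>z. Re z \<ge> a \<Longrightarrow> cmod (g z) \<le> B / (1 + (cmod z)\<^sup>2)"
  shows "cmod ((deriv ^^ k) g (of_real l)) \<le> fact k * (4 * B / (l - a) ^ Suc k)"
proof -
  define \<rho> where "\<rho> = l - a"
  have \<rho>: "\<rho> > 0" using a by (simp add: \<rho>_def)
  let ?l = "complex_of_real l"
  let ?\<gamma> = "circlepath ?l \<rho>"
  have re: "Re z \<ge> a" if "cmod (?l - z) \<le> \<rho>" for z
    using that abs_Re_le_cmod[of "?l - z"] by (simp add: \<rho>_def)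
  have sub: "cball ?l \<rho> \<subseteq> {z. Re z > 0}" using re a by (force simp: dist_norm)
  define I where "I = (2 * pi * \<i>) / (fact k) * (deriv ^^ k) g ?l"
  have "((\<lambda>u. g u / (u - ?l) ^ Suc k) has_contour_integral I) ?\<gamma>"
    unfolding I_def
  proof (rule Cauchy_has_contour_integral_higher_derivative_circlepath)
    show "continuous_on (cball ?l \<rho>) g"
      by (rule continuous_on_subset[OF holomorphic_on_imp_continuous_on[OF hol] sub])
    show "g holomorphic_on ball ?l \<rho>"
      by (rule holomorphic_on_subset[OF hol]) (use sub ball_subset_cball in blast)
  qed (use \<rho> in simp)
  then have int: "((\<lambda>s. g (?\<gamma> s) / (?\<gamma> s - ?l) ^ Suc k * vector_derivative ?\<gamma> (at s within {0..1})) has_integral I) {0..1}"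
    by (simp add: has_contour_integral_def)
  \<comment> \<open>An integrable majorant of the integrand in Cauchy's formula, and its primitive \<open>c\<close>.\<close>
  define b where "b s = 2 * pi * B / \<rho> ^ k * (1 / (1 + (\<rho> * (s - 1 / 2))\<^sup>2))" for s
  define c where "c s = 2 * pi * B / \<rho> ^ k * (arctan (\<rho> * (s - 1 / 2)) / \<rho>)" for s
  have b_int: "(b has_integral (c 1 - c 0)) {0..1}"
  proof (rule fundamental_theorem_of_calculus)
    fix s :: real
    have "((\<lambda>s. arctan (\<rho> * (s - 1 / 2)) / \<rho>) has_real_derivative (1 / (1 + (\<rho> * (s - 1 / 2))\<^sup>2))) (at s)"
      using \<rho> by (auto intro!: derivative_eq_intros simp: inverse_eq_divide)
    from DERIV_cmult[OF this, of "2 * pi * B / \<rho> ^ k"]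
    have "(c has_real_derivative b s) (at s)" by (simp add: c_def[abs_def] b_def)
    then show "(c has_vector_derivative b s) (at s within {0..1})"
      by (simp add: has_real_derivative_iff_has_vector_derivative has_vector_derivative_at_within)
  qed simp
  have "norm I \<le> c 1 - c 0"
  proof -
    have "norm (integral {0..1} (\<lambda>s. g (?\<gamma> s) / (?\<gamma> s - ?l) ^ Suc k * vector_derivative ?\<gamma> (at s within {0..1}))) \<le> integral {0..1} b"
    proof (rule integral_norm_bound_integral)
      fix s :: real assume s: "s \<in> {0..1}"
      have diff: "cmod (?\<gamma> s - ?l) = \<rho>" using \<rho> by (simp add: circlepath norm_mult)
      have vd: "cmod (vector_derivative ?\<gamma> (at s within {0..1})) = 2 * pi * \<rho>"
        using s \<rho> by (simp add: vector_derivative_circlepath01 norm_mult)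
      have "cmod (g (?\<gamma> s)) \<le> B / (1 + (cmod (?\<gamma> s))\<^sup>2)"
        using diff by (intro bound re) (simp add: norm_minus_commute)
      also have "\<dots> \<le> B / (1 + (\<rho> * (s - 1 / 2))\<^sup>2)"
        using circle_distance[OF \<rho>, of l s] s a B
        by (intro divide_left_mono mult_pos_pos) (auto simp: \<rho>_def power_mult_distrib add_pos_nonneg)
      finally have gb: "cmod (g (?\<gamma> s)) \<le> B / (1 + (\<rho> * (s - 1 / 2))\<^sup>2)" .
      have "norm (g (?\<gamma> s) / (?\<gamma> s - ?l) ^ Suc k * vector_derivative ?\<gamma> (at s within {0..1}))
          = cmod (g (?\<gamma> s)) / \<rho> ^ Suc k * (2 * pi * \<rho>)"
        by (simp only: norm_mult norm_divide norm_power diff vd)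
      also have "\<dots> \<le> B / (1 + (\<rho> * (s - 1 / 2))\<^sup>2) / \<rho> ^ Suc k * (2 * pi * \<rho>)"
        using gb \<rho> by (intro mult_right_mono divide_right_mono) auto
      also have "\<dots> = b s"
      proof -
        have "X / \<rho> ^ Suc k * (2 * pi * \<rho>) = X * (2 * pi) / \<rho> ^ k" for X using \<rho> by simp
        moreover have "X * (2 * pi) / Y = 2 * pi * B / Y * (1 / Z)" if "X = B / Z" for X Y Z :: real
          using that by (simp add: mult_ac)
        ultimately show ?thesis unfolding b_def by metis
      qed
      finally show "norm (g (?\<gamma> s) / (?\<gamma> s - ?l) ^ Suc k * vector_derivative ?\<gamma> (at s within {0..1})) \<le> b s" .
    qed (use int b_int in \<open>auto simp: has_integral_integrable\<close>)
    then show ?thesis using integral_unique[OF int] integral_unique[OF b_int] by simp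
  qed
  also have "c 1 - c 0 = 2 * pi * B / \<rho> ^ Suc k * (2 * arctan (\<rho> / 2))"
    by (simp add: c_def arctan_minus field_simps)
  also have "\<dots> \<le> 2 * pi * B / \<rho> ^ Suc k * 4"
    using B \<rho> arctan_ubound[of "\<rho> / 2"] pi_less_4 by (intro mult_left_mono) auto
  finally have "2 * pi / fact k * cmod ((deriv ^^ k) g ?l) \<le> 2 * pi / fact k * (fact k * (4 * B / \<rho> ^ Suc k))"
    by (simp add: I_def norm_mult norm_divide)
  then have "cmod ((deriv ^^ k) g ?l) \<le> fact k * (4 * B / \<rho> ^ Suc k)"
    by (rule mult_left_le_imp_le) simp
  then show ?thesis by (simp add: \<rho>_def)
qed

definition laplace :: "(real \<Rightarrow> complex) \<Rightarrow> complex \<Rightarrow> complex" where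
  "laplace f z = (LINT t:{0<..}|lborel. exp (- z * of_real t) * f t)"

lemma gamma_density:
  fixes c :: real
  assumes c: "c > 0"
  shows "has_bochner_integral lborel (\<lambda>t. indicator {0<..} t * (t ^ n / fact n * exp (- c * t))) (1 / c ^ Suc n)"
proof -
  have "has_bochner_integral lborel (erlang_density n c) 1"
  proof (rule has_bochner_integral_nn_integral)
    show "AE x in lborel. 0 \<le> erlang_density n c x" using c by (simp add: erlang_density_nonneg)
    show "(\<integral>\<^sup>+ x. ennreal (erlang_density n c x) \<partial>lborel) = ennreal 1"
      using nn_integral_erlang_ith_moment[OF c, of n 0] by simp
  qed simp_all
  then have "has_bochner_integral lborel (\<lambda>t. erlang_density n c t * (1 / c ^ Suc n)) (1 * (1 / c ^ Suc n))"
    by (rule has_bochner_integral_mult_left)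
  moreover have "AE t in lborel. erlang_density n c t * (1 / c ^ Suc n) = indicator {0<..} t * (t ^ n / fact n * exp (- c * t))"
  proof -
    have "AE t in lborel. t \<noteq> (0 :: real)" by (rule AE_lborel_singleton)
    then show ?thesis
      by eventually_elim (use c in \<open>auto simp: erlang_density_def indicator_def\<close>)
  qed
  ultimately show ?thesis
    by (subst (asm) has_bochner_integral_cong_AE) auto
qed

context
  fixes f :: "real \<Rightarrow> complex" and C \<beta> :: real
  assumes meas: "set_borel_measurable lborel {0<..} f"
    and f_bound: "\<And>t. t > 0 \<Longrightarrow> cmod (f t) \<le> C * exp (\<beta> * t)" and C: "0 \<le> C"
begin

definition zero_ext :: "real \<Rightarrow> complex" where "zero_ext t = indicator {0<..} t *\<^sub>R f t"

lemma zero_ext_measurable [measurable]: "zero_ext \<in> borel_measurable lborel"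
  using meas by (simp add: set_borel_measurable_def zero_ext_def[abs_def])

lemma laplace_eq: "laplace f z = (\<integral>t. exp (- z * of_real t) * zero_ext t \<partial>lborel)"
  by (simp add: laplace_def set_lebesgue_integral_def zero_ext_def)

definition laplace_coeff :: "complex \<Rightarrow> nat \<Rightarrow> complex" where
  "laplace_coeff \<mu> n = (\<integral>t. (- of_real t) ^ n / fact n * (exp (- \<mu> * of_real t) * zero_ext t) \<partial>lborel)"

lemma laplace_term:
  fixes \<mu> :: complex and n :: nat
  assumes \<mu>: "Re \<mu> > \<beta>"
  defines "G \<equiv> \<lambda>t :: real. (- complex_of_real t) ^ n / fact n * (exp (- \<mu> * of_real t) * zero_ext t)"
  shows "integrable lborel G" "(\<integral>t. norm (G t) \<partial>lborel) \<le> C / (Re \<mu> - \<beta>) ^ Suc n"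
proof -
  define c where "c = Re \<mu> - \<beta>"
  have c: "c > 0" using \<mu> by (simp add: c_def)
  define e where "e t = C * (indicator {0<..} t * (t ^ n / fact n * exp (- c * t)))" for t
  have G_le: "norm (G t) \<le> e t" for t
  proof (cases "t > 0")
    case True
    have "norm (G t) = t ^ n / fact n * (exp (- Re \<mu> * t) * cmod (f t))"
      using True by (simp add: G_def zero_ext_def norm_mult norm_divide norm_power)
    also have "\<dots> \<le> t ^ n / fact n * (exp (- Re \<mu> * t) * (C * exp (\<beta> * t)))"
      using True by (intro mult_left_mono f_bound) auto
    also have "\<dots> = C * (t ^ n / fact n * (exp (- Re \<mu> * t) * exp (\<beta> * t)))" by simp
    also have "exp (- Re \<mu> * t) * exp (\<beta> * t) = exp (- c * t)" unfolding mult_exp_exp by (simp add: c_def algebra_simps)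
    finally show ?thesis using True by (simp add: e_def)
  qed (simp add: G_def zero_ext_def e_def)
  have "has_bochner_integral lborel e (C * (1 / c ^ Suc n))"
    unfolding e_def by (rule has_bochner_integral_mult_right) (rule gamma_density[OF c])
  then have e: "integrable lborel e" "(\<integral>t. e t \<partial>lborel) = C * (1 / c ^ Suc n)"
    by (auto simp only: has_bochner_integral_iff)
  have "G \<in> borel_measurable lborel" unfolding G_def by measurable
  moreover have "norm (G t) \<le> norm (e t)" for t using order_trans[OF G_le abs_ge_self] by simp
  then have "AE t in lborel. norm (G t) \<le> norm (e t)" by simp
  ultimately show int: "integrable lborel G" by (rule Bochner_Integration.integrable_bound[OF e(1)])
  have "(\<integral>t. norm (G t) \<partial>lborel) \<le> (\<integral>t. e t \<partial>lborel)"
    by (rule integral_mono) (use e int G_le in auto)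
  then show "(\<integral>t. norm (G t) \<partial>lborel) \<le> C / (Re \<mu> - \<beta>) ^ Suc n" unfolding e(2) by (simp add: c_def)
qed

lemma laplace_coeff_bound:
  assumes "Re \<mu> > \<beta>"
  shows "cmod (laplace_coeff \<mu> n) \<le> C / (Re \<mu> - \<beta>) ^ Suc n"
  using integral_norm_bound laplace_term(2)[OF assms, of n] unfolding laplace_coeff_def
  by (rule order_trans)

lemma laplace_integrable:
  assumes "Re z > \<beta>"
  shows "set_integrable lborel {0<..} (\<lambda>t. exp (- z * of_real t) * f t)"
  using laplace_term(1)[OF assms, of 0] by (simp add: set_integrable_def zero_ext_def)

text \<open>Expand \<open>exp (- (z - \<mu>) t)\<close> and integrate termwise; the moments are those of the Gamma densities.\<close>

lemma laplace_sums:
  assumes \<mu>: "Re \<mu> > \<beta>" and z: "z \<in> ball \<mu> (Re \<mu> - \<beta>)"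
  shows "(\<lambda>n. laplace_coeff \<mu> n * (z - \<mu>) ^ n) sums laplace f z"
proof -
  define c where "c = Re \<mu> - \<beta>"
  have c: "c > 0" and zc: "cmod (z - \<mu>) < c" using \<mu> z by (auto simp: c_def dist_norm norm_minus_commute)
  define G where "G n t = (- complex_of_real t) ^ n / fact n * (exp (- \<mu> * of_real t) * zero_ext t)" for n t
  have G: "integrable lborel (G n)" "(\<integral>t. norm (G n t) \<partial>lborel) \<le> C / c ^ Suc n" for n
    using laplace_term[OF \<mu>, of n] by (simp_all add: G_def[abs_def] c_def)
  have power_split: "(x * y) ^ n /\<^sub>R fact n * u = (x ^ n / fact n * u) * y ^ n" for x y u :: complex and n
    by (simp add: power_mult_distrib scaleR_conv_of_real divide_inverse mult_ac)
  have G_eq: "(- of_real t * (z - \<mu>)) ^ n /\<^sub>R fact n * (exp (- \<mu> * of_real t) * zero_ext t) = G n t * (z - \<mu>) ^ n" for n t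
    unfolding G_def power_split ..
  have pointwise: "(\<lambda>n. G n t * (z - \<mu>) ^ n) sums (exp (- z * of_real t) * zero_ext t)" for t
  proof -
    have "(\<lambda>n. (- of_real t * (z - \<mu>)) ^ n /\<^sub>R fact n * (exp (- \<mu> * of_real t) * zero_ext t))
      sums (exp (- of_real t * (z - \<mu>)) * (exp (- \<mu> * of_real t) * zero_ext t))"
      by (intro sums_mult2 exp_converges)
    moreover have "exp (- of_real t * (z - \<mu>)) * (exp (- \<mu> * of_real t) * zero_ext t) = exp (- z * of_real t) * zero_ext t"
      unfolding mult.assoc[symmetric] mult_exp_exp by (simp add: algebra_simps)
    ultimately show ?thesis unfolding G_eq by (simp only:)
  qed
  have norm_sum: "summable (\<lambda>n. norm (G n t * (z - \<mu>) ^ n))" for t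
    unfolding G_eq[symmetric] norm_mult[of "_ /\<^sub>R _"] by (intro summable_mult2 summable_norm_exp)
  have int_norm: "(\<integral>t. norm (G n t * (z - \<mu>) ^ n) \<partial>lborel) = (\<integral>t. norm (G n t) \<partial>lborel) * cmod (z - \<mu>) ^ n" for n
    by (simp add: norm_mult norm_power)
  have int_sum: "summable (\<lambda>n. \<integral>t. norm (G n t * (z - \<mu>) ^ n) \<partial>lborel)"
  proof (rule summable_comparison_test')
    have "summable (\<lambda>n. (cmod (z - \<mu>) / c) ^ n)" using c zc by (intro summable_geometric) simp
    then show "summable (\<lambda>n. C / c * (cmod (z - \<mu>) / c) ^ n)" by (rule summable_mult)
    fix n :: nat
    have "(\<integral>t. norm (G n t * (z - \<mu>) ^ n) \<partial>lborel) \<le> C / c ^ Suc n * cmod (z - \<mu>) ^ n"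
      unfolding int_norm by (intro mult_right_mono G(2)) auto
    also have "\<dots> = C / c * (cmod (z - \<mu>) / c) ^ n" by (simp add: power_divide)
    finally show "norm (\<integral>t. norm (G n t * (z - \<mu>) ^ n) \<partial>lborel) \<le> C / c * (cmod (z - \<mu>) / c) ^ n" by simp
  qed
  have "(\<lambda>n. \<integral>t. G n t * (z - \<mu>) ^ n \<partial>lborel) sums (\<integral>t. (\<Sum>n. G n t * (z - \<mu>) ^ n) \<partial>lborel)"
    using G(1) norm_sum int_sum by (intro sums_integral) auto
  moreover have "(\<Sum>n. G n t * (z - \<mu>) ^ n) = exp (- z * of_real t) * zero_ext t" for t
    using sums_unique[OF pointwise[of t]] ..
  moreover have "(\<integral>t. G n t * (z - \<mu>) ^ n \<partial>lborel) = laplace_coeff \<mu> n * (z - \<mu>) ^ n" for n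
    unfolding laplace_coeff_def G_def[symmetric] by (rule integral_mult_left_zero)
  ultimately show ?thesis by (simp only: laplace_eq)
qed

lemma laplace_holomorphic: "laplace f holomorphic_on {z. Re z > \<beta>}"
proof -
  have "laplace f analytic_on {\<mu>}" if \<mu>: "Re \<mu> > \<beta>" for \<mu>
  proof -
    have "laplace f holomorphic_on ball \<mu> (Re \<mu> - \<beta>)"
      by (rule power_series_holomorphic) (rule laplace_sums[OF \<mu>])
    then show ?thesis using \<mu> by (auto simp: analytic_on_def intro!: exI[of _ "Re \<mu> - \<beta>"])
  qed
  then have "laplace f analytic_on {z. Re z > \<beta>}" by (subst analytic_on_analytic_at) auto
  then show ?thesis by (rule analytic_imp_holomorphic)
qed

lemma laplace_deriv_bound:
  assumes \<mu>: "Re \<mu> > \<beta>"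
  shows "cmod ((deriv ^^ n) (laplace f) \<mu>) \<le> fact n * (C / (Re \<mu> - \<beta>) ^ Suc n)"
proof -
  have "(deriv ^^ n) (laplace f) \<mu> = fact n * laplace_coeff \<mu> n"
    by (rule taylor_coefficient[of "Re \<mu> - \<beta>"]) (use \<mu> laplace_sums in auto)
  then have "cmod ((deriv ^^ n) (laplace f) \<mu>) = fact n * cmod (laplace_coeff \<mu> n)" by (simp add: norm_mult)
  also have "\<dots> \<le> fact n * (C / (Re \<mu> - \<beta>) ^ Suc n)"
    by (intro mult_left_mono laplace_coeff_bound \<mu>) simp
  finally show ?thesis .
qed

end

text \<open>A sector given by the slope instead of the angle, which makes it an intersection of two half-planes.\<close>

definition wedge :: "real \<Rightarrow> complex set" where "wedge m = {z. \<bar>Im z\<bar> < m * Re z}"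

lemma wedge_eq: "wedge m = {z. Im z < m * Re z} \<inter> {z. - (m * Re z) < Im z}"
  by (auto simp: wedge_def abs_less_iff)

lemma open_wedge: "open (wedge m)"
  unfolding wedge_eq by (intro open_Int open_Collect_less continuous_intros)

lemma convex_wedge: "convex (wedge m)"
proof -
  have "wedge m = {z. (Complex (- m) 1) \<bullet> z < 0} \<inter> {z. (Complex (- m) (-1)) \<bullet> z < 0}"
    unfolding wedge_eq by (auto simp: inner_complex_def)
  then show ?thesis by (simp add: convex_Int convex_halfspace_lt)
qed

lemma wedge_Re_pos: "z \<in> wedge m \<Longrightarrow> 0 < m \<Longrightarrow> 0 < Re z"
  unfolding wedge_def by (smt (verit) mem_Collect_eq mult_nonneg_nonpos2 mult_pos_neg mult_eq_0_iff)

lemma wedge_ray: "t > 0 \<Longrightarrow> \<bar>q\<bar> < m \<Longrightarrow> of_real t * (1 + \<i> * of_real q) \<in> wedge m"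
  by (simp add: wedge_def abs_mult mult.commute)

lemma wedge_ray_continuous:
  assumes "s holomorphic_on wedge m" "\<bar>q\<bar> < m"
  shows "continuous_on {0<..} (\<lambda>t. s (of_real t * (1 + \<i> * of_real q)))"
  by (rule continuous_on_compose2[OF holomorphic_on_imp_continuous_on[OF assms(1)]])
    (use wedge_ray assms(2) in \<open>auto intro!: continuous_intros\<close>)

lemma continuous_imp_measurable_pos:
  fixes f :: "real \<Rightarrow> complex"
  shows "continuous_on {0<..} f \<Longrightarrow> set_borel_measurable lborel {0<..} f"
  using borel_measurable_continuous_on_indicator[of "{0<..}" f] by (simp add: set_borel_measurable_def)

lemma wedge_subset_sector:
  assumes "0 < m" "m \<le> \<theta>"
  shows "wedge m \<subseteq> sector \<theta>"
proof
  fix z assume z: "z \<in> wedge m"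
  have re: "0 < Re z" by (rule wedge_Re_pos[OF z assms(1)])
  have "\<bar>Im z\<bar> / Re z < m" using z re by (simp add: wedge_def field_simps)
  then have "\<bar>Im z / Re z\<bar> < m" using re by simp
  then have "\<bar>arctan (Im z / Re z)\<bar> < m" using abs_arctan_le[of "Im z / Re z"] by linarith
  then show "z \<in> sector \<theta>" using re assms by (auto simp: sector_def arg_conv_arctan)
qed

lemma linear_exp_tendsto_0: "c > 0 \<Longrightarrow> ((\<lambda>t. t * exp (- c * t)) \<longlongrightarrow> (0 :: real)) at_top"
  by real_asymp

text \<open>By Cauchy's theorem the integral of \<open>exp (- l z) s z\<close> along the positive axis may be rotated to the ray
  through \<open>1 + i q\<close>.  In terms of a primitive \<open>Q\<close> on the wedge, the difference of both integrals up to \<open>t\<close> is the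
  increment of \<open>Q\<close> over a vertical segment, which tends to zero at both ends.\<close>

lemma laplace_rotate:
  fixes s :: "complex \<Rightarrow> complex" and m c b q l :: real
  assumes m: "0 < m" and hol: "s holomorphic_on wedge m"
    and bound: "\<And>z. z \<in> wedge m \<Longrightarrow> cmod (s z) \<le> c * exp (b * Re z)" and c: "c \<ge> 0"
    and q: "\<bar>q\<bar> < m" and l: "l > b"
  shows "laplace (\<lambda>t. s (of_real t)) (of_real l)
    = (1 + \<i> * of_real q) * laplace (\<lambda>t. s (of_real t * (1 + \<i> * of_real q))) ((1 + \<i> * of_real q) * of_real l)"
proof -
  let ?e = "1 + \<i> * complex_of_real q"
  have ray: "of_real t * (1 + \<i> * of_real q') \<in> wedge m" if "t > 0" "\<bar>q'\<bar> < m" for t q' by (rule wedge_ray[OF that])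
  have ray0: "complex_of_real t \<in> wedge m" if "t > 0" for t using ray[of t 0] that m by simp
  define g where "g z = exp (- of_real l * z) * s z" for z
  have g_hol: "g holomorphic_on wedge m" unfolding g_def by (intro holomorphic_intros hol)
  obtain Q where Q: "\<And>z. z \<in> wedge m \<Longrightarrow> (Q has_field_derivative g z) (at z within wedge m)"
    using holomorphic_convex_primitive'[OF convex_wedge open_wedge g_hol] by blast
  have Q': "(Q has_field_derivative g z) (at z)" if "z \<in> wedge m" for z
    using Q[OF that] at_within_open[OF that open_wedge] by simp
  have g_bound: "cmod (g z) \<le> c * exp (- (l - b) * Re z)" if "z \<in> wedge m" for z
  proof -
    have "cmod (g z) \<le> exp (- l * Re z) * (c * exp (b * Re z))"
      unfolding g_def norm_mult using bound[OF that] by (intro mult_mono) auto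
    also have "\<dots> = c * (exp (- l * Re z) * exp (b * Re z))" by simp
    also have "exp (- l * Re z) * exp (b * Re z) = exp (- (l - b) * Re z)"
      unfolding mult_exp_exp by (simp add: algebra_simps)
    finally show ?thesis .
  qed
  \<comment> \<open>Both rays are compared along vertical segments, whose length grows linearly while \<open>g\<close> decays
    exponentially.\<close>
  define d where "d t = Q (of_real t * ?e) - Q (of_real t)" for t
  have d_bound: "norm (d t) \<le> \<bar>q\<bar> * c * (t * exp (- (l - b) * t))" if t: "t > 0" for t
  proof -
    let ?S = "closed_segment (complex_of_real t) (of_real t * ?e)"
    have sub: "?S \<subseteq> wedge m"
      by (rule closed_segment_subset[OF ray0[OF t] ray[OF t q] convex_wedge])
    have re: "Re z = t" if z: "z \<in> ?S" for z
    proof -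
      obtain u where "z = (1 - u) *\<^sub>R complex_of_real t + u *\<^sub>R (of_real t * ?e)"
        using z by (auto simp: in_segment)
      then show ?thesis by (simp add: algebra_simps)
    qed
    have "norm (Q (of_real t * ?e) - Q (of_real t)) \<le> (c * exp (- (l - b) * t)) * norm (of_real t * ?e - of_real t)"
    proof (rule field_differentiable_bound[where S = ?S])
      show "(Q has_field_derivative g z) (at z within ?S)" if "z \<in> ?S" for z
        using Q' sub that by (blast intro: has_field_derivative_at_within)
      show "norm (g z) \<le> c * exp (- (l - b) * t)" if "z \<in> ?S" for z
        using g_bound[of z] re[OF that] sub that by auto
    qed auto
    also have "norm (of_real t * ?e - of_real t) = t * \<bar>q\<bar>"
      using t by (simp add: algebra_simps norm_mult)
    finally show ?thesis by (simp add: d_def mult_ac)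
  qed
  define f where "f t = ?e * g (of_real t * ?e) - g (of_real t)" for t
  have d': "(d has_vector_derivative f t) (at t)" if t: "t > 0" for t
  proof -
    have D: "((\<lambda>z. Q (z * ?e) - Q z) has_field_derivative g (of_real t * ?e) * ?e - g (of_real t)) (at (of_real t))"
    proof (intro DERIV_diff Q' ray0 t)
      have "((\<lambda>z. z * ?e) has_field_derivative ?e) (at (of_real t))" by (auto intro!: derivative_eq_intros)
      then show "((\<lambda>z. Q (z * ?e)) has_field_derivative g (of_real t * ?e) * ?e) (at (of_real t))"
        by (rule DERIV_chain2[where f = Q and g = "\<lambda>z. z * ?e" and x = "of_real t", OF Q'[OF ray[OF t q]]])
    qed
    from has_vector_derivative_real_field[OF D]
    show ?thesis by (simp add: d_def[abs_def] f_def mult.commute)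
  qed
  have sq_meas: "set_borel_measurable lborel {0<..} (\<lambda>t. s (of_real t * (1 + \<i> * of_real q')))" if "\<bar>q'\<bar> < m" for q'
    by (rule continuous_imp_measurable_pos[OF wedge_ray_continuous[OF hol that]])
  have sq_bound: "cmod (s (of_real t * (1 + \<i> * of_real q'))) \<le> c * exp (b * t)" if "t > 0" "\<bar>q'\<bar> < m" for t q'
    using bound[OF ray[OF that]] by simp
  have int_q: "set_integrable lborel {0<..} (\<lambda>t. exp (- ((1 + \<i> * of_real q') * of_real l) * of_real t) * s (of_real t * (1 + \<i> * of_real q')))"
    if "\<bar>q'\<bar> < m" for q'
    by (rule laplace_integrable[OF sq_meas[OF that] _ c]) (use sq_bound that l in auto)
  have g_q: "exp (- ((1 + \<i> * of_real q') * of_real l) * of_real t) * s (of_real t * (1 + \<i> * of_real q')) = g (of_real t * (1 + \<i> * of_real q'))" for t q'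
    by (simp add: g_def mult_ac)
  have int_e: "set_integrable lborel {0<..} (\<lambda>t. g (of_real t * ?e))" using int_q[OF q] unfolding g_q .
  have int_1: "set_integrable lborel {0<..} (\<lambda>t. g (of_real t))" using int_q[of 0] m unfolding g_q by simp
  have int_f: "set_integrable lborel {0<..} f"
    unfolding f_def by (intro set_integral_diff(1) set_integrable_mult_right int_e int_1)
  have g_cont: "continuous_on (wedge m) g" by (rule holomorphic_on_imp_continuous_on[OF g_hol])
  have "(LBINT t=ereal 0..\<infinity>. f t) = 0 - 0"
  proof (rule interval_integral_FTC_integrable[where F = d])
    show "(d has_vector_derivative f t) (at t)" if "ereal 0 < ereal t" for t using d' that by simp
    have "continuous_on {0<..} (\<lambda>t. g (of_real t * ?e))"
      by (rule continuous_on_compose2[OF g_cont]) (use ray q in \<open>auto intro!: continuous_intros\<close>)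
    moreover have "continuous_on {0<..} (\<lambda>t. g (of_real t))"
      by (rule continuous_on_compose2[OF g_cont]) (use ray0 in \<open>auto intro!: continuous_intros\<close>)
    ultimately have "continuous_on {0<..} f"
      unfolding f_def by (intro continuous_on_diff continuous_on_mult_left)
    then show "isCont f t" if "ereal 0 < ereal t" for t
      using that continuous_on_eq_continuous_at[OF open_greaterThan] by auto
    have "einterval (ereal 0) \<infinity> = {0<..}" by (auto simp: einterval_def)
    then show "set_integrable lborel (einterval (ereal 0) \<infinity>) f" using int_f by simp
    have "((\<lambda>t. \<bar>q\<bar> * c * (t * exp (- (l - b) * t))) \<longlongrightarrow> \<bar>q\<bar> * c * (0 * exp (- (l - b) * 0))) (at_right 0)"
      by (intro tendsto_intros)
    then have "((\<lambda>t. \<bar>q\<bar> * c * (t * exp (- (l - b) * t))) \<longlongrightarrow> 0) (at_right 0)" by simp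
    then have "(d \<longlongrightarrow> 0) (at_right 0)"
      by (rule Lim_null_comparison[rotated]) (use d_bound in \<open>auto intro: eventually_at_rightI[of 0 1]\<close>)
    then show "((d \<circ> real_of_ereal) \<longlongrightarrow> 0) (at_right (ereal 0))" by (simp add: ereal_tendsto_simps)
    have "((\<lambda>t. \<bar>q\<bar> * c * (t * exp (- (l - b) * t))) \<longlongrightarrow> \<bar>q\<bar> * c * 0) at_top"
      by (rule tendsto_mult[OF tendsto_const linear_exp_tendsto_0]) (use l in simp)
    then have "((\<lambda>t. \<bar>q\<bar> * c * (t * exp (- (l - b) * t))) \<longlongrightarrow> 0) at_top" by simp
    then have "(d \<longlongrightarrow> 0) at_top"
      by (rule Lim_null_comparison[rotated]) (use d_bound in \<open>auto intro: eventually_at_top_linorderI[of 1]\<close>)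
    then show "((d \<circ> real_of_ereal) \<longlongrightarrow> 0) (at_left \<infinity>)" by (simp add: ereal_tendsto_simps)
  qed simp
  then have "(LINT t:{0<..}|lborel. f t) = 0" by (simp add: interval_integral_to_infinity_eq)
  moreover have "(LINT t:{0<..}|lborel. f t) = ?e * (LINT t:{0<..}|lborel. g (of_real t * ?e)) - (LINT t:{0<..}|lborel. g (of_real t))"
    unfolding f_def by (subst set_integral_diff(2)) (auto intro: int_e int_1)
  ultimately have "(LINT t:{0<..}|lborel. g (of_real t)) = ?e * (LINT t:{0<..}|lborel. g (of_real t * ?e))" by simp
  then show ?thesis unfolding laplace_def g_q using g_q[of 0] by (simp add: g_def)
qed

context half_plane_resolvent
begin

text \<open>The derivative of \<open>exp (- l t) T t (R l x)\<close> is integrated over the half-line after applying \<open>\<phi>\<close>.\<close>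

lemma laplace_orbit:
  assumes \<phi>: "bounded_clinear \<phi>" "\<And>x. cmod (\<phi> x) \<le> norm x" and l: "l > w"
  shows "laplace (\<lambda>t. \<phi> (T t x)) (of_real l) = \<phi> (R (of_real l) x)"
    "set_integrable lborel {0<..} (\<lambda>t. exp (- of_real l * of_real t) * \<phi> (T t x))"
proof -
  have lpos: "l > 0" using l w_ge_1 by simp
  have \<phi>lin: "bounded_linear \<phi>" using \<phi>(1) by (simp add: bounded_clinear_def)
  have \<phi>R: "\<phi> (r *\<^sub>R x) = of_real r * \<phi> x" for r x
    using linear_scale[OF bounded_linear.linear[OF \<phi>lin]] by (simp add: scaleR_conv_of_real)
  have cont: "continuous_on {0<..} (\<lambda>t. \<phi> (T t x))"
    by (intro bounded_linear.continuous_on[OF \<phi>lin] T_continuous) auto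
  have meas: "set_borel_measurable lborel {0<..} (\<lambda>t. \<phi> (T t x))"
    by (rule continuous_imp_measurable_pos[OF cont])
  have bound: "cmod (\<phi> (T t x)) \<le> M * norm x * exp (w * t)" if "t > 0" for t
    using order_trans[OF \<phi>(2) growth_apply[of t x]] that by (simp add: mult_ac)
  show int: "set_integrable lborel {0<..} (\<lambda>t. exp (- of_real l * of_real t) * \<phi> (T t x))"
    by (rule laplace_integrable[OF meas bound]) (use l M_ge_1 in auto)
  let ?y = "R (of_real l) x"
  define d where "d t = - \<phi> (exp (- l * t) *\<^sub>R T t ?y)" for t
  have f_eq: "\<phi> (exp (- l * t) *\<^sub>R T t x) = exp (- of_real l * of_real t) * \<phi> (T t x)" for t
    by (simp add: \<phi>R exp_of_real[symmetric])
  have "(LBINT t=ereal 0..\<infinity>. exp (- of_real l * of_real t) * \<phi> (T t x)) = 0 - (- \<phi> ?y)"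
  proof (rule interval_integral_FTC_integrable[where F = d])
    show "(d has_vector_derivative exp (- of_real l * of_real t) * \<phi> (T t x)) (at t)" if "ereal 0 < ereal t" for t
    proof -
      have "((\<lambda>t. exp (- l * t) *\<^sub>R T t ?y) has_vector_derivative - (exp (- l * t) *\<^sub>R T t x)) (at t)"
        using resolvent_orbit_derivative[OF lpos, of t 0 x] that by simp
      then have "(d has_vector_derivative - \<phi> (- (exp (- l * t) *\<^sub>R T t x))) (at t)"
        unfolding d_def[abs_def] by (intro has_vector_derivative_minus bounded_linear.has_vector_derivative[OF \<phi>lin])
      then show ?thesis unfolding linear_neg[OF bounded_linear.linear[OF \<phi>lin]] minus_minus f_eq .
    qed
    show "isCont (\<lambda>t. exp (- of_real l * of_real t) * \<phi> (T t x)) t" if "ereal 0 < ereal t" for t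
    proof -
      have "continuous_on {0<..} (\<lambda>t. exp (- of_real l * of_real t) * \<phi> (T t x))" by (intro continuous_intros cont)
      then show ?thesis using that continuous_on_eq_continuous_at[OF open_greaterThan] by auto
    qed
    have "einterval (ereal 0) \<infinity> = {0<..}" by (auto simp: einterval_def)
    then show "set_integrable lborel (einterval (ereal 0) \<infinity>) (\<lambda>t. exp (- of_real l * of_real t) * \<phi> (T t x))"
      using int by simp
    have "continuous_on {0..1} d" unfolding d_def
      by (intro continuous_on_minus bounded_linear.continuous_on[OF \<phi>lin] continuous_on_scaleR continuous_on_exp
        continuous_on_mult_left continuous_on_id T_continuous) auto
    then have "(d \<longlongrightarrow> d 0) (at 0 within {0..1})" by (simp add: continuous_on_def)
    then have "(d \<longlongrightarrow> - \<phi> ?y) (at_right 0)" by (simp add: at_within_Icc_at_right d_def T_0)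
    then show "((d \<circ> real_of_ereal) \<longlongrightarrow> - \<phi> ?y) (at_right (ereal 0))" by (simp add: ereal_tendsto_simps)
    have "(d \<longlongrightarrow> - \<phi> 0) at_top" unfolding d_def
      by (intro tendsto_minus bounded_linear.tendsto[OF \<phi>lin] scaled_orbit_tendsto_0 l)
    then have "(d \<longlongrightarrow> 0) at_top" by (simp add: linear_0[OF bounded_linear.linear[OF \<phi>lin]])
    then show "((d \<circ> real_of_ereal) \<longlongrightarrow> 0) (at_left \<infinity>)" by (simp add: ereal_tendsto_simps)
  qed simp
  then show "laplace (\<lambda>t. \<phi> (T t x)) (of_real l) = \<phi> ?y"
    by (simp add: interval_integral_to_infinity_eq laplace_def)
qed

text \<open>Both sides are holomorphic where \<open>Re z > 0\<close> and \<open>Re ((1 + i q) z) > b\<close>, and agree for large real \<open>z\<close>.  The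
  point is that \<open>z\<close> may lie close to the imaginary axis if \<open>q\<close> and \<open>Im z\<close> have opposite signs and \<open>|z|\<close> is
  large.\<close>

lemma resolvent_difference:
  assumes \<phi>: "bounded_clinear \<phi>" "\<And>x. cmod (\<phi> x) \<le> norm x"
    and m: "0 < m" and hol: "s holomorphic_on wedge m"
    and s_bound: "\<And>z. z \<in> wedge m \<Longrightarrow> cmod (s z) \<le> c * exp (b * Re z)" and c: "c \<ge> 0" and b: "b \<ge> 0"
    and d_bound: "\<And>t. t > 0 \<Longrightarrow> cmod (\<phi> (T t x) - s (of_real t)) \<le> C * exp (\<omega> * t)" and C: "C \<ge> 0" and \<omega>: "\<omega> < 0"
    and q: "\<bar>q\<bar> < m" and z: "Re z > 0" "Re ((1 + \<i> * of_real q) * z) > b"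
  shows "\<phi> (R z x) - laplace (\<lambda>t. \<phi> (T t x) - s (of_real t)) z
    = (1 + \<i> * of_real q) * laplace (\<lambda>t. s (of_real t * (1 + \<i> * of_real q))) ((1 + \<i> * of_real q) * z)"
proof -
  let ?e = "1 + \<i> * complex_of_real q"
  let ?d = "\<lambda>t. \<phi> (T t x) - s (of_real t)"
  have \<phi>lin: "bounded_linear \<phi>" using \<phi>(1) by (simp add: bounded_clinear_def)
  note sq_cont = wedge_ray_continuous[OF hol]
  have s0_cont: "continuous_on {0<..} (\<lambda>t. s (of_real t))" using sq_cont[of 0] m by simp
  note meas = continuous_imp_measurable_pos
  have d_cont: "continuous_on {0<..} ?d"
    by (intro continuous_on_diff s0_cont bounded_linear.continuous_on[OF \<phi>lin] T_continuous) auto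
  have sq_bound: "cmod (s (of_real t * ?e)) \<le> c * exp (b * t)" if "t > 0" for t
    using s_bound[OF wedge_ray[OF that q]] by simp
  have s0_bound: "cmod (s (of_real t)) \<le> c * exp (b * t)" if "t > 0" for t
    using s_bound[OF wedge_ray[OF that, of 0]] m by simp
  have real_case: "\<phi> (R (of_real l) x) - laplace ?d (of_real l)
      = ?e * laplace (\<lambda>t. s (of_real t * ?e)) (?e * of_real l)" if l: "l > max w b" for l
  proof -
    have int_s: "set_integrable lborel {0<..} (\<lambda>t. exp (- of_real l * of_real t) * s (of_real t))"
      by (rule laplace_integrable[OF meas[OF s0_cont] s0_bound c]) (use l in auto)
    have int_T: "set_integrable lborel {0<..} (\<lambda>t. exp (- of_real l * of_real t) * \<phi> (T t x))"
      by (rule laplace_orbit(2)[OF \<phi>]) (use l in simp)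
    have "laplace ?d (of_real l) = laplace (\<lambda>t. \<phi> (T t x)) (of_real l) - laplace (\<lambda>t. s (of_real t)) (of_real l)"
      unfolding laplace_def right_diff_distrib by (rule set_integral_diff(2)[OF int_T int_s])
    moreover have "laplace (\<lambda>t. \<phi> (T t x)) (of_real l) = \<phi> (R (of_real l) x)"
      by (rule laplace_orbit(1)[OF \<phi>]) (use l in simp)
    moreover have "laplace (\<lambda>t. s (of_real t)) (of_real l) = ?e * laplace (\<lambda>t. s (of_real t * ?e)) (?e * of_real l)"
      by (rule laplace_rotate[OF m hol s_bound c q]) (use l in auto)
    ultimately show ?thesis by simp
  qed
  define W where "W = {z. Re z > 0} \<inter> {z. Re (?e * z) > b}"
  have W_eq: "W = {z. 1 \<bullet> z > 0} \<inter> {z. Complex 1 (- q) \<bullet> z > b}"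
    unfolding W_def by (auto simp: inner_complex_def algebra_simps)
  have "convex W" unfolding W_eq by (intro convex_Int convex_halfspace_gt)
  then have conn: "connected W" by (rule convex_connected)
  have "open W" unfolding W_eq by (intro open_Int open_halfspace_gt)
  define h where "h z = \<phi> (R z x) - laplace ?d z - ?e * laplace (\<lambda>t. s (of_real t * ?e)) (?e * z)" for z
  have d_hol: "laplace ?d holomorphic_on {z. Re z > \<omega>}"
    by (rule laplace_holomorphic[OF meas[OF d_cont] d_bound C])
  have s_hol: "laplace (\<lambda>t. s (of_real t * ?e)) holomorphic_on {z. Re z > b}"
    by (rule laplace_holomorphic[OF meas[OF sq_cont[OF q]] sq_bound c])
  have "(\<lambda>z. laplace (\<lambda>t. s (of_real t * ?e)) (?e * z)) holomorphic_on W"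
    by (rule holomorphic_on_compose_gen[OF _ s_hol, unfolded comp_def]) (auto simp: W_def intro!: holomorphic_intros)
  then have "h holomorphic_on W" unfolding h_def
    by (intro holomorphic_intros holomorphic_on_subset[OF R_scalar_holomorphic[OF \<phi>]] holomorphic_on_subset[OF d_hol])
      (use \<omega> in \<open>auto simp: W_def\<close>)
  then have "h z = 0"
  proof (rule analytic_continuation[OF _ \<open>open W\<close> conn])
    define l0 where "l0 = max w b"
    have l0: "l0 > 0" using w_ge_1 by (simp add: l0_def)
    show sub: "of_real ` {l0<..} \<subseteq> W" using b l0 by (auto simp: W_def l0_def)
    show "of_real (l0 + 1) \<in> W" using sub by (metis image_subset_iff greaterThan_iff less_add_one)
    show "complex_of_real (l0 + 1) islimpt of_real ` {l0<..}"
    proof (rule islimptI)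
      fix U :: "complex set" assume U: "of_real (l0 + 1) \<in> U" "open U"
      then obtain r where r: "r > 0" "ball (complex_of_real (l0 + 1)) r \<subseteq> U" by (meson openE)
      have "complex_of_real (l0 + 1 + r / 2) \<in> U"
        using r by (intro subsetD[OF r(2)]) (simp add: dist_norm del: of_real_add add: of_real_diff[symmetric])
      then show "\<exists>y\<in>of_real ` {l0<..}. y \<in> U \<and> y \<noteq> complex_of_real (l0 + 1)"
        using r(1) by (intro bexI[of _ "complex_of_real (l0 + 1 + r / 2)"]) (auto simp del: of_real_add)
    qed
    show "h z = 0" if "z \<in> of_real ` {l0<..}" for z
      using that real_case unfolding h_def l0_def by auto
    show "z \<in> W" using z by (simp add: W_def)
  qed
  then show ?thesis by (simp add: h_def)
qed

text \<open>By \<open>R_scalar_deriv\<close>, \<open>\<phi> (E\<^sup>n x)\<close> is, up to a factor, the Taylor coefficient of order \<open>n - 1\<close> of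
  \<open>\<phi> (R z x)\<close> at \<open>l = n / t\<close>.  The Laplace transform of the decaying part \<open>d\<close> has good Taylor
  coefficients everywhere in the right half-plane.  The rest, \<open>u\<close>, is treated through its derivative \<open>g\<close>: on
  \<open>Re z \<ge> 1 / t\<close> it is of order \<open>t \<kappa> (1 / t)\<close>, and it decays like \<open>1 / |z|\<^sup>2\<close>.  Recovering \<open>u\<close> from
  \<open>g\<close> divides the Taylor coefficients by \<open>n - 1\<close>; with the power of \<open>l - 1 / t\<close> gained in
  \<open>circle_average_bound\<close>, this makes up for the factor \<open>t\<close>.\<close>

lemma scalar_euler_bound:
  assumes \<phi>: "bounded_clinear \<phi>" "\<And>x. cmod (\<phi> x) \<le> norm x"
    and m: "0 < m" "m \<le> 1" and hol: "s holomorphic_on wedge m"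
    and s_bound: "\<And>z. z \<in> wedge m \<Longrightarrow> cmod (s z) \<le> c * norm x * exp (b * Re z)" and c: "c \<ge> 0" and b: "b \<ge> 0"
    and d_bound: "\<And>t. t > 0 \<Longrightarrow> cmod (\<phi> (T t x) - s (of_real t)) \<le> C * norm x * exp (\<omega> * t)" and C: "C \<ge> 0" and \<omega>: "\<omega> < 0"
    and t: "t \<ge> 1" and n: "n \<ge> 2"
  shows "cmod (\<phi> ((E (t / real n) ^^ n) x))
    \<le> (C + 8 * exp 2 * ((4 * 2 powr \<alpha> + C / \<omega>\<^sup>2) * (1 + (max 1 (4 * b / m))\<^sup>2) + 64 * c / m\<^sup>2)) * \<kappa> (1 / t) * norm x"
proof -
  define X where "X = norm x"
  define a where "a = 1 / t"
  define l where "l = real n / t"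
  define \<rho>0 where "\<rho>0 = max 1 (4 * b / m)"
  have X: "X \<ge> 0" by (simp add: X_def)
  have a: "0 < a" "a \<le> 1" "a < l" using t n by (auto simp: a_def l_def divide_strict_right_mono)
  have l: "l > 0" using a by simp
  let ?d = "\<lambda>t. \<phi> (T t x) - s (of_real t)"
  let ?L = "laplace ?d"
  let ?r = "\<lambda>z. \<phi> (R z x)"
  let ?H = "{z :: complex. Re z > 0}"
  have openH: "open ?H" by (rule open_halfspace_Re_gt)
  have r_hol: "?r holomorphic_on ?H" by (rule R_scalar_holomorphic[OF \<phi>])
  have \<phi>lin: "bounded_linear \<phi>" using \<phi>(1) by (simp add: bounded_clinear_def)
  note sq_cont = wedge_ray_continuous[OF hol]
  have s0_cont: "continuous_on {0<..} (\<lambda>t. s (of_real t))" using sq_cont[of 0] m by simp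
  note meas = continuous_imp_measurable_pos
  have d_meas: "set_borel_measurable lborel {0<..} ?d"
    by (intro meas continuous_on_diff s0_cont bounded_linear.continuous_on[OF \<phi>lin] T_continuous) auto
  have CX: "C * X \<ge> 0" and cX: "c * X \<ge> 0" using C c X by auto
  have d_bound': "cmod (?d t) \<le> C * X * exp (\<omega> * t)" if "t > 0" for t using d_bound[OF that] by (simp add: X_def)
  have L_hol: "?L holomorphic_on ?H"
    by (rule holomorphic_on_subset[OF laplace_holomorphic[OF d_meas d_bound' CX]]) (use \<omega> in auto)
  have L_deriv: "cmod ((deriv ^^ k) ?L z) \<le> fact k * (C * X / (Re z - \<omega>) ^ Suc k)" if "Re z > \<omega>" for k z
    by (rule laplace_deriv_bound[OF d_meas d_bound' CX that])
  define u where "u z = ?r z - ?L z" for z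
  have u_hol: "u holomorphic_on ?H" unfolding u_def by (intro holomorphic_intros r_hol L_hol)
  define g where "g = deriv u"
  have g_hol: "g holomorphic_on ?H" unfolding g_def by (rule holomorphic_deriv[OF u_hol openH])
  have g_eq: "g z = deriv ?r z - deriv ?L z" if "z \<in> ?H" for z
    using higher_deriv_diff[OF r_hol L_hol openH that, of 1] by (simp add: g_def u_def[abs_def])
  have g_low: "cmod (g z) \<le> 2 * \<kappa> (a / 2) / a * X + C * X / \<omega>\<^sup>2" if z: "Re z \<ge> a" for z
  proof -
    have zH: "z \<in> ?H" using z a by simp
    have "cmod (deriv ?r z) = cmod (\<phi> ((blinfun_apply (R z) ^^ Suc 1) x))"
      using R_scalar_deriv[OF \<phi>, of z 1 x] zH by (simp add: norm_mult)
    also have "\<dots> \<le> \<kappa> (a / 2) * X / (Re z - a / 2) ^ 1"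
      using R_scalar_cauchy[OF \<phi>, of "a / 2" z 1 x] a z unfolding X_def by linarith
    also have "\<dots> \<le> \<kappa> (a / 2) * X / (a / 2)"
      using a z \<kappa>_ge_1[of "a / 2"] X by (intro divide_left_mono) auto
    finally have "cmod (deriv ?r z) \<le> 2 * \<kappa> (a / 2) / a * X" by (simp add: mult_ac)
    moreover have "cmod (deriv ?L z) \<le> C * X / (Re z - \<omega>)\<^sup>2"
      using L_deriv[of z 1] z a \<omega> by (simp add: power2_eq_square)
    moreover have "C * X / (Re z - \<omega>)\<^sup>2 \<le> C * X / \<omega>\<^sup>2"
    proof (intro divide_left_mono CX mult_pos_pos)
      have "(- \<omega>)\<^sup>2 \<le> (Re z - \<omega>)\<^sup>2" using z a \<omega> by (intro power_mono) auto
      then show "\<omega>\<^sup>2 \<le> (Re z - \<omega>)\<^sup>2" by simp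
    qed (use \<omega> z a in auto)
    ultimately show ?thesis using norm_triangle_ineq4[of "deriv ?r z" "deriv ?L z"] g_eq[OF zH] by simp
  qed
  \<comment> \<open>For \<open>z\<close> near the imaginary axis the ray is rotated to the opposite side of the real axis, so that
    \<open>Re (?e * z)\<close> is at least \<open>m / 2 * |z|\<close>.\<close>
  have g_high: "cmod (g z) \<le> 32 * (c * X) / m\<^sup>2 / (cmod z)\<^sup>2" if z: "Re z > 0" "cmod z \<ge> \<rho>0" for z
  proof -
    define q where "q = (if Im z \<ge> 0 then - m / 2 else m / 2)"
    have q: "\<bar>q\<bar> < m" "\<bar>q\<bar> \<le> 1" using m by (auto simp: q_def)
    let ?e = "1 + \<i> * complex_of_real q"
    let ?f = "\<lambda>t. s (of_real t * ?e)"
    have z1: "cmod z \<ge> 1" and zb: "4 * b / m \<le> cmod z" using z by (auto simp: \<rho>0_def)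
    have re: "Re (?e * z) \<ge> m / 2 * cmod z"
    proof -
      have "m / 2 * cmod z \<le> m / 2 * (\<bar>Re z\<bar> + \<bar>Im z\<bar>)" using m by (intro mult_left_mono cmod_le) auto
      also have "\<dots> = m / 2 * Re z + m / 2 * \<bar>Im z\<bar>" using z by (simp add: distrib_left)
      also have "\<dots> \<le> 1 * Re z + m / 2 * \<bar>Im z\<bar>" using m z by (intro add_right_mono mult_right_mono) auto
      also have "\<dots> = Re (?e * z)" by (simp add: q_def)
      finally show ?thesis .
    qed
    have b_le: "b \<le> m / 4 * cmod z" using zb m by (simp add: field_simps)
    have gap: "m / 4 * cmod z \<le> Re (?e * z) - b" using re b_le by simp
    have "cmod z > 0" using z1 by linarith
    then have gap0: "m / 4 * cmod z > 0" using m by (intro mult_pos_pos) auto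
    have f_bound: "cmod (?f t) \<le> c * X * exp (b * t)" if "t > 0" for t
      using s_bound[OF wedge_ray[OF that q(1)]] by (simp add: X_def)
    have f_meas: "set_borel_measurable lborel {0<..} ?f" by (rule meas[OF sq_cont[OF q(1)]])
    define V where "V = ?H \<inter> {z. Re (?e * z) > b}"
    have "open V" unfolding V_def by (intro open_Int openH open_Collect_less continuous_intros)
    have zV: "z \<in> V" using z gap gap0 by (simp add: V_def)
    have "u v = ?e * laplace ?f (?e * v)" if "v \<in> V" for v
      unfolding u_def
    proof (rule resolvent_difference[OF \<phi> m(1) hol _ cX b d_bound' CX \<omega> q(1)])
      show "cmod (s z) \<le> c * X * exp (b * Re z)" if "z \<in> wedge m" for z using s_bound[OF that] by (simp add: X_def)
    qed (use that in \<open>auto simp: V_def\<close>)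
    then have ev: "\<forall>\<^sub>F v in nhds z. u v = ?e * laplace ?f (?e * v)"
      using eventually_nhds_in_open[OF \<open>open V\<close> zV] by (auto elim: eventually_mono)
    have f_hol: "laplace ?f holomorphic_on {z. Re z > b}" by (rule laplace_holomorphic[OF f_meas f_bound cX])
    have "(laplace ?f has_field_derivative deriv (laplace ?f) (?e * z)) (at (?e * z))"
      by (rule holomorphic_derivI[OF f_hol open_halfspace_Re_gt]) (use zV in \<open>simp add: V_def\<close>)
    moreover have "((\<lambda>v. ?e * v) has_field_derivative ?e) (at z)" by (auto intro!: derivative_eq_intros)
    ultimately have "((\<lambda>v. laplace ?f (?e * v)) has_field_derivative deriv (laplace ?f) (?e * z) * ?e) (at z)"
      by (rule DERIV_chain2[where f = "laplace ?f" and g = "\<lambda>v. ?e * v"])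
    from DERIV_cmult[OF this, of ?e]
    have "deriv (\<lambda>v. ?e * laplace ?f (?e * v)) z = ?e * (deriv (laplace ?f) (?e * z) * ?e)" by (rule DERIV_imp_deriv)
    then have "g z = ?e * (deriv (laplace ?f) (?e * z) * ?e)" unfolding g_def using deriv_cong_ev[OF ev refl] by simp
    then have "cmod (g z) = (cmod ?e)\<^sup>2 * cmod (deriv (laplace ?f) (?e * z))"
      by (simp only: norm_mult power2_eq_square mult_ac)
    also have "\<dots> \<le> 2 * (c * X / (m / 4 * cmod z)\<^sup>2)"
    proof (intro mult_mono)
      have "(cmod ?e)\<^sup>2 = 1 + q\<^sup>2" by (simp add: cmod_power2)
      moreover have "q\<^sup>2 \<le> 1" using q(2) by (simp add: abs_square_le_1)
      ultimately show "(cmod ?e)\<^sup>2 \<le> 2" by simp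
      have "cmod (deriv (laplace ?f) (?e * z)) \<le> c * X / (Re (?e * z) - b)\<^sup>2"
        using laplace_deriv_bound[OF f_meas f_bound cX, of "?e * z" 1] gap gap0 by (simp add: power2_eq_square)
      also have "\<dots> \<le> c * X / (m / 4 * cmod z)\<^sup>2"
      proof (rule divide_left_mono[OF _ cX])
        show "(m / 4 * cmod z)\<^sup>2 \<le> (Re (?e * z) - b)\<^sup>2" by (rule power_mono[OF gap less_imp_le[OF gap0]])
        show "0 < (Re (?e * z) - b)\<^sup>2 * (m / 4 * cmod z)\<^sup>2"
          by (intro mult_pos_pos[of "(Re (?e * z) - b)\<^sup>2"] zero_less_power gap0 less_le_trans[OF gap0 gap])
      qed
      finally show "cmod (deriv (laplace ?f) (?e * z)) \<le> c * X / (m / 4 * cmod z)\<^sup>2" .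
    qed auto
    also have "\<dots> = 32 * (c * X) / m\<^sup>2 / (cmod z)\<^sup>2" by (simp add: power_mult_distrib power_divide)
    finally show ?thesis .
  qed
  define B where "B = (2 * \<kappa> (a / 2) / a * X + C * X / \<omega>\<^sup>2) * (1 + \<rho>0\<^sup>2) + 64 * (c * X) / m\<^sup>2"
  have low_nonneg: "0 \<le> 2 * \<kappa> (a / 2) / a * X + C * X / \<omega>\<^sup>2"
    using \<kappa>_ge_1[of "a / 2"] a X CX by simp
  have high_nonneg: "0 \<le> 64 * (c * X) / m\<^sup>2" using cX by simp
  have B: "B \<ge> 0" unfolding B_def by (intro add_nonneg_nonneg[OF mult_nonneg_nonneg[OF low_nonneg] high_nonneg]) simp
  have g_bound: "cmod (g z) \<le> B / (1 + (cmod z)\<^sup>2)" if z: "Re z \<ge> a" for z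
  proof -
    have pos: "1 + (cmod z)\<^sup>2 > 0" by (simp add: add_pos_nonneg)
    have "cmod (g z) * (1 + (cmod z)\<^sup>2) \<le> B"
    proof (cases "cmod z \<ge> \<rho>0")
      case True
      then have z1: "cmod z \<ge> 1" by (simp add: \<rho>0_def)
      then have "1 \<le> (cmod z)\<^sup>2" by simp
      then have "cmod (g z) * (1 + (cmod z)\<^sup>2) \<le> (32 * (c * X) / m\<^sup>2 / (cmod z)\<^sup>2) * (2 * (cmod z)\<^sup>2)"
        using g_high[OF _ True] z a cX by (intro mult_mono) auto
      also have "\<dots> = 64 * (c * X) / m\<^sup>2"
      proof -
        have "y / v * (2 * v) = 2 * y" if "v \<noteq> 0" for y v :: real using that by simp
        from this[of "(cmod z)\<^sup>2" "32 * (c * X) / m\<^sup>2"] z1 show ?thesis by fastforce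
      qed
      also have "\<dots> \<le> B" unfolding B_def using low_nonneg by (simp add: mult_nonneg_nonneg)
      finally show ?thesis .
    next
      case False
      have "(cmod z)\<^sup>2 \<le> \<rho>0\<^sup>2" using False by (intro power_mono) auto
      then have "cmod (g z) * (1 + (cmod z)\<^sup>2) \<le> (2 * \<kappa> (a / 2) / a * X + C * X / \<omega>\<^sup>2) * (1 + \<rho>0\<^sup>2)"
        using g_low[OF z] low_nonneg by (intro mult_mono) auto
      then show ?thesis unfolding B_def using high_nonneg by linarith
    qed
    then show ?thesis using pos by (simp add: pos_le_divide_eq)
  qed
  obtain k where k: "n = Suc (Suc k)" using n by (metis add_2_eq_Suc le_Suc_ex)
  define Y where "Y = cmod (\<phi> ((blinfun_apply (R (of_real l)) ^^ n) x))"
  have "fact (Suc k) * Y = cmod ((deriv ^^ Suc k) ?r (of_real l))"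
    using R_scalar_deriv[OF \<phi>, of "of_real l" "Suc k" x] l
    by (simp add: Y_def k norm_mult norm_power del: funpow.simps fact_Suc)
  also have "(deriv ^^ Suc k) ?r (of_real l) = (deriv ^^ k) g (of_real l) + (deriv ^^ Suc k) ?L (of_real l)"
  proof -
    have "(deriv ^^ k) g (of_real l) = (deriv ^^ Suc k) u (of_real l)"
      unfolding g_def by (simp add: funpow_Suc_right del: funpow.simps)
    also have "\<dots> = (deriv ^^ Suc k) ?r (of_real l) - (deriv ^^ Suc k) ?L (of_real l)"
      unfolding u_def by (rule higher_deriv_diff[OF r_hol L_hol openH]) (use l in simp)
    finally show ?thesis by simp
  qed
  also have "cmod \<dots> \<le> fact k * (4 * B / (l - a) ^ Suc k) + fact (Suc k) * (C * X / (l - \<omega>) ^ n)"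
  proof (rule order_trans[OF norm_triangle_ineq add_mono])
    show "cmod ((deriv ^^ k) g (of_real l)) \<le> fact k * (4 * B / (l - a) ^ Suc k)"
      by (rule circle_average_bound[OF g_hol a(1,3) B g_bound])
    show "cmod ((deriv ^^ Suc k) ?L (of_real l)) \<le> fact (Suc k) * (C * X / (l - \<omega>) ^ n)"
      using L_deriv[of "of_real l" "Suc k"] l \<omega> by (simp add: k del: fact_Suc funpow.simps power_Suc)
  qed
  finally have main: "real (Suc k) * Y \<le> 4 * B / (l - a) ^ Suc k + real (Suc k) * (C * X / (l - \<omega>) ^ n)"
  proof -
    assume *: "fact (Suc k) * Y \<le> fact k * (4 * B / (l - a) ^ Suc k) + fact (Suc k) * (C * X / (l - \<omega>) ^ n)"
    have f: "fact (Suc k) = (fact k :: real) * real (Suc k)" by simp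
    have "fact k * (real (Suc k) * Y) \<le> fact k * (4 * B / (l - a) ^ Suc k + real (Suc k) * (C * X / (l - \<omega>) ^ n))"
      using * unfolding f by (simp only: distrib_left mult.assoc)
    then show ?thesis by (rule mult_left_le_imp_le) simp
  qed
  have E: "cmod (\<phi> ((E (t / real n) ^^ n) x)) = l ^ n * Y"
  proof -
    have "1 / (t / real n) = l" by (simp add: l_def)
    then have "(E (t / real n) ^^ n) x = l ^ n *\<^sub>R (blinfun_apply (R (of_real l)) ^^ n) x" by (simp add: E_power_eq)
    then show ?thesis using l linear_scale[OF bounded_linear.linear[OF \<phi>lin]] by (simp add: Y_def)
  qed
  have part1: "l ^ n * (C * X / (l - \<omega>) ^ n) \<le> C * X"
  proof -
    have "l ^ n \<le> (l - \<omega>) ^ n" using l \<omega> by (intro power_mono) auto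
    then have "C * X * l ^ n \<le> C * X * (l - \<omega>) ^ n" by (intro mult_left_mono CX)
    then show ?thesis using l \<omega> by (simp add: pos_divide_le_eq mult.commute)
  qed
  have part2: "l ^ n * (4 * B / (l - a) ^ Suc k / real (Suc k)) \<le> 8 * exp 2 * (B / t)"
  proof -
    define r where "r = 1 - 1 / real n"
    have r: "0 < r" "r \<le> 1" using n by (auto simp: r_def)
    have la: "l - a = l * r" using t n by (simp add: l_def a_def r_def field_simps)
    have "exp (-2) \<le> r ^ n" unfolding r_def by (rule one_minus_inverse_power[OF n])
    also have "\<dots> \<le> r ^ Suc k" using r by (intro power_decreasing) (auto simp: k)
    finally have "1 / r ^ Suc k \<le> 1 / exp (-2)" using r by (intro divide_left_mono) auto
    then have re: "1 / r ^ Suc k \<le> exp 2" by (simp add: exp_minus inverse_eq_divide)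
    have lk: "l / real (Suc k) \<le> 2 / t"
    proof -
      have "real n / real (Suc k) \<le> 2" by (simp add: k pos_divide_le_eq)
      then have "real n / real (Suc k) / t \<le> 2 / t" using t by (intro divide_right_mono) auto
      then show ?thesis by (simp add: l_def mult.commute)
    qed
    have "l ^ n * (4 * B / (l - a) ^ Suc k / real (Suc k)) = 4 * B * (l / real (Suc k)) * (1 / r ^ Suc k)"
    proof -
      have cancel: "l * L * (4 * B / (L * Q) / S) = 4 * B * (l / S) * (1 / Q)" if "L \<noteq> 0" for L Q S
        using that by (simp add: mult_ac)
      have ln: "l ^ n = l * l ^ Suc k" by (simp add: k)
      show ?thesis unfolding la power_mult_distrib ln by (rule cancel) (use l in simp)
    qed
    also have "\<dots> \<le> 4 * B * (2 / t) * exp 2"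
      using B lk re l t r by (intro mult_mono) auto
    finally show ?thesis by (simp add: mult_ac)
  qed
  have "Y \<le> 4 * B / (l - a) ^ Suc k / real (Suc k) + C * X / (l - \<omega>) ^ n"
  proof -
    have "real (Suc k) * Y \<le> real (Suc k) * (4 * B / (l - a) ^ Suc k / real (Suc k) + C * X / (l - \<omega>) ^ n)"
      using main unfolding distrib_left by simp
    then show ?thesis by (rule mult_left_le_imp_le) simp
  qed
  then have "l ^ n * Y \<le> l ^ n * (4 * B / (l - a) ^ Suc k / real (Suc k) + C * X / (l - \<omega>) ^ n)"
    using l by (intro mult_left_mono) auto
  also have "\<dots> \<le> C * X + 8 * exp 2 * (B / t)" unfolding distrib_left using part1 part2 by linarith
  finally have Ebound: "cmod (\<phi> ((E (t / real n) ^^ n) x)) \<le> C * X + 8 * exp 2 * (B / t)" unfolding E .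
  have \<kappa>: "\<kappa> (1 / t) \<ge> 1" by (rule \<kappa>_ge_1)
  have \<kappa>2: "\<kappa> (a / 2) \<le> 2 powr \<alpha> * \<kappa> (1 / t)"
  proof -
    have "\<kappa> (a / 2) = K * (2 powr \<alpha> * t powr \<alpha> + 1)"
      using t by (simp add: \<kappa>_def a_def powr_minus powr_divide powr_mult)
    also have "\<dots> \<le> K * (2 powr \<alpha> * t powr \<alpha> + 2 powr \<alpha>)"
      using K_ge_1 \<alpha>_nonneg by (intro mult_left_mono add_left_mono ge_one_powr_ge_zero) auto
    also have "\<dots> = 2 powr \<alpha> * \<kappa> (1 / t)"
      using t by (simp add: \<kappa>_def powr_minus powr_divide algebra_simps)
    finally show ?thesis .
  qed
  have "B / t \<le> ((4 * 2 powr \<alpha> + C / \<omega>\<^sup>2) * (1 + \<rho>0\<^sup>2) + 64 * c / m\<^sup>2) * (\<kappa> (1 / t) * X)"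
  proof -
    have "2 * \<kappa> (a / 2) / a * X = t * (2 * \<kappa> (a / 2) * X)" by (simp add: a_def)
    also have "\<dots> \<le> t * (4 * 2 powr \<alpha> * (\<kappa> (1 / t) * X))"
    proof (rule mult_left_mono)
      have "2 * \<kappa> (a / 2) * X \<le> 2 * (2 powr \<alpha> * \<kappa> (1 / t)) * X" using \<kappa>2 X by (intro mult_right_mono mult_left_mono) auto
      also have "\<dots> \<le> 4 * 2 powr \<alpha> * (\<kappa> (1 / t) * X)" using \<kappa> X by simp
      finally show "2 * \<kappa> (a / 2) * X \<le> 4 * 2 powr \<alpha> * (\<kappa> (1 / t) * X)" .
    qed (use t in simp)
    finally have A1: "2 * \<kappa> (a / 2) / a * X \<le> t * (4 * 2 powr \<alpha> * (\<kappa> (1 / t) * X))" .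
    have tX: "X \<le> t * (\<kappa> (1 / t) * X)"
    proof -
      have "1 * X \<le> (t * \<kappa> (1 / t)) * X" using t \<kappa> X mult_mono[of 1 t 1 "\<kappa> (1 / t)"] by (intro mult_right_mono) auto
      then show ?thesis by (simp add: mult.assoc)
    qed
    have A2: "C * X / \<omega>\<^sup>2 \<le> t * (C / \<omega>\<^sup>2 * (\<kappa> (1 / t) * X))"
      using mult_left_mono[OF tX, of "C / \<omega>\<^sup>2"] C by (simp add: mult_ac)
    have A3: "64 * (c * X) / m\<^sup>2 \<le> t * (64 * c / m\<^sup>2 * (\<kappa> (1 / t) * X))"
      using mult_left_mono[OF tX, of "64 * c / m\<^sup>2"] c by (simp add: mult_ac)
    have "B \<le> (t * (4 * 2 powr \<alpha> * (\<kappa> (1 / t) * X)) + t * (C / \<omega>\<^sup>2 * (\<kappa> (1 / t) * X))) * (1 + \<rho>0\<^sup>2)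
        + t * (64 * c / m\<^sup>2 * (\<kappa> (1 / t) * X))"
      unfolding B_def by (intro add_mono mult_right_mono A1 A2 A3) auto
    also have "\<dots> = t * (((4 * 2 powr \<alpha> + C / \<omega>\<^sup>2) * (1 + \<rho>0\<^sup>2) + 64 * c / m\<^sup>2) * (\<kappa> (1 / t) * X))"
      by (simp only: distrib_left distrib_right mult_ac)
    finally show ?thesis using t by (simp add: pos_divide_le_eq mult.commute)
  qed
  then have "8 * exp 2 * (B / t) \<le> 8 * exp 2 * (((4 * 2 powr \<alpha> + C / \<omega>\<^sup>2) * (1 + \<rho>0\<^sup>2) + 64 * c / m\<^sup>2) * (\<kappa> (1 / t) * X))"
    by (intro mult_left_mono) auto
  moreover have "C * X \<le> C * (\<kappa> (1 / t) * X)"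
    using C mult_right_mono[OF \<kappa> X] by (intro mult_left_mono) auto
  ultimately have "cmod (\<phi> ((E (t / real n) ^^ n) x)) \<le> C * (\<kappa> (1 / t) * X)
      + 8 * exp 2 * (((4 * 2 powr \<alpha> + C / \<omega>\<^sup>2) * (1 + \<rho>0\<^sup>2) + 64 * c / m\<^sup>2) * (\<kappa> (1 / t) * X))"
    using Ebound by linarith
  then show ?thesis unfolding X_def[symmetric] \<rho>0_def[symmetric] by (simp only: distrib_left distrib_right mult_ac)
qed

text \<open>The functional is chosen after \<open>n\<close> and \<open>x\<close>, so as to be norming for \<open>E\<^sup>n x\<close>; the constant in
  \<open>scalar_euler_bound\<close> does not depend on it.\<close>

theorem growth_asymptotically_analytic:
  assumes "asymptotically_analytic T"
  shows "\<exists>C\<ge>0. \<forall>t\<ge>0. norm (T t) \<le> C * K * (t powr \<alpha> + 1)"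
proof -
  have "Inf (ereal ` {\<omega>. \<exists>S. exp_bounded_analytic S \<and>
      bdd_above ((\<lambda>t. exp (- \<omega> * t) * norm (T t - S t)) ` {0<..})}) < 0"
    using assms by (simp add: asymptotically_analytic_def nonanalytic_growth_bound_def)
  then obtain \<omega> S where \<omega>: "\<omega> < 0" and S: "exp_bounded_analytic S"
    and bdd: "bdd_above ((\<lambda>t. exp (- \<omega> * t) * norm (T t - S t)) ` {0<..})"
    unfolding Inf_less_iff by auto
  obtain C0 where C0: "\<And>t. t > 0 \<Longrightarrow> exp (- \<omega> * t) * norm (T t - S t) \<le> C0"
    using bdd unfolding bdd_above_def by auto
  define C where "C = max 0 C0"
  have C: "C \<ge> 0" by (simp add: C_def)
  have TS: "norm (T t - S t) \<le> C * exp (\<omega> * t)" if "t > 0" for t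
  proof -
    have "norm (T t - S t) = exp (\<omega> * t) * (exp (- \<omega> * t) * norm (T t - S t))"
      by (simp add: mult.assoc[symmetric] mult_exp_exp)
    also have "\<dots> \<le> exp (\<omega> * t) * C" using C0[OF that] by (intro mult_left_mono) (auto simp: C_def)
    finally show ?thesis by (simp add: mult.commute)
  qed
  from S obtain \<theta> F c1 b1 where \<theta>: "0 < \<theta>"
    and F_lin: "\<forall>z\<in>sector \<theta>. bounded_clinear (blinfun_apply (F z))"
    and F_hol: "vector_holomorphic_on F (sector \<theta>)"
    and F_bound: "\<forall>z\<in>sector \<theta>. norm (F z) \<le> c1 * exp (b1 * cmod z)"
    and F_eq: "\<forall>t>0. F (complex_of_real t) = S t"
    unfolding exp_bounded_analytic_def by blast
  define m where "m = min 1 \<theta>"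
  have m: "0 < m" "m \<le> 1" "m \<le> \<theta>" using \<theta> by (auto simp: m_def)
  have sub: "wedge m \<subseteq> sector \<theta>" by (rule wedge_subset_sector[OF m(1,3)])
  define c where "c = max 0 c1"
  define b where "b = 2 * max 0 b1"
  have c: "c \<ge> 0" and b: "b \<ge> 0" by (auto simp: c_def b_def)
  have F_bound': "norm (F z) \<le> c * exp (b * Re z)" if z: "z \<in> wedge m" for z
  proof -
    have re: "Re z > 0" by (rule wedge_Re_pos[OF z m(1)])
    have "m * Re z \<le> 1 * Re z" using m(2) re by (intro mult_right_mono) auto
    then have "\<bar>Im z\<bar> \<le> Re z" using z by (simp add: wedge_def)
    then have cz: "cmod z \<le> 2 * Re z" using cmod_le[of z] re by simp
    have "b1 * cmod z \<le> max 0 b1 * cmod z" by (intro mult_right_mono) auto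
    also have "\<dots> \<le> max 0 b1 * (2 * Re z)" using cz by (intro mult_left_mono) auto
    finally have "b1 * cmod z \<le> b * Re z" by (simp add: b_def)
    then have "c1 * exp (b1 * cmod z) \<le> c * exp (b * Re z)" unfolding c_def by (intro mult_mono) auto
    then show ?thesis using F_bound sub z by fastforce
  qed
  define C' where "C' = C + 8 * exp 2 * ((4 * 2 powr \<alpha> + C / \<omega>\<^sup>2) * (1 + (max 1 (4 * b / m))\<^sup>2) + 64 * c / m\<^sup>2)"
  show ?thesis
  proof (rule growth_from_euler[where C = C'])
    show "0 \<le> C'" unfolding C'_def using C c by (intro add_nonneg_nonneg mult_nonneg_nonneg) auto
    fix t :: real and x assume t: "t \<ge> 1"
    have "norm ((E (t / real n) ^^ n) x) \<le> C' * \<kappa> (1 / t) * norm x" if n: "n \<ge> 2" for n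
    proof -
      obtain \<phi> where \<phi>: "bounded_clinear \<phi>" "\<And>x. cmod (\<phi> x) \<le> norm x"
        "\<phi> ((E (t / real n) ^^ n) x) = norm ((E (t / real n) ^^ n) x)"
        using norming_functional by metis
      have \<phi>lin: "bounded_linear \<phi>" and \<phi>C: "\<And>c x. \<phi> (c *\<^sub>C x) = c * \<phi> x"
        using \<phi>(1) by (auto simp: bounded_clinear_def scaleC_complex_def)
      have "cmod (\<phi> ((E (t / real n) ^^ n) x)) \<le> C' * \<kappa> (1 / t) * norm x"
        unfolding C'_def
      proof (rule scalar_euler_bound[OF \<phi>(1,2) m(1,2) _ _ c b _ C \<omega> t n])
        show "(\<lambda>z. \<phi> (F z x)) holomorphic_on wedge m"
        proof (rule holomorphic_onI)
          fix z assume z: "z \<in> wedge m"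
          obtain d where d: "(F has_derivative (\<lambda>h. h *\<^sub>C d)) (at z within sector \<theta>)"
            using F_hol z sub unfolding vector_holomorphic_on_def by blast
          have "bounded_linear (\<lambda>A. \<phi> (blinfun_apply A x))"
            by (rule bounded_linear_compose[OF \<phi>lin blinfun.bounded_linear_left])
          from bounded_linear.has_derivative[OF this has_derivative_subset[OF d sub]]
          have "((\<lambda>z. \<phi> (F z x)) has_derivative (\<lambda>h. \<phi> (d x) * h)) (at z within wedge m)"
            by (simp add: scaleC_blinfun.rep_eq \<phi>C mult.commute)
          then show "(\<lambda>z. \<phi> (F z x)) field_differentiable (at z within wedge m)"
            unfolding field_differentiable_def has_field_derivative_def by blast
        qed
        show "cmod (\<phi> (F z x)) \<le> c * norm x * exp (b * Re z)" if "z \<in> wedge m" for z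
        proof -
          have "cmod (\<phi> (F z x)) \<le> norm (F z) * norm x" by (rule order_trans[OF \<phi>(2) norm_blinfun])
          also have "\<dots> \<le> c * exp (b * Re z) * norm x" by (intro mult_right_mono F_bound' that) simp
          finally show ?thesis by (simp add: mult_ac)
        qed
        show "cmod (\<phi> (T t x) - \<phi> (F (of_real t) x)) \<le> C * norm x * exp (\<omega> * t)" if "t > 0" for t
        proof -
          have "\<phi> (T t x) - \<phi> (F (of_real t) x) = \<phi> ((T t - S t) x)"
            using F_eq that linear_diff[OF bounded_linear.linear[OF \<phi>lin]] by (simp add: blinfun.diff_left)
          then have "cmod (\<phi> (T t x) - \<phi> (F (of_real t) x)) \<le> norm (T t - S t) * norm x"
            using order_trans[OF \<phi>(2) norm_blinfun] by metis
          also have "\<dots> \<le> C * exp (\<omega> * t) * norm x" by (intro mult_right_mono TS that) simp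
          finally show ?thesis by (simp add: mult_ac)
        qed
      qed
      then show ?thesis unfolding \<phi>(3) by simp
    qed
    then show "\<forall>\<^sub>F n in sequentially. norm ((E (t / real n) ^^ n) x) \<le> C' * \<kappa> (1 / t) * norm x"
      unfolding eventually_sequentially by blast
  qed
qed

end

section \<open>The growth bound\<close>

theorem theorem1p1:
  fixes T :: "real \<Rightarrow> 'a :: {complex_normed_vector, banach} \<Rightarrow>\<^sub>L 'a"
    and D :: "'a set" and A :: "'a \<Rightarrow> 'a"
    and \<alpha> K :: real
  assumes nonzero: "\<exists>x :: 'a. x \<noteq> 0"
    and semigroup: "C0_semigroup T"
    and generator: "is_generator T D (\<lambda>x. - A x)"
    and spectrum: "{z. Re z < 0} \<subseteq> resolvent_set D A"
    and condition:
      "(\<exists>ip :: 'a \<Rightarrow> 'a \<Rightarrow> complex. hilbert_inner ip) \<or>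
       asymptotically_analytic T \<or>
       (\<exists>(p :: real) (M :: 'm measure) (\<Phi> :: ('m \<Rightarrow> complex) \<Rightarrow> 'a).
          1 \<le> p \<and> identifies_Lp \<Phi> p M \<and>
          (\<forall>t\<ge>0. positive_operator (Lp_nonneg \<Phi> p M) (T t))) \<or>
       (\<exists>J :: 'a \<Rightarrow> ('w :: topological_space \<Rightarrow>\<^sub>C complex).
          embeds_Cb J \<and> Cb_banach_lattice (range J) \<and>
          (const_bcontfun 1 \<in> range J \<or> Cb_sublattice (range J)) \<and>
          (\<forall>t\<ge>0. positive_operator (Cb_nonneg J) (T t)))"
    and "0 \<le> \<alpha>" and "1 \<le> K"
    and resolvent_bound:
      "\<And>z. Re z > 0 \<Longrightarrow>
         onorm (inv_into D (\<lambda>x. z *\<^sub>C x + A x)) \<le> K * (Re z powr (- \<alpha>) + 1)"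
  shows "\<exists>C\<ge>0. \<forall>t\<ge>0. norm (T t) \<le> C * K * (t powr \<alpha> + 1)"
proof -
  obtain M w where M: "1 \<le> M" and w: "1 \<le> w" and growth: "\<And>t. 0 \<le> t \<Longrightarrow> norm (T t) \<le> M * exp (w * t)"
    using C0_semigroup_exponentially_bounded[OF semigroup] by blast
  interpret half_plane_resolvent T D A \<alpha> K M w
    by (intro half_plane_resolvent.intro semigroup generator spectrum \<open>0 \<le> \<alpha>\<close> \<open>1 \<le> K\<close>
        resolvent_bound M w growth)
  from condition consider
      (Hilbert) ip where "hilbert_inner (ip :: 'a \<Rightarrow> 'a \<Rightarrow> complex)"
    | (analytic) "asymptotically_analytic T"
    | (Lp) p and \<mu> :: "'m measure" and \<Phi> :: "('m \<Rightarrow> complex) \<Rightarrow> 'a" where "1 \<le> p" "identifies_Lp \<Phi> p \<mu>"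
        "\<forall>t\<ge>0. positive_operator (Lp_nonneg \<Phi> p \<mu>) (T t)"
    | (Cb) J :: "'a \<Rightarrow> ('w :: topological_space \<Rightarrow>\<^sub>C complex)" where "embeds_Cb J" "Cb_banach_lattice (range J)"
        "const_bcontfun 1 \<in> range J \<or> Cb_sublattice (range J)"
        "\<forall>t\<ge>0. positive_operator (Cb_nonneg J) (T t)"
    by blast
  then show ?thesis
  proof cases
    case Hilbert
    then show ?thesis by (rule growth_hilbert)
  next
    case analytic
    then show ?thesis by (rule growth_asymptotically_analytic)
  next
    case Lp
    show ?thesis by (rule growth_Lp[OF Lp(1,2)]) (use Lp(3) in blast)
  next
    case Cb
    show ?thesis by (rule growth_Cb[OF Cb(1-3)]) (use Cb(4) in blast)
  qed
qed

end
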